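(* Let $(T,m)$ be a flow tree. Let $F\in\mathcal{H}(2,1)$. Then, for all $p\in[1,\infty]$, $$\|F(\Sigma,\Sigma^* )\|_{L^p(m)\to L^p(m)}\le\liminf_{q\to\infty}\|F(\Sigma_{\mathbb{T}_q},\Sigma_{\mathbb{T}_q}^* )\|_{L^p(m_{\mathbb{T}_q})\to L^p(m_{\mathbb{T}_q})}.$$ Moreover, for every weight $w:\mathbb{N}\times\mathbb{Z}\times\mathbb{Z}\to[0,\infty)$ which is increasing in the first variable, $$\sup_{y\in T}\sum_{x\in T}w(d(x,y),\ell(x),\ell(y))\,|K_{F(\Sigma,\Sigma^* )}(x,y)|\,m(x)\le\liminf_{q\to\infty}\sup_{y\in\mathbb{T}_q}\sum_{x\in\mathbb{T}_q}w(d_{\mathbb{T}_q}(x,y),\ell(x),\ell(y))\,|K_{F(\Sigma_{\mathbb{T}_q},\Sigma_{\mathbb{T}_q}^* )}(x,y)|\,m_{\mathbb{T}_q}(x).$$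
   Context: Trees. A tree $T$ is an infinite connected graph without cycles, locally finite, identified with its set of vertices and equipped with the graph distance $d$. A tree with root at infinity is such a tree with a fixed boundary point (end) $\omega_*\in\partial T$. For $x\in T$, the predecessor $\mathfrak{p}(x)$ is the neighbour of $x$ lying on the semi-infinite geodesic from $x$ to $\omega_*$; the remaining neighbours form the set $\mathfrak{s}(x)$ of successors. A level function $\ell:T\to\mathbb{Z}$ with $\ell(\mathfrak{p}(x))=\ell(x)+1$ is fixed on each tree (unique up to an additive constant). A flow measure on $T$ is a function $m:T\to(0,\infty)$ with $m(x)=\sum_{y\in\mathfrak{s}(x)}m(y)$ for all $x\in T$, identified with the measure of density $m$ with respect to counting measure; $(T,m)$ is then a flow tree. For a positive integer $q$, $\mathbb{T}_q$ is the homogeneous tree with root at infinity in which every vertex has exactly $q$ successors; it carries the canonical flow measure $m_{\mathbb{T}_q}(x)=q^{\ell(x)}$. The shift operator is $\Sigma f(x)=f(\mathfrak{p}(x))$, and $\Sigma^*f(x)=\frac1{m(x)}\sum_{y\in\mathfrak{s}(x)}f(y)m(y)$ is its adjoint on $L^2(m)$; both have norm at most $1$ on $L^p(m)$ for all $p\in[1,\infty]$. $\Sigma_{\mathbb{T}_q},\Sigma_{\mathbb{T}_q}^*$ are the corresponding operators on $(\mathbb{T}_q,m_{\mathbb{T}_q})$. The integral kernel of an operator $\mathcal{O}$ on $(T,m)$ is defined by $\mathcal{O}f(x)=\sum_yK_{\mathcal{O}}(x,y)f(y)m(y)$ for finitely supported $f$ (and with $m_{\mathbb{T}_q}$ in place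 of $m$ on $\mathbb{T}_q$). $\mathcal{H}(2,1)$ is the set of formal power series in two noncommuting indeterminates $F(Z_1,Z_2)=\sum_{N\in\mathbb{N}}\sum_{\alpha\in\{1,2\}^N}c_\alpha Z_{\alpha_1}\cdots Z_{\alpha_N}$, $c_\alpha\in\mathbb{C}$, with $\sum_N\sum_{\alpha\in\{1,2\}^N}|c_\alpha|<\infty$. For operators $M_1,M_2$ of norm at most $1$, $F(M_1,M_2)=\sum_N\sum_\alpha c_\alpha M_{\alpha_1}\cdots M_{\alpha_N}$ (absolutely convergent in operator norm). Increasing means nondecreasing; $\mathbb{N}$ includes $0$. *)

theory Defs
  imports "HOL-Probability.Essential_Supremum"
begin

section \<open>Trees with root at infinity\<close>

text \<open>
  A simple graph is given by its adjacency relation \<open>E\<close>, and the vertex set is the whole type.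
  (The \<open>tree\<close> predicate of the AFP entry on graph theory is not applicable to undirected graphs
  encoded as symmetric relations: there, the walk \<open>x, y, x\<close> is a cycle.)
\<close>

definition graph_cycle :: "'a rel \<Rightarrow> 'a list \<Rightarrow> bool" where
  "graph_cycle E xs \<longleftrightarrow>
     3 \<le> length xs \<and> distinct xs \<and> (\<forall>i<length xs. (xs ! i, xs ! (Suc i mod length xs)) \<in> E)"

definition infinite_tree :: "'a rel \<Rightarrow> bool" where
  "infinite_tree E \<longleftrightarrow>
     sym E \<and> irrefl E \<and> infinite (UNIV :: 'a set) \<and> (\<forall>x y. (x, y) \<in> E\<^sup>*) \<and>
     (\<nexists>xs. graph_cycle E xs) \<and> (\<forall>x. finite (E `` {x}))"

definition gdist :: "'a rel \<Rightarrow> 'a \<Rightarrow> 'a \<Rightarrow> nat" where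
  "gdist E x y = (LEAST n. (x, y) \<in> E ^^ n)"

definition geodesic_ray :: "'a rel \<Rightarrow> (nat \<Rightarrow> 'a) \<Rightarrow> bool" where
  "geodesic_ray E \<gamma> \<longleftrightarrow> (\<forall>i j. i \<le> j \<longrightarrow> gdist E (\<gamma> i) (\<gamma> j) = j - i)"

text \<open>The boundary consists of the semi-infinite geodesics modulo eventual coincidence up to a shift.\<close>

definition cofinal_rays :: "'a rel \<Rightarrow> (nat \<Rightarrow> 'a) rel" where
  "cofinal_rays E = {(\<gamma>, \<delta>). geodesic_ray E \<gamma> \<and> geodesic_ray E \<delta> \<and>
                             (\<exists>a b. \<forall>n. \<gamma> (n + a) = \<delta> (n + b))}"

definition boundary :: "'a rel \<Rightarrow> (nat \<Rightarrow> 'a) set set" where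
  "boundary E = Collect (geodesic_ray E) // cofinal_rays E"

text \<open>In a tree there is exactly one ray in the class \<open>\<omega>\<close> starting at \<open>x\<close>.\<close>

definition predecessor :: "'a rel \<Rightarrow> (nat \<Rightarrow> 'a) set \<Rightarrow> 'a \<Rightarrow> 'a" where
  "predecessor E \<omega> x = (THE y. \<exists>\<gamma>\<in>\<omega>. \<gamma> 0 = x \<and> \<gamma> 1 = y)"

definition successors :: "'a rel \<Rightarrow> (nat \<Rightarrow> 'a) set \<Rightarrow> 'a \<Rightarrow> 'a set" where
  "successors E \<omega> x = E `` {x} - {predecessor E \<omega> x}"

locale rooted_tree =
  fixes E :: "'a rel" and \<omega> :: "(nat \<Rightarrow> 'a) set" and l :: "'a \<Rightarrow> int"
  assumes tree: "infinite_tree E"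
    and root: "\<omega> \<in> boundary E"
    and level: "l (predecessor E \<omega> x) = l x + 1"

locale flow_tree = rooted_tree E \<omega> l
  for E :: "'a rel" and \<omega> :: "(nat \<Rightarrow> 'a) set" and l :: "'a \<Rightarrow> int" +
  fixes m :: "'a \<Rightarrow> real"
  assumes flow_pos: "0 < m x"
    and flow: "m x = (\<Sum>y\<in>successors E \<omega> x. m y)"

definition homogeneous_tree :: "nat \<Rightarrow> 'a rel \<Rightarrow> (nat \<Rightarrow> 'a) set \<Rightarrow> ('a \<Rightarrow> int) \<Rightarrow> bool" where
  "homogeneous_tree q E \<omega> l \<longleftrightarrow> rooted_tree E \<omega> l \<and> (\<forall>x. card (successors E \<omega> x) = q)"

definition canonical_flow :: "nat \<Rightarrow> ('a \<Rightarrow> int) \<Rightarrow> 'a \<Rightarrow> real" where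
  "canonical_flow q l x = real q powi l x"

section \<open>Operators on functions\<close>

type_synonym 'a operator = "('a \<Rightarrow> complex) \<Rightarrow> 'a \<Rightarrow> complex"

definition shift :: "'a rel \<Rightarrow> (nat \<Rightarrow> 'a) set \<Rightarrow> 'a operator" where
  "shift E \<omega> f x = f (predecessor E \<omega> x)"

definition shift_adj :: "'a rel \<Rightarrow> (nat \<Rightarrow> 'a) set \<Rightarrow> ('a \<Rightarrow> real) \<Rightarrow> 'a operator" where
  "shift_adj E \<omega> m f x = 1 / of_real (m x) * (\<Sum>y\<in>successors E \<omega> x. f y * of_real (m y))"

definition weighted_measure :: "('a \<Rightarrow> real) \<Rightarrow> 'a measure" where
  "weighted_measure m = point_measure UNIV (\<lambda>x. ennreal (m x))"

text \<open>The extended-valued norm: functions outside the Lebesgue space have norm \<open>\<infinity>\<close>.\<close>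

definition Lp_norm :: "'a measure \<Rightarrow> ennreal \<Rightarrow> ('a \<Rightarrow> complex) \<Rightarrow> ennreal" where
  "Lp_norm M p f =
     (if p = \<infinity> then esssup M (\<lambda>x. ennreal (cmod (f x)))
      else let I = (\<integral>\<^sup>+x. ennreal (cmod (f x) powr enn2real p) \<partial>M)
           in if I = \<infinity> then \<infinity> else ennreal (enn2real I powr (1 / enn2real p)))"

definition Lp_opnorm :: "'a measure \<Rightarrow> ennreal \<Rightarrow> 'a operator \<Rightarrow> ennreal" where
  "Lp_opnorm M p A = (SUP f\<in>{f \<in> borel_measurable M. Lp_norm M p f \<le> 1}. Lp_norm M p (A f))"

definition is_integral_kernel :: "('a \<Rightarrow> real) \<Rightarrow> 'a operator \<Rightarrow> ('a \<Rightarrow> 'a \<Rightarrow> complex) \<Rightarrow> bool" where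
  "is_integral_kernel m A K \<longleftrightarrow>
     (\<forall>f. finite {y. f y \<noteq> 0} \<longrightarrow>
        (\<forall>x. A f x = (\<Sum>y | f y \<noteq> 0. K x y * f y * of_real (m y))))"

definition integral_kernel :: "('a \<Rightarrow> real) \<Rightarrow> 'a operator \<Rightarrow> 'a \<Rightarrow> 'a \<Rightarrow> complex" where
  "integral_kernel m A = (THE K. is_integral_kernel m A K)"

section \<open>Power series in two noncommuting indeterminates\<close>

datatype indet = Z1 | Z2

text \<open>A formal power series is the family of its coefficients, indexed by words.\<close>

type_synonym nc_series = "indet list \<Rightarrow> complex"

definition H21 :: "nc_series set" where
  "H21 = {c. summable (\<lambda>N. \<Sum>\<alpha> | length \<alpha> = N. cmod (c \<alpha>))}"

definition nc_word :: "'a operator \<Rightarrow> 'a operator \<Rightarrow> indet list \<Rightarrow> 'a operator" where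
  "nc_word A B \<alpha> = foldr (\<lambda>i. case i of Z1 \<Rightarrow> A | Z2 \<Rightarrow> B) \<alpha>"

definition nc_homogeneous :: "nc_series \<Rightarrow> 'a operator \<Rightarrow> 'a operator \<Rightarrow> nat \<Rightarrow> 'a operator" where
  "nc_homogeneous c A B N f x = (\<Sum>\<alpha> | length \<alpha> = N. c \<alpha> * nc_word A B \<alpha> f x)"

text \<open>
  The operator-norm convergent series \<open>F(A, B)\<close> on a Lebesgue space of a measure charging every
  point can be summed pointwise, since point evaluations are continuous. The pointwise
  definition gives one operator that serves for all exponents; the lemma
  \<open>nc_eval_converges\<close> below shows that it is the sum in operator norm.
\<close>

definition nc_eval :: "nc_series \<Rightarrow> 'a operator \<Rightarrow> 'a operator \<Rightarrow> 'a operator" where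
  "nc_eval c A B f x = (\<Sum>N. nc_homogeneous c A B N f x)"

section \<open>Consistency of the definitions\<close>

lemma integral_kernel_unique:
  assumes m: "\<And>x. 0 < m x" and K: "is_integral_kernel m A K"
  shows "integral_kernel m A = K"
proof -
  have eq: "K' x y = A (\<lambda>z. if z = y then 1 else 0) x / of_real (m y)"
    if "is_integral_kernel m A K'" for K' x y
  proof -
    define f :: "'a \<Rightarrow> complex" where "f = (\<lambda>z. if z = y then 1 else 0)"
    have s: "{z. f z \<noteq> 0} = {y}" by (auto simp: f_def)
    have "finite {z. f z \<noteq> 0}" by (simp add: s)
    then have "A f x = (\<Sum>z | f z \<noteq> 0. K' x z * f z * of_real (m z))"
      by (rule that[unfolded is_integral_kernel_def, rule_format])
    also have "\<dots> = K' x y * of_real (m y)"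
      unfolding s by (simp add: f_def)
    finally show ?thesis using m[of y] by (simp add: f_def)
  qed
  show ?thesis
    unfolding integral_kernel_def
  proof (rule the_equality)
    show "is_integral_kernel m A K" by (rule K)
    fix K' assume "is_integral_kernel m A K'"
    from eq[OF this] eq[OF K] show "K' = K" by (intro ext) (rule trans[OF _ sym])
  qed
qed

lemma finite_words: "finite {\<alpha> :: indet list. length \<alpha> = N}"
proof -
  have "(UNIV :: indet set) = {Z1, Z2}"
    using indet.exhaust by auto
  then have "finite (UNIV :: indet set)" by (rule ssubst) simp
  from finite_lists_length_eq[OF this, of N] show ?thesis by simp
qed

lemma weighted_powr_mean:
  fixes w t :: "'i \<Rightarrow> real"
  assumes S: "finite S" and w: "\<And>i. i \<in> S \<Longrightarrow> 0 \<le> w i" and t: "\<And>i. i \<in> S \<Longrightarrow> 0 \<le> t i"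
    and C: "(\<Sum>i\<in>S. w i) \<le> C" and r: "1 \<le> r"
  shows "(\<Sum>i\<in>S. w i * t i) powr r \<le> C powr (r - 1) * (\<Sum>i\<in>S. w i * t i powr r)"
proof -
  define S' where "S' = {i\<in>S. 0 < w i \<and> 0 < t i}"
  have S': "finite S'" using S by (simp add: S'_def)
  define W where "W = (\<Sum>i\<in>S'. w i)"
  have e1: "(\<Sum>i\<in>S. w i * t i) = (\<Sum>i\<in>S'. w i * t i)"
    by (rule sum.mono_neutral_right) (use S w t in \<open>auto simp: S'_def less_le\<close>)
  have e2: "(\<Sum>i\<in>S. w i * t i powr r) = (\<Sum>i\<in>S'. w i * t i powr r)"
    by (rule sum.mono_neutral_right) (use S w t in \<open>auto simp: S'_def less_le\<close>)
  have nn: "0 \<le> (\<Sum>i\<in>S'. w i * t i powr r)"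
    by (rule sum_nonneg) (auto simp: S'_def)
  have WC: "W \<le> C"
    unfolding W_def by (rule order_trans[OF sum_mono2 C]) (use S w in \<open>auto simp: S'_def\<close>)
  show ?thesis
  proof (cases "S' = {}")
    case True
    then show ?thesis by (simp add: e1 e2)
  next
    case False
    then have W: "0 < W" unfolding W_def by (intro sum_pos S') (auto simp: S'_def)
    have "(\<Sum>i\<in>S'. (w i / W) *\<^sub>R t i) powr r \<le> (\<Sum>i\<in>S'. (w i / W) * (t i powr r))"
    proof (rule convex_on_sum[OF S' False powr_convex[OF r]])
      show "(\<Sum>i\<in>S'. w i / W) = 1"
        using W by (simp add: W_def flip: sum_divide_distrib)
    qed (use W in \<open>auto simp: S'_def\<close>)
    then have "((\<Sum>i\<in>S'. w i * t i) / W) powr r \<le> (\<Sum>i\<in>S'. w i * (t i powr r)) / W"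
      by (simp add: sum_divide_distrib)
    moreover have "0 \<le> (\<Sum>i\<in>S'. w i * t i)"
      by (rule sum_nonneg) (auto simp: S'_def)
    ultimately have "(\<Sum>i\<in>S'. w i * t i) powr r \<le> W powr r * ((\<Sum>i\<in>S'. w i * (t i powr r)) / W)"
      using W by (simp add: powr_divide field_simps)
    also have "\<dots> = W powr (r - 1) * (\<Sum>i\<in>S'. w i * (t i powr r))"
      using W by (simp add: powr_diff)
    also have "\<dots> \<le> C powr (r - 1) * (\<Sum>i\<in>S'. w i * (t i powr r))"
      by (intro mult_right_mono powr_mono2 nn) (use W WC r in auto)
    finally show ?thesis unfolding e1 e2 .
  qed
qed

lemma Lp_norm_le_iff:
  assumes "1 \<le> p" "p < \<infinity>" "0 \<le> C"
  shows "Lp_norm M p f \<le> ennreal C \<longleftrightarrow>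
         (\<integral>\<^sup>+x. ennreal (cmod (f x) powr enn2real p) \<partial>M) \<le> ennreal (C powr enn2real p)"
proof -
  define r where "r = enn2real p"
  have r: "1 \<le> r"
    using assms enn2real_mono[of 1 p] by (simp add: r_def)
  define I where "I = (\<integral>\<^sup>+x. ennreal (cmod (f x) powr r) \<partial>M)"
  show ?thesis
  proof (cases "I = \<infinity>")
    case True
    then show ?thesis using assms by (auto simp: Lp_norm_def I_def r_def top_unique)
  next
    case False
    then obtain J where J: "I = ennreal J" "0 \<le> J" by (cases I) auto
    have "J powr (1 / r) \<le> C \<longleftrightarrow> J \<le> C powr r"
    proof
      assume "J powr (1 / r) \<le> C"
      then have "(J powr (1 / r)) powr r \<le> C powr r" using r by (intro powr_mono2) auto
      then show "J \<le> C powr r" using r J by (simp add: powr_powr)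
    next
      assume "J \<le> C powr r"
      then have "J powr (1 / r) \<le> (C powr r) powr (1 / r)" using r J by (intro powr_mono2) auto
      then show "J powr (1 / r) \<le> C" using r assms by (simp add: powr_powr)
    qed
    then show ?thesis
      using False J assms unfolding Lp_norm_def r_def[symmetric] I_def[symmetric] Let_def
      by (auto simp: ennreal_le_iff)
  qed
qed

lemma AE_weighted_measure:
  assumes "\<And>x. 0 < m x"
  shows "(AE x in weighted_measure m. P x) \<longleftrightarrow> (\<forall>x. P x)"
  unfolding weighted_measure_def using assms by (simp add: AE_point_measure)

lemma Lp_norm_top_le_iff:
  assumes "\<And>x. 0 < m x"
  shows "Lp_norm (weighted_measure m) \<infinity> f \<le> C \<longleftrightarrow> (\<forall>x. ennreal (cmod (f x)) \<le> C)"
proof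
  assume "Lp_norm (weighted_measure m) \<infinity> f \<le> C"
  then have le: "esssup (weighted_measure m) (\<lambda>x. ennreal (cmod (f x))) \<le> C"
    by (simp add: Lp_norm_def)
  have "\<forall>x. ennreal (cmod (f x)) \<le> esssup (weighted_measure m) (\<lambda>x. ennreal (cmod (f x)))"
    using esssup_AE[where M = "weighted_measure m" and f = "\<lambda>x. ennreal (cmod (f x))"]
    by (simp add: AE_weighted_measure[OF assms])
  then show "\<forall>x. ennreal (cmod (f x)) \<le> C"
    by (intro allI order_trans[OF _ le]) simp
next
  assume "\<forall>x. ennreal (cmod (f x)) \<le> C"
  then show "Lp_norm (weighted_measure m) \<infinity> f \<le> C"
    by (auto simp: Lp_norm_def weighted_measure_def intro!: esssup_I)
qed

text \<open>Boundedness of point evaluations.\<close>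

lemma cmod_bounded_of_Lp_norm:
  assumes m: "\<And>x. 0 < m x" and p: "1 \<le> p"
  shows "\<exists>D. \<forall>f. Lp_norm (weighted_measure m) p f \<le> 1 \<longrightarrow> cmod (f x) \<le> D"
proof (cases "p = \<infinity>")
  case True
  have "cmod (f x) \<le> 1" if "Lp_norm (weighted_measure m) p f \<le> 1" for f
    using that True Lp_norm_top_le_iff[of m f 1, OF m] by simp
  then show ?thesis by blast
next
  case False
  define r where "r = enn2real p"
  have p': "p < \<infinity>" using False by (simp add: less_top)
  have r: "1 \<le> r"
    using p p' enn2real_mono[of 1 p] by (simp add: r_def)
  show ?thesis
  proof (intro exI allI impI)
    fix f assume "Lp_norm (weighted_measure m) p f \<le> 1"
    then have "(\<integral>\<^sup>+x. ennreal (cmod (f x) powr r) \<partial>weighted_measure m) \<le> 1"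
      using Lp_norm_le_iff[OF p p', of 1 "weighted_measure m" f] by (simp add: r_def)
    moreover have "(\<integral>\<^sup>+y. ennreal (cmod (f y) powr r) * indicator {x} y \<partial>weighted_measure m)
        \<le> (\<integral>\<^sup>+y. ennreal (cmod (f y) powr r) \<partial>weighted_measure m)"
      by (intro nn_integral_mono) (auto simp: indicator_def)
    moreover have "(\<integral>\<^sup>+y. ennreal (cmod (f y) powr r) * indicator {x} y \<partial>weighted_measure m)
        = ennreal (cmod (f x) powr r) * ennreal (m x)"
      by (subst nn_integral_indicator_singleton)
         (auto simp: weighted_measure_def sets_point_measure emeasure_point_measure_finite2)
    ultimately have "ennreal (cmod (f x) powr r * m x) \<le> ennreal 1"
      using m[of x] by (simp add: ennreal_mult)
    then have "cmod (f x) powr r \<le> 1 / m x"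
      using m[of x] by (simp add: field_simps)
    then have "(cmod (f x) powr r) powr (1 / r) \<le> (1 / m x) powr (1 / r)"
      using r by (intro powr_mono2) auto
    then show "cmod (f x) \<le> (1 / m x) powr (1 / r)"
      using r by (simp add: powr_powr)
  qed
qed

lemma Lp_norm_series_le:
  fixes g :: "'i \<Rightarrow> 'a \<Rightarrow> complex" and W :: "nat \<Rightarrow> 'i set"
  assumes m: "\<And>x. 0 < m x" and p: "1 \<le> p"
    and W: "\<And>N. finite (W N)"
    and g: "\<And>N i. i \<in> W N \<Longrightarrow> Lp_norm (weighted_measure m) p (g i) \<le> 1"
    and c: "summable (\<lambda>N. \<Sum>i\<in>W N. cmod (c i))"
  shows "Lp_norm (weighted_measure m) p (\<lambda>x. \<Sum>N. \<Sum>i\<in>W N. c i * g i x)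
           \<le> ennreal (\<Sum>N. \<Sum>i\<in>W N. cmod (c i))" (is ?bound)
    and "summable (\<lambda>N. \<Sum>i\<in>W N. c i * g i x)" (is ?sum)
proof -
  define M where "M = weighted_measure m"
  define C where "C = (\<Sum>N. \<Sum>i\<in>W N. cmod (c i))"
  have C0: "0 \<le> C" unfolding C_def by (intro suminf_nonneg c sum_nonneg) auto
  have abs_le: "cmod (\<Sum>i\<in>W N. c i * g i x) \<le> (\<Sum>i\<in>W N. cmod (c i) * cmod (g i x))" for N x
    by (rule sum_norm_le) (simp add: norm_mult)
  have D: "\<exists>D. \<forall>N. \<forall>i\<in>W N. cmod (g i x) \<le> D" for x
  proof -
    obtain D where "\<forall>f. Lp_norm (weighted_measure m) p f \<le> 1 \<longrightarrow> cmod (f x) \<le> D"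
      using cmod_bounded_of_Lp_norm[of m p x, OF m p] by blast
    with g show ?thesis by blast
  qed
  have summ: "summable (\<lambda>N. \<Sum>i\<in>W N. cmod (c i) * u (cmod (g i x)))"
    if u0: "\<And>a. 0 \<le> a \<Longrightarrow> 0 \<le> u a" and u: "\<And>a b. 0 \<le> a \<Longrightarrow> a \<le> b \<Longrightarrow> u a \<le> u b" for x and u :: "real \<Rightarrow> real"
  proof -
    obtain D where D: "\<And>N i. i \<in> W N \<Longrightarrow> cmod (g i x) \<le> D" using D[of x] by blast
    show ?thesis
    proof (rule summable_comparison_test'[where N = 0])
      show "summable (\<lambda>N. (\<Sum>i\<in>W N. cmod (c i)) * u D)" by (rule summable_mult2[OF c])
      fix N :: nat
      have "(\<Sum>i\<in>W N. cmod (c i) * u (cmod (g i x))) \<le> (\<Sum>i\<in>W N. cmod (c i) * u D)"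
        by (intro sum_mono mult_left_mono) (auto intro: u D)
      moreover have "0 \<le> (\<Sum>i\<in>W N. cmod (c i) * u (cmod (g i x)))"
        by (intro sum_nonneg mult_nonneg_nonneg u0) auto
      ultimately show "norm (\<Sum>i\<in>W N. cmod (c i) * u (cmod (g i x))) \<le> (\<Sum>i\<in>W N. cmod (c i)) * u D"
        by (simp add: sum_distrib_right)
    qed
  qed
  have summ1: "summable (\<lambda>N. \<Sum>i\<in>W N. cmod (c i) * cmod (g i x))" for x
    using summ[of "\<lambda>a. a"] by simp
  show ?sum
    by (rule summable_comparison_test'[OF summ1[of x], of 0]) (use abs_le in auto)
  have le1: "cmod (\<Sum>N. \<Sum>i\<in>W N. c i * g i x) \<le> (\<Sum>N. \<Sum>i\<in>W N. cmod (c i) * cmod (g i x))" for x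
    by (rule norm_suminf_le[OF abs_le summ1])
  show ?bound
  proof (cases "p = \<infinity>")
    case True
    have "cmod (\<Sum>N. \<Sum>i\<in>W N. c i * g i x) \<le> C" for x
    proof -
      have "cmod (g i x) \<le> 1" if "i \<in> W N" for N i
        using g[OF that] Lp_norm_top_le_iff[of m "g i" 1, OF m] True by simp
      then have "(\<Sum>i\<in>W N. cmod (c i) * cmod (g i x)) \<le> (\<Sum>i\<in>W N. cmod (c i))" for N
        by (intro sum_mono) (simp add: mult_left_le)
      then have "(\<Sum>N. \<Sum>i\<in>W N. cmod (c i) * cmod (g i x)) \<le> C"
        unfolding C_def by (intro suminf_le summ1 c) auto
      then show ?thesis by (rule order_trans[OF le1])
    qed
    then show ?thesis
      unfolding True C_def[symmetric] using Lp_norm_top_le_iff[of m, OF m] by (auto intro: ennreal_leI)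
  next
    case False
    define r where "r = enn2real p"
    have p': "p < \<infinity>" using False by (simp add: less_top)
    have r: "1 \<le> r"
      using p p' enn2real_mono[of 1 p] by (simp add: r_def)
    have gI: "(\<integral>\<^sup>+x. ennreal (cmod (g i x) powr r) \<partial>M) \<le> 1" if "i \<in> W N" for N i
      using g[OF that] Lp_norm_le_iff[OF p p', of 1 M "g i"] by (simp add: r_def M_def)
    define h where "h N x = (\<Sum>i\<in>W N. cmod (c i) * cmod (g i x) powr r)" for N x
    have h0: "0 \<le> h N x" for N x unfolding h_def by (intro sum_nonneg) auto
    have sumh: "summable (\<lambda>N. h N x)" for x
      unfolding h_def using r by (intro summ) (auto intro: powr_mono2)
    have pt: "cmod (\<Sum>N. \<Sum>i\<in>W N. c i * g i x) powr r \<le> C powr (r - 1) * (\<Sum>N. h N x)" for x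
    proof -
      define s where "s k = (\<Sum>N<k. \<Sum>i\<in>W N. cmod (c i) * cmod (g i x))" for k
      have s: "s \<longlonglongrightarrow> (\<Sum>N. \<Sum>i\<in>W N. cmod (c i) * cmod (g i x))"
        unfolding s_def by (rule summable_LIMSEQ[OF summ1])
      have "s k powr r \<le> C powr (r - 1) * (\<Sum>N. h N x)" for k
      proof -
        have "(\<Sum>z\<in>Sigma {..<k} W. cmod (c (snd z))) = (\<Sum>N<k. \<Sum>i\<in>W N. cmod (c i))"
          using sum.Sigma[of "{..<k}" W "\<lambda>_ i. cmod (c i)"] W by (simp add: split_def)
        also have "\<dots> \<le> C"
          unfolding C_def by (intro sum_le_suminf c) (auto intro: sum_nonneg)
        finally have "(\<Sum>z\<in>Sigma {..<k} W. cmod (c (snd z))) \<le> C" .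
        from weighted_powr_mean[OF _ _ _ this r, of "\<lambda>z. cmod (g (snd z) x)"]
        have "(\<Sum>z\<in>Sigma {..<k} W. cmod (c (snd z)) * cmod (g (snd z) x)) powr r
            \<le> C powr (r - 1) * (\<Sum>z\<in>Sigma {..<k} W. cmod (c (snd z)) * cmod (g (snd z) x) powr r)"
          using W by simp
        then have "s k powr r \<le> C powr (r - 1) * (\<Sum>N<k. h N x)"
          using sum.Sigma[of "{..<k}" W "\<lambda>_ i. cmod (c i) * cmod (g i x)"]
            sum.Sigma[of "{..<k}" W "\<lambda>_ i. cmod (c i) * cmod (g i x) powr r"] W
          by (simp add: s_def h_def split_def)
        also have "\<dots> \<le> C powr (r - 1) * (\<Sum>N. h N x)"
          by (intro mult_left_mono sum_le_suminf sumh) (auto simp: h0)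
        finally show ?thesis .
      qed
      moreover have "(\<lambda>k. s k powr r) \<longlonglongrightarrow> (\<Sum>N. \<Sum>i\<in>W N. cmod (c i) * cmod (g i x)) powr r"
        by (rule tendsto_powr2[OF s tendsto_const])
           (use r in \<open>auto simp: s_def intro!: always_eventually sum_nonneg\<close>)
      ultimately have "(\<Sum>N. \<Sum>i\<in>W N. cmod (c i) * cmod (g i x)) powr r \<le> C powr (r - 1) * (\<Sum>N. h N x)"
        by (intro LIMSEQ_le_const2) auto
      moreover have "cmod (\<Sum>N. \<Sum>i\<in>W N. c i * g i x) powr r
          \<le> (\<Sum>N. \<Sum>i\<in>W N. cmod (c i) * cmod (g i x)) powr r"
        using r by (intro powr_mono2 le1) auto
      ultimately show ?thesis by linarith
    qed
    have meas: "u \<in> borel_measurable M" for u :: "'a \<Rightarrow> ennreal"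
      by (simp add: M_def weighted_measure_def)
    have "(\<integral>\<^sup>+x. ennreal (cmod (\<Sum>N. \<Sum>i\<in>W N. c i * g i x) powr r) \<partial>M)
        \<le> (\<integral>\<^sup>+x. ennreal (C powr (r - 1)) * (\<Sum>N. ennreal (h N x)) \<partial>M)"
    proof (rule nn_integral_mono)
      fix x
      show "ennreal (cmod (\<Sum>N. \<Sum>i\<in>W N. c i * g i x) powr r)
          \<le> ennreal (C powr (r - 1)) * (\<Sum>N. ennreal (h N x))"
        using ennreal_leI[OF pt[of x]]
        by (simp add: suminf_ennreal2[OF h0 sumh] ennreal_mult' suminf_nonneg[OF sumh h0])
    qed
    also have "\<dots> = ennreal (C powr (r - 1)) * (\<Sum>N. \<integral>\<^sup>+x. ennreal (h N x) \<partial>M)"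
      by (subst nn_integral_cmult[OF meas], subst nn_integral_suminf[OF meas]) simp
    also have "\<dots> \<le> ennreal (C powr (r - 1)) * (\<Sum>N. ennreal (\<Sum>i\<in>W N. cmod (c i)))"
    proof (intro mult_left_mono suminf_le)
      fix N
      have "(\<integral>\<^sup>+x. ennreal (h N x) \<partial>M)
          = (\<integral>\<^sup>+x. (\<Sum>i\<in>W N. ennreal (cmod (c i)) * ennreal (cmod (g i x) powr r)) \<partial>M)"
        unfolding h_def by (simp add: sum_ennreal[symmetric] ennreal_mult)
      also have "\<dots> = (\<Sum>i\<in>W N. ennreal (cmod (c i)) * (\<integral>\<^sup>+x. ennreal (cmod (g i x) powr r) \<partial>M))"
        by (subst nn_integral_sum[OF meas]) (simp add: nn_integral_cmult[OF meas])
      also have "\<dots> \<le> (\<Sum>i\<in>W N. ennreal (cmod (c i)) * 1)"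
        by (intro sum_mono mult_left_mono gI) auto
      finally show "(\<integral>\<^sup>+x. ennreal (h N x) \<partial>M) \<le> ennreal (\<Sum>i\<in>W N. cmod (c i))"
        by simp
    qed auto
    also have "\<dots> = ennreal (C powr (r - 1) * C)"
      using C0 by (simp add: suminf_ennreal2[OF _ c] sum_nonneg C_def ennreal_mult')
    also have "C powr (r - 1) * C = C powr r"
      using C0 r by (cases "C = 0") (auto simp: powr_diff)
    finally show ?thesis
      using Lp_norm_le_iff[OF p p' C0, of M] by (simp add: r_def M_def C_def)
  qed
qed

lemma nc_eval_converges:
  assumes m: "\<And>x. 0 < m x" and p: "1 \<le> p" and c: "c \<in> H21"
    and A: "\<And>f. Lp_norm (weighted_measure m) p (A f) \<le> Lp_norm (weighted_measure m) p f"
    and B: "\<And>f. Lp_norm (weighted_measure m) p (B f) \<le> Lp_norm (weighted_measure m) p f"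
  shows "(\<lambda>n. Lp_opnorm (weighted_measure m) p
           (\<lambda>f x. nc_eval c A B f x - (\<Sum>N<n. nc_homogeneous c A B N f x))) \<longlonglongrightarrow> 0"
proof -
  define a where "a N = (\<Sum>\<alpha> | length \<alpha> = N. cmod (c \<alpha>))" for N
  have a: "summable a" using c by (simp add: H21_def a_def[abs_def])
  have word: "Lp_norm (weighted_measure m) p (nc_word A B \<alpha> f) \<le> Lp_norm (weighted_measure m) p f"
    for \<alpha> f
  proof (induction \<alpha>)
    case (Cons i \<alpha>)
    show ?case
    proof (cases i)
      case Z1
      then show ?thesis using order_trans[OF A Cons.IH] by (simp add: nc_word_def)
    next
      case Z2
      then show ?thesis using order_trans[OF B Cons.IH] by (simp add: nc_word_def)
    qed
  qed (simp add: nc_word_def)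
  have bound: "Lp_opnorm (weighted_measure m) p
      (\<lambda>f x. nc_eval c A B f x - (\<Sum>N<n. nc_homogeneous c A B N f x)) \<le> ennreal (\<Sum>N. a (N + n))" for n
    unfolding Lp_opnorm_def
  proof (rule SUP_least)
    fix f assume "f \<in> {f \<in> borel_measurable (weighted_measure m). Lp_norm (weighted_measure m) p f \<le> 1}"
    then have f: "Lp_norm (weighted_measure m) p (nc_word A B \<alpha> f) \<le> 1" for \<alpha>
      using order_trans[OF word[of \<alpha> f], of 1] by simp
    have "summable (\<lambda>N. nc_homogeneous c A B N f x)" for x
      using Lp_norm_series_le(2)[of m p "\<lambda>N. {\<alpha>. length \<alpha> = N}" "\<lambda>\<alpha>. nc_word A B \<alpha> f" c x,
          OF m p finite_words f] a
      by (simp add: nc_homogeneous_def a_def[abs_def])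
    then have "(\<lambda>x. nc_eval c A B f x - (\<Sum>N<n. nc_homogeneous c A B N f x))
        = (\<lambda>x. \<Sum>N. nc_homogeneous c A B (N + n) f x)"
      unfolding nc_eval_def by (intro ext) (rule suminf_minus_initial_segment[symmetric])
    then show "Lp_norm (weighted_measure m) p
        (\<lambda>x. nc_eval c A B f x - (\<Sum>N<n. nc_homogeneous c A B N f x)) \<le> ennreal (\<Sum>N. a (N + n))"
      using Lp_norm_series_le(1)[of m p "\<lambda>N. {\<alpha>. length \<alpha> = N + n}" "\<lambda>\<alpha>. nc_word A B \<alpha> f" c,
          OF m p finite_words f] summable_ignore_initial_segment[OF a, of n]
      by (simp add: nc_homogeneous_def a_def)
  qed
  have "(\<lambda>n. ennreal (\<Sum>N. a (N + n))) \<longlonglongrightarrow> ennreal 0"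
    by (intro tendsto_ennrealI suminf_exist_split2[OF a])
  then have "(\<lambda>n. ennreal (\<Sum>N. a (N + n))) \<longlonglongrightarrow> 0"
    by simp
  from tendsto_sandwich[OF _ _ tendsto_const this] show ?thesis
    using bound by simp
qed

text \<open>Series in linear contractions have an integral kernel; exponent \<open>\<infinity>\<close> suffices.\<close>

lemma is_integral_kernel_nc_eval:
  fixes A B :: "'a operator"
  assumes m: "\<And>x. 0 < m x" and c: "c \<in> H21"
    and linA: "\<And>(S :: 'a set) k g. finite S \<Longrightarrow> A (\<lambda>x. \<Sum>y\<in>S. k y * g y x) = (\<lambda>x. \<Sum>y\<in>S. k y * A (g y) x)"
    and linB: "\<And>(S :: 'a set) k g. finite S \<Longrightarrow> B (\<lambda>x. \<Sum>y\<in>S. k y * g y x) = (\<lambda>x. \<Sum>y\<in>S. k y * B (g y) x)"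
    and A: "\<And>f. Lp_norm (weighted_measure m) \<infinity> (A f) \<le> Lp_norm (weighted_measure m) \<infinity> f"
    and B: "\<And>f. Lp_norm (weighted_measure m) \<infinity> (B f) \<le> Lp_norm (weighted_measure m) \<infinity> f"
  shows "is_integral_kernel m (nc_eval c A B) (integral_kernel m (nc_eval c A B))"
proof -
  define \<delta> :: "'a \<Rightarrow> 'a \<Rightarrow> complex" where "\<delta> y x = (if x = y then 1 else 0)" for y x
  define K where "K x y = nc_eval c A B (\<delta> y) x / of_real (m y)" for x y
  have word: "Lp_norm (weighted_measure m) \<infinity> (nc_word A B \<alpha> (\<delta> y)) \<le> 1" for \<alpha> y
  proof (induction \<alpha>)
    case Nil
    show ?case
      unfolding Lp_norm_top_le_iff[of m, OF m] by (simp add: nc_word_def \<delta>_def)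
  next
    case (Cons i \<alpha>)
    show ?case
    proof (cases i)
      case Z1
      then show ?thesis using order_trans[OF A Cons.IH] by (simp add: nc_word_def)
    next
      case Z2
      then show ?thesis using order_trans[OF B Cons.IH] by (simp add: nc_word_def)
    qed
  qed
  have summ: "summable (\<lambda>N. nc_homogeneous c A B N (\<delta> y) x)" for x y
    using Lp_norm_series_le(2)[of m \<infinity> "\<lambda>N. {\<alpha>. length \<alpha> = N}" "\<lambda>\<alpha>. nc_word A B \<alpha> (\<delta> y)" c x,
        OF m _ finite_words word] c
    by (simp add: nc_homogeneous_def H21_def)
  have "is_integral_kernel m (nc_eval c A B) K"
    unfolding is_integral_kernel_def
  proof (intro allI impI)
    fix f :: "'a \<Rightarrow> complex" and x
    assume "finite {y. f y \<noteq> 0}"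
    moreover define S where "S = {y. f y \<noteq> 0}"
    ultimately have S: "finite S" by simp
    have f: "f = (\<lambda>x. \<Sum>y\<in>S. f y * \<delta> y x)"
    proof
      fix x
      have "(\<Sum>y\<in>S. f y * \<delta> y x) = (\<Sum>y\<in>S. if x = y then f y else 0)"
        by (rule sum.cong) (auto simp: \<delta>_def)
      then show "f x = (\<Sum>y\<in>S. f y * \<delta> y x)"
        using S by (simp add: sum.delta S_def)
    qed
    have lin: "nc_word A B \<alpha> f = (\<lambda>x. \<Sum>y\<in>S. f y * nc_word A B \<alpha> (\<delta> y) x)" for \<alpha>
    proof (induction \<alpha>)
      case Nil
      show ?case using f by (simp add: nc_word_def)
    next
      case (Cons i \<alpha>)
      have "nc_word A B (i # \<alpha>) g = (case i of Z1 \<Rightarrow> A | Z2 \<Rightarrow> B) (nc_word A B \<alpha> g)" for g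
        by (simp add: nc_word_def)
      then show ?case
        using linA[OF S] linB[OF S] by (cases i) (simp_all add: Cons.IH)
    qed
    have "nc_homogeneous c A B N f x = (\<Sum>y\<in>S. f y * nc_homogeneous c A B N (\<delta> y) x)" for N
      unfolding nc_homogeneous_def lin sum_distrib_left
      by (subst sum.swap) (simp add: mult_ac)
    then have "nc_eval c A B f x = (\<Sum>y\<in>S. \<Sum>N. f y * nc_homogeneous c A B N (\<delta> y) x)"
      unfolding nc_eval_def by (simp add: suminf_sum summable_mult summ)
    also have "\<dots> = (\<Sum>y\<in>S. f y * nc_eval c A B (\<delta> y) x)"
      unfolding nc_eval_def by (simp add: suminf_mult summ)
    also have "\<dots> = (\<Sum>y\<in>S. K x y * f y * of_real (m y))"
    proof (rule sum.cong)
      fix y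
      show "f y * nc_eval c A B (\<delta> y) x = K x y * f y * of_real (m y)"
        using m[of y] by (simp add: K_def)
    qed simp
    finally show "nc_eval c A B f x = (\<Sum>y | f y \<noteq> 0. K x y * f y * of_real (m y))"
      by (simp add: S_def)
  qed
  with integral_kernel_unique[of m, OF m this] show ?thesis by simp
qed

end

theory Submission
  imports Defs
begin

text \<open>
  Fix a top vertex \<open>t\<close> of \<open>T\<close>. Rounding \<open>q m(y) / m(x)\<close> to integers \<open>k\<^sub>q(y)\<close> that sum to \<open>q\<close> over the
  successors \<open>y\<close> of each \<open>x\<close>, one maps the descendants of a vertex of the homogeneous tree, level by
  level, to the descendants of \<open>t\<close> so that a vertex over \<open>x\<close> has exactly \<open>k\<^sub>q(y)\<close> successors over \<open>y\<close>.
  Composition with this map intertwines words in the two shift operators on the homogeneous tree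
  with words in \<open>\<Sigma>\<close> and a perturbed average that converges to \<open>\<Sigma>\<^sup>*\<close>, at all vertices deeper below the
  top than the length of the word; the measures of its fibres converge, up to one common factor, to
  \<open>m\<close>. The norm inequality follows by transplanting finitely supported functions. For the kernels,
  \<open>K(x, y) m(x)\<close> is the value at \<open>y\<close> of the transposed series applied to the indicator of \<open>x\<close>, so the
  sum of the kernel over a fibre is approximately the kernel of \<open>T\<close>, and the map does not increase
  distances.
\<close>

section \<open>Walks in trees\<close>

text \<open>The ratios \<open>m y / m x\<close> may be irrational, so in general no homogeneous tree
  covers \<open>T\<close> with fibres of exactly the right masses; hence the rounding and the limit
  in \<open>q\<close>. The order of choices is what makes the limit work: a strict lower bound for a
  norm or a kernel sum is witnessed on a finite set of vertices, and absolute summability of the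
  coefficients makes long words negligible uniformly in \<open>q\<close>. Only then is
  \<open>t\<close> chosen, as a common ancestor lying high enough above this set that the remaining
  words never see the edge of the cone, and \<open>q\<close> grows last. Transposition is forced by
  the variables of the kernel: the indicator of one vertex of the homogeneous tree is in general not
  a lift, while the indicator of a whole fibre is, and the fibre has to belong to the variable that
  is summed. Summing over a fibre before taking absolute values can only lose mass, and shrinking
  distances can only lower an increasing weight; both losses point in the direction of the claimed
  inequality.\<close>

text \<open>Walks without backtracking, a purely local condition. Distinctness of the vertices is
  not demanded but follows from acyclicity, so two walks can be glued by inspecting the junction
  only.\<close>

definition walk :: "'a rel \<Rightarrow> 'a list \<Rightarrow> bool" where
  "walk E xs \<longleftrightarrow> (\<forall>i. Suc i < length xs \<longrightarrow> (xs ! i, xs ! Suc i) \<in> E) \<and>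
     (\<forall>i. Suc (Suc i) < length xs \<longrightarrow> xs ! i \<noteq> xs ! Suc (Suc i))"

lemma walk_Cons_Cons:
  "walk E (x # y # xs) \<longleftrightarrow> (x, y) \<in> E \<and> (xs \<noteq> [] \<longrightarrow> x \<noteq> hd xs) \<and> walk E (y # xs)"
proof
  assume w: "walk E (x # y # xs)"
  have "(x, y) \<in> E" using w unfolding walk_def by (auto dest: spec[of _ 0])
  moreover have "xs \<noteq> [] \<longrightarrow> x \<noteq> hd xs"
    using w unfolding walk_def by (auto dest: spec[of _ 0] simp: hd_conv_nth)
  moreover have "walk E (y # xs)"
    unfolding walk_def
  proof (intro conjI allI impI)
    fix i assume "Suc i < length (y # xs)"
    then show "((y # xs) ! i, (y # xs) ! Suc i) \<in> E"
      using w unfolding walk_def by (auto dest: spec[of _ "Suc i"])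
  next
    fix i assume "Suc (Suc i) < length (y # xs)"
    then show "(y # xs) ! i \<noteq> (y # xs) ! Suc (Suc i)"
      using conjunct2[OF w[unfolded walk_def], rule_format, of "Suc i"] by auto
  qed
  ultimately show "(x, y) \<in> E \<and> (xs \<noteq> [] \<longrightarrow> x \<noteq> hd xs) \<and> walk E (y # xs)" by blast
next
  assume a: "(x, y) \<in> E \<and> (xs \<noteq> [] \<longrightarrow> x \<noteq> hd xs) \<and> walk E (y # xs)"
  show "walk E (x # y # xs)"
    unfolding walk_def
  proof (intro conjI allI impI)
    fix i assume "Suc i < length (x # y # xs)"
    then show "((x # y # xs) ! i, (x # y # xs) ! Suc i) \<in> E"
      using a unfolding walk_def by (cases i) auto
  next
    fix i assume "Suc (Suc i) < length (x # y # xs)"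
    then show "(x # y # xs) ! i \<noteq> (x # y # xs) ! Suc (Suc i)"
      using a unfolding walk_def by (cases i) (auto simp: hd_conv_nth)
  qed
qed

text \<open>The vertices of \<open>xs\<close> are moved in front of \<open>ys\<close> one at a time;
  the only place where backtracking could arise is \<open>x\<close>, and there the two first steps
  differ.\<close>

lemma walk_rev_append:
  assumes "sym E" "walk E (x # xs)" "walk E (x # ys)" "xs \<noteq> []" "ys \<noteq> []" "hd xs \<noteq> hd ys"
  shows "walk E (rev xs @ x # ys)"
  using assms
proof (induction xs arbitrary: x ys)
  case (Cons a xs)
  have wa: "walk E (a # xs)" and ea: "(a, x) \<in> E"
    using Cons.prems(2) symD[OF Cons.prems(1)] by (auto simp: walk_Cons_Cons)
  have w2: "walk E (a # x # ys)"
    using ea Cons.prems by (simp add: walk_Cons_Cons)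
  show ?case
  proof (cases xs)
    case Nil
    then show ?thesis using w2 by simp
  next
    case (Cons b xs')
    then show ?thesis
      using Cons.IH[OF Cons.prems(1) wa w2] Cons.prems(2) by (auto simp: walk_Cons_Cons)
  qed
qed simp

text \<open>Two equal entries at the smallest possible gap \<open>d\<close> bound a cycle:
  minimality makes the entries between them distinct, irreflexivity excludes \<open>d = 1\<close>,
  and the absence of backtracking excludes \<open>d = 2\<close>.\<close>

lemma walk_distinct:
  assumes irr: "irrefl E" and acyc: "\<nexists>xs. graph_cycle E xs" and w: "walk E xs"
  shows "distinct xs"
proof (rule ccontr)
  assume "\<not> distinct xs"
  define P where "P d \<longleftrightarrow> 0 < d \<and> (\<exists>i. i + d < length xs \<and> xs ! i = xs ! (i + d))" for d
  have "\<exists>d. P d"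
  proof -
    obtain i j where "i < j" "j < length xs" "xs ! i = xs ! j"
      using \<open>\<not> distinct xs\<close> by (metis distinct_conv_nth nat_neq_iff)
    then have "P (j - i)" by (auto simp: P_def intro!: exI[of _ i])
    then show ?thesis ..
  qed
  define d where "d = (LEAST d. P d)"
  have "P d" unfolding d_def by (rule LeastI_ex) fact
  then obtain i where d: "0 < d" and i: "i + d < length xs" "xs ! i = xs ! (i + d)"
    by (auto simp: P_def)
  have least: "\<not> P e" if "e < d" for e using that not_less_Least d_def by blast
  have edge: "(xs ! j, xs ! Suc j) \<in> E" if "Suc j < length xs" for j
    using w that by (auto simp: walk_def)
  have "d \<noteq> 1" using i edge[of i] irr by (auto simp: irrefl_def)
  moreover have "d \<noteq> 2" using i w by (auto simp: walk_def numeral_2_eq_2)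
  ultimately have d3: "3 \<le> d" using d by auto
  define ys where "ys = take d (drop i xs)"
  have len: "length ys = d" using i by (simp add: ys_def)
  have nth: "ys ! j = xs ! (i + j)" if "j < d" for j using that i by (simp add: ys_def)
  have "distinct ys"
    unfolding distinct_conv_nth
  proof (intro allI impI)
    fix a b assume ab: "a < length ys" "b < length ys" "a \<noteq> b"
    have *: "ys ! a \<noteq> ys ! b" if "a < b" "b < d" for a b
    proof
      assume "ys ! a = ys ! b"
      then have "P (b - a)" using that i by (auto simp: P_def nth intro!: exI[of _ "i + a"])
      then show False using least[of "b - a"] that by auto
    qed
    show "ys ! a \<noteq> ys ! b" using *[of a b] *[of b a] ab len by (metis nat_neq_iff)
  qed
  moreover have "(ys ! j, ys ! (Suc j mod length ys)) \<in> E" if j: "j < length ys" for j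
  proof (cases "Suc j = d")
    \<comment> \<open>The closing edge: \<open>ys ! 0\<close> is \<open>xs ! i\<close>, which equals
      \<open>xs ! (i + d)\<close>.\<close>
    case True
    then show ?thesis using edge[of "i + j"] i d nth[of 0] nth[of j] len by auto
  next
    case False
    then show ?thesis using edge[of "i + j"] i d nth[of "Suc j"] nth[of j] len j by auto
  qed
  ultimately have "graph_cycle E ys" using d3 len by (simp add: graph_cycle_def)
  then show False using acyc by blast
qed

text \<open>If the first steps differ, running one walk backwards and then the other forwards is a
  walk whose two ends coincide, against distinctness.\<close>

lemma walk_unique:
  assumes E: "sym E" "irrefl E" "\<nexists>xs. graph_cycle E xs"
  shows "walk E (x # xs) \<Longrightarrow> walk E (x # ys) \<Longrightarrow> last (x # xs) = last (x # ys) \<Longrightarrow> xs = ys"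
proof (induction xs arbitrary: x ys)
  case Nil
  have "distinct (x # ys)" by (rule walk_distinct[OF E(2,3) Nil(2)])
  then show ?case using Nil(3) by (cases "ys = []") auto
next
  case (Cons a xs)
  have dx: "distinct (x # a # xs)" by (rule walk_distinct[OF E(2,3) Cons(2)])
  have dy: "distinct (x # ys)" by (rule walk_distinct[OF E(2,3) Cons(3)])
  obtain b ys' where ys: "ys = b # ys'"
    using Cons.prems(3) dx by (cases ys) (auto split: if_splits)
  show ?case
  proof (cases "a = b")
    case True
    have "walk E (a # xs)" "walk E (a # ys')"
      using Cons.prems ys True by (auto simp: walk_Cons_Cons)
    moreover have "last (a # xs) = last (a # ys')" using Cons.prems(3) ys True by simp
    ultimately show ?thesis using Cons.IH ys True by blast
  next
    case False
    have "walk E (rev (a # xs) @ x # ys)"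
      by (rule walk_rev_append) (use E Cons.prems ys False in auto)
    then have "distinct (rev (a # xs) @ x # ys)" by (rule walk_distinct[OF E(2,3)])
    moreover have "last (a # xs) = last ys" using Cons.prems(3) ys by simp
    moreover have "last (a # xs) \<in> set (rev (a # xs))" using last_in_set[of "a # xs"] by auto
    moreover have "last ys \<in> set ys" using ys by (intro last_in_set) simp
    ultimately show ?thesis by (auto simp del: last.simps)
  qed
qed

lemma gdist_le: "(x, y) \<in> E ^^ n \<Longrightarrow> gdist E x y \<le> n"
  unfolding gdist_def by (rule Least_le)

lemma relpow_gdist:
  assumes "(x, y) \<in> E\<^sup>*" shows "(x, y) \<in> E ^^ gdist E x y"
  unfolding gdist_def using rtrancl_imp_relpow[OF assms] by (rule LeastI_ex)

section \<open>The predecessor map of a tree with root at infinity\<close>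

text \<open>In a tree these are the geodesic rays (\<open>geodesic_ray_iff\<close>); the local form
  makes prepending a vertex easy to check.\<close>

definition nb_ray :: "'a rel \<Rightarrow> (nat \<Rightarrow> 'a) \<Rightarrow> bool" where
  "nb_ray E \<gamma> \<longleftrightarrow> (\<forall>n. (\<gamma> n, \<gamma> (Suc n)) \<in> E \<and> \<gamma> n \<noteq> \<gamma> (Suc (Suc n)))"

lemma nb_ray_walk: "nb_ray E \<gamma> \<Longrightarrow> walk E (map \<gamma> [i..<j])"
  unfolding nb_ray_def walk_def by (auto simp: nth_append)

lemma nb_ray_shift: "nb_ray E \<gamma> \<Longrightarrow> nb_ray E (\<lambda>n. \<gamma> (n + k))"
  unfolding nb_ray_def by auto

context rooted_tree
begin

abbreviation "par \<equiv> predecessor E \<omega>"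

lemma tree': "sym E" "irrefl E" "\<nexists>xs. graph_cycle E xs" "(x, y) \<in> E\<^sup>*" "finite (E `` {x})"
  using tree by (auto simp: infinite_tree_def)

text \<open>From local to global: a shortest path between two points of the ray is itself a walk,
  and walks with given ends are unique, so it is as long as the segment of the ray.\<close>

lemma geodesic_ray_iff: "geodesic_ray E \<gamma> \<longleftrightarrow> nb_ray E \<gamma>"
proof
  assume g: "geodesic_ray E \<gamma>"
  have d: "(\<gamma> i, \<gamma> j) \<in> E ^^ (j - i)" "gdist E (\<gamma> i) (\<gamma> j) = j - i" if "i \<le> j" for i j
    using g that relpow_gdist[OF tree'(4), of "\<gamma> i" "\<gamma> j"] by (auto simp: geodesic_ray_def)
  show "nb_ray E \<gamma>"
    unfolding nb_ray_def
  proof (intro allI conjI)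
    fix n
    show "(\<gamma> n, \<gamma> (Suc n)) \<in> E" using d(1)[of n "Suc n"] by simp
    have "gdist E (\<gamma> n) (\<gamma> n) = 0" using d(2)[of n n] by simp
    then show "\<gamma> n \<noteq> \<gamma> (Suc (Suc n))" using d(2)[of n "Suc (Suc n)"] by auto
  qed
next
  assume nb: "nb_ray E \<gamma>"
  show "geodesic_ray E \<gamma>"
    unfolding geodesic_ray_def
  proof (intro allI impI)
    fix i j :: nat assume ij: "i \<le> j"
    have e2: "map \<gamma> [i..<Suc j] = \<gamma> i # map \<gamma> [Suc i..<Suc j]"
      using ij upt_conv_Cons[of i "Suc j"] by simp
    define n where "n = gdist E (\<gamma> i) (\<gamma> j)"
    obtain f where f: "f 0 = \<gamma> i" "f n = \<gamma> j" "\<And>k. k < n \<Longrightarrow> (f k, f (Suc k)) \<in> E"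
      using relpow_gdist[OF tree'(4), of "\<gamma> i" "\<gamma> j"]
      unfolding n_def[symmetric] relpow_fun_conv by auto
    \<comment> \<open>A backtrack could be cut out of the path, making it shorter by two.\<close>
    have "f k \<noteq> f (Suc (Suc k))" if k: "Suc (Suc k) \<le> n" for k
    proof
      assume eq: "f k = f (Suc (Suc k))"
      have "(\<gamma> i, f k) \<in> E ^^ k"
        unfolding relpow_fun_conv by (rule exI[of _ f]) (use f k in auto)
      moreover have "(f k, \<gamma> j) \<in> E ^^ (n - Suc (Suc k))"
        unfolding relpow_fun_conv
        by (rule exI[of _ "\<lambda>a. f (a + Suc (Suc k))"]) (use f k eq in \<open>auto simp del: add_Suc_right\<close>)
      ultimately have "(\<gamma> i, \<gamma> j) \<in> E ^^ (k + (n - Suc (Suc k)))"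
        by (auto simp: relpow_add)
      from gdist_le[OF this] show False using k by (simp add: n_def[symmetric])
    qed
    then have "walk E (map f [0..<Suc n])"
      using f unfolding walk_def by (auto simp del: upt_Suc)
    moreover have e1: "map f [0..<Suc n] = \<gamma> i # map f [1..<Suc n]"
      using f(1) upt_conv_Cons[of 0 "Suc n"] by simp
    ultimately have w1: "walk E (\<gamma> i # map f [1..<Suc n])" by simp
    have "last (map f [0..<Suc n]) = last (map \<gamma> [i..<Suc j])" using f(2) ij by simp
    then have last: "last (\<gamma> i # map f [1..<Suc n]) = last (\<gamma> i # map \<gamma> [Suc i..<Suc j])"
      unfolding e1 e2 .
    have w2: "walk E (\<gamma> i # map \<gamma> [Suc i..<Suc j])"
      using nb_ray_walk[OF nb, of i "Suc j"] unfolding e2 .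
    have "map f [1..<Suc n] = map \<gamma> [Suc i..<Suc j]"
      by (rule walk_unique[OF tree'(1-3) w1 w2 last])
    then have "length (map f [1..<Suc n]) = length (map \<gamma> [Suc i..<Suc j])" by simp
    then show "gdist E (\<gamma> i) (\<gamma> j) = j - i" by (simp add: n_def del: upt_Suc)
  qed
qed

section \<open>Rays towards the fixed end and the predecessor map\<close>

lemma boundary_rays:
  obtains \<gamma> where "\<gamma> \<in> \<omega>" and "\<And>\<delta>. \<delta> \<in> \<omega> \<longleftrightarrow> nb_ray E \<delta> \<and> (\<exists>a b. \<forall>n. \<gamma> (n + a) = \<delta> (n + b))"
proof -
  obtain \<gamma> where g: "geodesic_ray E \<gamma>" and w: "\<omega> = cofinal_rays E `` {\<gamma>}"
    using root unfolding boundary_def quotient_def by auto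
  have iff: "\<delta> \<in> \<omega> \<longleftrightarrow> nb_ray E \<delta> \<and> (\<exists>a b. \<forall>n. \<gamma> (n + a) = \<delta> (n + b))" for \<delta>
    using g unfolding w cofinal_rays_def by (auto simp: geodesic_ray_iff)
  have "\<gamma> \<in> \<omega>" unfolding iff using g by (auto simp: geodesic_ray_iff)
  with iff show ?thesis using that by blast
qed

lemma rays_nb: "\<gamma> \<in> \<omega> \<Longrightarrow> nb_ray E \<gamma>"
  by (rule boundary_rays) auto

lemma rays_cofinal:
  assumes "\<gamma> \<in> \<omega>" "\<delta> \<in> \<omega>" shows "\<exists>a b. \<forall>n. \<gamma> (n + a) = \<delta> (n + b)"
proof (rule boundary_rays)
  fix \<beta> assume iff: "\<And>\<delta>. \<delta> \<in> \<omega> \<longleftrightarrow> nb_ray E \<delta> \<and> (\<exists>a b. \<forall>n. \<beta> (n + a) = \<delta> (n + b))"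
  from assms obtain a b a' b' where *: "\<forall>n. \<beta> (n + a) = \<gamma> (n + b)" "\<forall>n. \<beta> (n + a') = \<delta> (n + b')"
    unfolding iff by blast
  have "\<gamma> (n + (a' + b)) = \<delta> (n + (a + b'))" for n
    using *(1)[rule_format, of "n + a'"] *(2)[rule_format, of "n + a"] by (simp add: algebra_simps)
  then show ?thesis by blast
qed

lemma ray_extends:
  assumes "\<gamma> \<in> \<omega>" and "nb_ray E \<delta>" and "\<And>n. \<gamma> (n + a) = \<delta> (n + b)"
  shows "\<delta> \<in> \<omega>"
proof (rule boundary_rays)
  fix \<beta> assume iff: "\<And>\<delta>. \<delta> \<in> \<omega> \<longleftrightarrow> nb_ray E \<delta> \<and> (\<exists>a b. \<forall>n. \<beta> (n + a) = \<delta> (n + b))"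
  from assms(1) obtain c d where *: "\<forall>n. \<beta> (n + c) = \<gamma> (n + d)" unfolding iff by blast
  have "\<beta> (n + (a + c)) = \<delta> (n + (b + d))" for n
    using *[rule_format, of "n + a"] assms(3)[of "n + d"] by (simp add: algebra_simps)
  then show ?thesis unfolding iff using assms(2) by blast
qed

lemma ray_shift: "\<gamma> \<in> \<omega> \<Longrightarrow> (\<lambda>n. \<gamma> (n + k)) \<in> \<omega>"
  by (rule ray_extends[of \<gamma> _ k 0]) (auto intro: nb_ray_shift rays_nb)

text \<open>The rays eventually coincide, so up to a common vertex they are walks with the same
  ends.\<close>

lemma rays_unique:
  assumes "\<gamma> \<in> \<omega>" "\<delta> \<in> \<omega>" "\<gamma> 0 = \<delta> 0" shows "\<gamma> 1 = \<delta> 1"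
proof -
  obtain a b where ab: "\<forall>n. \<gamma> (n + a) = \<delta> (n + b)" using rays_cofinal[OF assms(1,2)] by blast
  have *: "map \<beta> [0..<Suc (Suc c)] = \<beta> 0 # map \<beta> [1..<Suc (Suc c)]" for \<beta> :: "nat \<Rightarrow> 'a" and c
    using upt_conv_Cons[of 0 "Suc (Suc c)"] by simp
  \<comment> \<open>The segments stop one step after the index from which the rays agree, so that
    they contain index 1 even for \<open>a = 0\<close> or \<open>b = 0\<close>.\<close>
  have "map \<gamma> [1..<Suc (Suc a)] = map \<delta> [1..<Suc (Suc b)]"
  proof (rule walk_unique[OF tree'(1-3)])
    show "walk E (\<gamma> 0 # map \<gamma> [1..<Suc (Suc a)])"
      unfolding *[symmetric] by (rule nb_ray_walk[OF rays_nb[OF assms(1)]])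
    show "walk E (\<gamma> 0 # map \<delta> [1..<Suc (Suc b)])"
      unfolding assms(3) *[symmetric] by (rule nb_ray_walk[OF rays_nb[OF assms(2)]])
    show "last (\<gamma> 0 # map \<gamma> [1..<Suc (Suc a)]) = last (\<gamma> 0 # map \<delta> [1..<Suc (Suc b)])"
      using ab[rule_format, of 1] by simp
  qed
  then have "hd (map \<gamma> [1..<Suc (Suc a)]) = hd (map \<delta> [1..<Suc (Suc b)])" by simp
  then show ?thesis by (simp add: hd_map del: upt_Suc)
qed

lemma par_ray: "\<gamma> \<in> \<omega> \<Longrightarrow> par (\<gamma> n) = \<gamma> (Suc n)"
  unfolding predecessor_def
proof (rule the_equality)
  assume g: "\<gamma> \<in> \<omega>"
  show "\<exists>\<delta>\<in>\<omega>. \<delta> 0 = \<gamma> n \<and> \<delta> 1 = \<gamma> (Suc n)"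
    by (rule bexI[OF _ ray_shift[OF g, of n]]) simp
  fix y assume "\<exists>\<delta>\<in>\<omega>. \<delta> 0 = \<gamma> n \<and> \<delta> 1 = y"
  then obtain \<delta> where "\<delta> \<in> \<omega>" "\<delta> 0 = \<gamma> n" "\<delta> 1 = y" by blast
  then show "y = \<gamma> (Suc n)" using rays_unique[of \<delta> "\<lambda>k. \<gamma> (k + n)"] ray_shift[OF g, of n] by simp
qed

text \<open>Prepending \<open>y\<close> to the ray creates a backtrack only if \<open>y\<close> is
  the next vertex of the ray.\<close>

lemma edge_step:
  assumes g: "\<gamma> \<in> \<omega>" and e: "(\<gamma> 0, y) \<in> E"
  shows "y = \<gamma> 1 \<or> (\<lambda>n. case n of 0 \<Rightarrow> y | Suc k \<Rightarrow> \<gamma> k) \<in> \<omega>"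
proof (intro disjCI)
  let ?d = "\<lambda>n. case n of 0 \<Rightarrow> y | Suc k \<Rightarrow> \<gamma> k"
  assume "?d \<notin> \<omega>"
  moreover have "?d \<in> \<omega>" if "y \<noteq> \<gamma> 1"
  proof (rule ray_extends[OF g, of _ 0 1])
    show "nb_ray E ?d"
      unfolding nb_ray_def
    proof
      fix n
      show "(?d n, ?d (Suc n)) \<in> E \<and> ?d n \<noteq> ?d (Suc (Suc n))"
        using rays_nb[OF g] symD[OF tree'(1) e] that by (cases n) (auto simp: nb_ray_def)
    qed
  qed simp
  ultimately show "y = \<gamma> 1" by blast
qed

text \<open>Connectedness: along a path from the origin of some ray to \<open>x\<close>, each edge
  either drops the first vertex of the current ray or prepends a new one.\<close>

lemma ray_from: "\<exists>\<gamma>\<in>\<omega>. \<gamma> 0 = x"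
proof -
  obtain \<gamma> where g: "\<gamma> \<in> \<omega>" by (rule boundary_rays)
  have "(\<gamma> 0, x) \<in> E\<^sup>*" by (rule tree')
  then show ?thesis
  proof (induction rule: rtrancl_induct)
    case base
    then show ?case using g by blast
  next
    case (step y z)
    then obtain \<delta> where d: "\<delta> \<in> \<omega>" "\<delta> 0 = y" by blast
    from edge_step[OF d(1), of z] step(2) d(2) consider "z = \<delta> 1"
      | "(\<lambda>n. case n of 0 \<Rightarrow> z | Suc k \<Rightarrow> \<delta> k) \<in> \<omega>" by blast
    then show ?case
    proof cases
      case 1
      then show ?thesis by (intro bexI[OF _ ray_shift[OF d(1), of 1]]) simp
    next
      case 2
      then show ?thesis by (intro bexI[OF _ 2]) simp
    qed
  qed
qed

lemma par_edge: "(x, par x) \<in> E"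
proof -
  obtain \<gamma> where "\<gamma> \<in> \<omega>" "\<gamma> 0 = x" using ray_from by blast
  then show ?thesis using par_ray[of \<gamma> 0] rays_nb[of \<gamma>] by (auto simp: nb_ray_def)
qed

lemma edge_cases: "(x, y) \<in> E \<Longrightarrow> par x = y \<or> par y = x"
proof -
  assume e: "(x, y) \<in> E"
  obtain \<gamma> where g: "\<gamma> \<in> \<omega>" "\<gamma> 0 = x" using ray_from by blast
  show ?thesis
    using edge_step[OF g(1), of y] e g par_ray[of \<gamma> 0]
      par_ray[of "\<lambda>n. case n of 0 \<Rightarrow> y | Suc k \<Rightarrow> \<gamma> k" 0] by auto
qed

text \<open>Every edge joins a vertex to its predecessor, and never in both directions, since the
  level would rise twice. From here on the geometry is handled through the map
  \<open>par\<close>.\<close>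

lemma successors_eq: "successors E \<omega> x = {y. par y = x}"
proof -
  have pp: "par (par y) \<noteq> y" for y
  proof
    assume "par (par y) = y"
    then show False using level[of "par y"] level[of y] by simp
  qed
  have "y \<in> successors E \<omega> x \<longleftrightarrow> par y = x" for y
    using edge_cases[of x y] symD[OF tree'(1) par_edge[of y]] pp[of y]
    by (auto simp: successors_def)
  then show ?thesis by blast
qed

lemma finite_successors: "finite (successors E \<omega> x)"
  unfolding successors_def using tree'(5) by simp

section \<open>Levels, common ancestors and the distance\<close>

lemma level_funpow: "l ((par ^^ n) x) = l x + int n"
  by (induction n) (auto simp: level)

lemma common_ancestor: "\<exists>a b. (par ^^ a) x = (par ^^ b) y"
proof -
  have it: "(par ^^ n) (\<gamma> 0) = \<gamma> n" if "\<gamma> \<in> \<omega>" for \<gamma> n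
    by (induction n) (auto simp: par_ray[OF that])
  obtain \<gamma> \<delta> where g: "\<gamma> \<in> \<omega>" "\<gamma> 0 = x" "\<delta> \<in> \<omega>" "\<delta> 0 = y" using ray_from by metis
  obtain a b where "\<forall>n. \<gamma> (n + a) = \<delta> (n + b)" using rays_cofinal[OF g(1,3)] by blast
  then have "\<gamma> (0 + a) = \<delta> (0 + b)" by blast
  then have "(par ^^ a) x = (par ^^ b) y" using it[OF g(1), of a] it[OF g(3), of b] g by simp
  then show ?thesis by blast
qed

text \<open>The margin \<open>N\<close> will be the truncation length of the series: words shorter
  than that, started in \<open>S\<close>, do not climb past \<open>t\<close>.\<close>

lemma finite_common_ancestor:
  assumes "finite S" shows "\<exists>t. \<forall>x\<in>S. \<exists>j\<ge>N. (par ^^ j) x = t"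
  using assms
proof induction
  case (insert z S)
  then obtain t where t: "\<forall>x\<in>S. \<exists>j\<ge>N. (par ^^ j) x = t" by blast
  obtain a b where ab: "(par ^^ a) z = (par ^^ b) t" using common_ancestor by blast
  show ?case
  proof (rule exI[of _ "(par ^^ (N + b)) t"], rule ballI)
    fix x assume "x \<in> insert z S"
    then consider "x = z" | "x \<in> S" by blast
    then show "\<exists>j\<ge>N. (par ^^ j) x = (par ^^ (N + b)) t"
    proof cases
      case 1
      then have "(par ^^ (N + a)) x = (par ^^ (N + b)) t" using ab by (simp add: funpow_add)
      then show ?thesis by (metis le_add1)
    next
      case 2
      then obtain j where "j \<ge> N" "(par ^^ j) x = t" using t by blast
      then have "(par ^^ (N + b + j)) x = (par ^^ (N + b)) t" by (simp add: funpow_add)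
      then show ?thesis using \<open>j \<ge> N\<close> by (metis trans_le_add2)
    qed
  qed
qed simp

lemma gdist_le_common_ancestor:
  assumes "(par ^^ a) x = (par ^^ b) y" shows "gdist E x y \<le> a + b"
proof -
  have up: "(x, (par ^^ n) x) \<in> E ^^ n" for n x
    by (induction n) (auto intro: par_edge)
  have down: "((par ^^ n) x, x) \<in> E ^^ n" for n x
  proof (induction n)
    case (Suc n)
    have "((par ^^ Suc n) x, (par ^^ n) x) \<in> E" using symD[OF tree'(1) par_edge] by simp
    then show ?case using Suc by (rule relpow_Suc_I2)
  qed simp
  have "((par ^^ b) y, y) \<in> E ^^ b" by (rule down)
  then have "(x, y) \<in> E ^^ (a + b)" using up[of x a] assms by (auto simp: relpow_add)
  then show ?thesis by (rule gdist_le)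
qed

text \<open>Any path can be replaced by an ascent followed by a descent of no greater total length:
  a step up after a descent cancels the last step of that descent.\<close>

lemma common_ancestor_of_relpow:
  "(x, y) \<in> E ^^ n \<Longrightarrow> \<exists>a b. a + b \<le> n \<and> (par ^^ a) x = (par ^^ b) y"
proof (induction n arbitrary: y)
  case 0
  then show ?case by auto
next
  case (Suc n)
  then obtain z where z: "(x, z) \<in> E ^^ n" "(z, y) \<in> E" by auto
  from Suc.IH[OF z(1)] obtain a b where ab: "a + b \<le> n" "(par ^^ a) x = (par ^^ b) z" by blast
  from edge_cases[OF z(2)] show ?case
  proof
    assume y: "par z = y"
    show ?thesis
    proof (cases b)
      case 0
      then have "(par ^^ Suc a) x = (par ^^ 0) y" using ab y by simp
      then show ?thesis using ab 0 by (intro exI[of _ "Suc a"] exI[of _ 0]) auto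
    next
      case (Suc c)
      then have "(par ^^ a) x = (par ^^ c) y" using ab y by (simp add: funpow_swap1)
      then show ?thesis using ab Suc by (intro exI[of _ a] exI[of _ c]) auto
    qed
  next
    assume y: "par y = z"
    then have "(par ^^ a) x = (par ^^ Suc b) y" using ab by (simp add: funpow_swap1)
    then show ?thesis using ab by (intro exI[of _ a] exI[of _ "Suc b"]) auto
  qed
qed

lemma common_ancestor_gdist:
  obtains a b where "a + b \<le> gdist E x y" "(par ^^ a) x = (par ^^ b) y"
  using common_ancestor_of_relpow[OF relpow_gdist[OF tree'(4)]] by blast

end

section \<open>Words in the shift and an averaging operator\<close>

text \<open>Free weights \<open>P\<close> allow one calculus of words both for
  \<open>shift_adj\<close>, where \<open>P\<close> is \<open>transition\<close>, and for its
  perturbation with weights \<open>real (k y) / real q\<close>.\<close>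

definition avg :: "'a rel \<Rightarrow> (nat \<Rightarrow> 'a) set \<Rightarrow> ('a \<Rightarrow> real) \<Rightarrow> 'a operator" where
  "avg E \<omega> P f x = (\<Sum>y\<in>successors E \<omega> x. f y * of_real (P y))"

lemma avg_apply: "avg E \<omega> P f x = (\<Sum>y\<in>successors E \<omega> x. f y * of_real (P y))"
  by (simp add: avg_def)

lemma shift_apply: "shift E \<omega> f x = f (predecessor E \<omega> x)"
  by (simp add: shift_def)

lemma shift_adj_apply:
  "shift_adj E \<omega> m f x = 1 / of_real (m x) * (\<Sum>y\<in>successors E \<omega> x. f y * of_real (m y))"
  by (simp add: shift_adj_def)

lemma nc_word_simps [simp]:
  "nc_word A B [] f = f"
  "nc_word A B (Z1 # \<alpha>) f = A (nc_word A B \<alpha> f)"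
  "nc_word A B (Z2 # \<alpha>) f = B (nc_word A B \<alpha> f)"
  by (simp_all add: nc_word_def)

lemma nc_word_append: "nc_word A B (\<alpha> @ \<beta>) f = nc_word A B \<alpha> (nc_word A B \<beta> f)"
  by (simp add: nc_word_def)

lemma indet_list_induct [case_names Nil Z1 Z2]:
  assumes "P []" "\<And>\<alpha>. P \<alpha> \<Longrightarrow> P (Z1 # \<alpha>)" "\<And>\<alpha>. P \<alpha> \<Longrightarrow> P (Z2 # \<alpha>)"
  shows "P \<alpha>"
proof (induction \<alpha>)
  case (Cons i \<alpha>)
  then show ?case using assms(2,3) by (cases i) auto
qed (rule assms(1))

lemma word_sum:
  assumes "finite S"
  shows "nc_word (shift E \<omega>) (avg E \<omega> P) \<alpha> (\<lambda>x. \<Sum>i\<in>S. k i * g i x) =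
    (\<lambda>x. \<Sum>i\<in>S. k i * nc_word (shift E \<omega>) (avg E \<omega> P) \<alpha> (g i) x)"
proof (induction \<alpha> rule: indet_list_induct)
  case (Z2 \<alpha>)
  show ?case
    unfolding nc_word_simps Z2
  proof
    fix x
    show "avg E \<omega> P (\<lambda>x. \<Sum>i\<in>S. k i * nc_word (shift E \<omega>) (avg E \<omega> P) \<alpha> (g i) x) x
        = (\<Sum>i\<in>S. k i * avg E \<omega> P (nc_word (shift E \<omega>) (avg E \<omega> P) \<alpha> (g i)) x)"
      by (simp add: avg_apply sum_distrib_left sum_distrib_right mult.assoc sum.swap[of _ S])
  qed
qed (simp_all add: shift_def)

lemma word_cmult:
  "nc_word (shift E \<omega>) (avg E \<omega> P) \<alpha> (\<lambda>x. k * f x) =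
    (\<lambda>x. k * nc_word (shift E \<omega>) (avg E \<omega> P) \<alpha> f x)"
  using word_sum[of "{()}" E \<omega> P \<alpha> "\<lambda>_. k" "\<lambda>_. f"] by simp

section \<open>Limits and truncations of series\<close>

lemma word_tendsto:
  assumes "\<And>y. (\<lambda>q. Q q y) \<longlonglongrightarrow> P y"
  shows "(\<lambda>q. nc_word (shift E \<omega>) (avg E \<omega> (Q q)) \<alpha> f x)
    \<longlonglongrightarrow> nc_word (shift E \<omega>) (avg E \<omega> P) \<alpha> f x"
proof (induction \<alpha> arbitrary: x rule: indet_list_induct)
  case (Z2 \<alpha>)
  then show ?case
    by (auto simp: avg_apply intro!: tendsto_sum tendsto_mult tendsto_of_real assms)
qed (simp_all add: shift_def)

lemma nc_homogeneous_tendsto: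
  assumes "\<And>y. (\<lambda>q. Q q y) \<longlonglongrightarrow> P y"
  shows "(\<lambda>q. nc_homogeneous c (shift E \<omega>) (avg E \<omega> (Q q)) N f x)
    \<longlonglongrightarrow> nc_homogeneous c (shift E \<omega>) (avg E \<omega> P) N f x"
  unfolding nc_homogeneous_def by (intro tendsto_sum tendsto_mult tendsto_const word_tendsto assms)

lemma norm_diff_less_half:
  fixes a b u :: "'v::real_normed_vector"
  assumes "norm (a - u) < e / 2" "norm (b - u) < e / 2" shows "norm (a - b) < e"
  using norm_triangle_ineq4[of "a - u" "b - u"] assms by simp

text \<open>The bound \<open>D\<close> concerns the single vertex \<open>x\<close>. In the
  comparison with homogeneous trees it is independent of \<open>q\<close>, which lets the truncation
  length be fixed before \<open>q\<close> grows.\<close>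

lemma nc_eval_tail:
  assumes c: "c \<in> H21" and D: "\<And>\<alpha>. cmod (nc_word A B \<alpha> f x) \<le> D"
  shows "summable (\<lambda>N. nc_homogeneous c A B N f x)"
    and "cmod (nc_eval c A B f x - (\<Sum>N<n. nc_homogeneous c A B N f x))
      \<le> D * (\<Sum>N. \<Sum>\<alpha> | length \<alpha> = N + n. cmod (c \<alpha>))"
proof -
  have s: "summable (\<lambda>N. \<Sum>\<alpha> | length \<alpha> = N. cmod (c \<alpha>))" using c by (simp add: H21_def)
  have b: "cmod (nc_homogeneous c A B N f x) \<le> D * (\<Sum>\<alpha> | length \<alpha> = N. cmod (c \<alpha>))" for N
    unfolding nc_homogeneous_def sum_distrib_left
    by (rule sum_norm_le) (simp add: norm_mult mult.commute[of D] mult_left_mono D)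
  show sm: "summable (\<lambda>N. nc_homogeneous c A B N f x)"
    by (rule summable_comparison_test'[OF summable_mult[OF s, of D], of 0]) (use b in auto)
  have s': "summable (\<lambda>N. D * (\<Sum>\<alpha> | length \<alpha> = N + n. cmod (c \<alpha>)))"
    by (intro summable_mult summable_ignore_initial_segment[OF s, of n])
  have "cmod (nc_eval c A B f x - (\<Sum>N<n. nc_homogeneous c A B N f x))
      = cmod (\<Sum>N. nc_homogeneous c A B (N + n) f x)"
    unfolding nc_eval_def suminf_minus_initial_segment[OF sm] by simp
  also have "\<dots> \<le> (\<Sum>N. D * (\<Sum>\<alpha> | length \<alpha> = N + n. cmod (c \<alpha>)))"
    by (rule norm_suminf_le[OF _ s']) (rule b)
  also have "\<dots> = D * (\<Sum>N. \<Sum>\<alpha> | length \<alpha> = N + n. cmod (c \<alpha>))"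
    by (rule suminf_mult[OF summable_ignore_initial_segment[OF s, of n]])
  finally show "cmod (nc_eval c A B f x - (\<Sum>N<n. nc_homogeneous c A B N f x))
      \<le> D * (\<Sum>N. \<Sum>\<alpha> | length \<alpha> = N + n. cmod (c \<alpha>))" .
qed

lemma H21_tail_small:
  assumes c: "c \<in> H21" and e: "0 < e"
  shows "\<exists>n. (\<Sum>N. \<Sum>\<alpha> | length \<alpha> = N + n. cmod (c \<alpha>)) < e"
proof -
  have s: "summable (\<lambda>N. \<Sum>\<alpha> | length \<alpha> = N. cmod (c \<alpha>))" using c by (simp add: H21_def)
  from suminf_exist_split[OF e s] obtain K where
    "\<And>n. K \<le> n \<Longrightarrow> norm (\<Sum>N. \<Sum>\<alpha> | length \<alpha> = N + n. cmod (c \<alpha>)) < e" by blast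
  from this[of K] show ?thesis by (auto intro!: exI[of _ K])
qed

section \<open>Lebesgue norms as suprema of finite sums\<close>

text \<open>Monotone convergence along superlevel sets, which are finite because all finite sums are
  bounded.\<close>

lemma nn_integral_weighted_measure_le_iff:
  fixes h :: "'a \<Rightarrow> real"
  assumes m: "\<And>x. 0 < m x" and h: "\<And>x. 0 \<le> h x" and C: "0 \<le> C"
  shows "(\<integral>\<^sup>+x. ennreal (h x) \<partial>weighted_measure m) \<le> ennreal C \<longleftrightarrow>
    (\<forall>S. finite S \<longrightarrow> (\<Sum>x\<in>S. h x * m x) \<le> C)"
proof -
  have fin: "(\<integral>\<^sup>+x. ennreal (h x) * indicator S x \<partial>weighted_measure m) = ennreal (\<Sum>x\<in>S. h x * m x)"
    if S: "finite S" for S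
  proof -
    have "(\<integral>\<^sup>+x. ennreal (h x) * indicator S x \<partial>weighted_measure m)
        = (\<integral>\<^sup>+x. ennreal (m x) * (ennreal (h x) * indicator S x) \<partial>count_space UNIV)"
      unfolding weighted_measure_def point_measure_def by (subst nn_integral_density) auto
    also have "\<dots> = (\<Sum>x\<in>S. ennreal (m x) * (ennreal (h x) * indicator S x))"
      by (rule nn_integral_count_space'[OF S]) auto
    also have "\<dots> = (\<Sum>x\<in>S. ennreal (h x * m x))"
      by (rule sum.cong) (auto simp: ennreal_mult'' mult.commute less_imp_le[OF m])
    also have "\<dots> = ennreal (\<Sum>x\<in>S. h x * m x)"
      by (rule sum_ennreal) (simp add: h less_imp_le[OF m])
    finally show ?thesis .
  qed
  show ?thesis
  proof (intro iffI allI impI)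
    fix S :: "'a set"
    assume le: "(\<integral>\<^sup>+x. ennreal (h x) \<partial>weighted_measure m) \<le> ennreal C" and S: "finite S"
    have "ennreal (\<Sum>x\<in>S. h x * m x) \<le> (\<integral>\<^sup>+x. ennreal (h x) \<partial>weighted_measure m)"
      unfolding fin[OF S, symmetric] by (intro nn_integral_mono) (auto simp: indicator_def)
    then have "ennreal (\<Sum>x\<in>S. h x * m x) \<le> ennreal C" using le by (rule order_trans)
    then show "(\<Sum>x\<in>S. h x * m x) \<le> C" using C by (simp add: ennreal_le_iff)
  next
    assume le: "\<forall>S. finite S \<longrightarrow> (\<Sum>x\<in>S. h x * m x) \<le> C"
    define A where "A n = {x. 1 / real (Suc n) < h x * m x}" for n
    have finA: "finite (A n)" for n
    proof (rule ccontr)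
      assume inf: "infinite (A n)"
      \<comment> \<open>More than \<open>C * real (Suc n)\<close> points of \<open>A n\<close> would
        already push a finite sum above \<open>C\<close>.\<close>
      obtain K :: nat where K: "C * real (Suc n) < real K" using reals_Archimedean2 by blast
      obtain S where S: "finite S" "card S = K" "S \<subseteq> A n"
        using infinite_arbitrarily_large[OF inf] by metis
      have "real (card S) * (1 / real (Suc n)) \<le> (\<Sum>x\<in>S. h x * m x)"
        by (rule sum_bounded_below) (use S in \<open>auto simp: A_def\<close>)
      also have "\<dots> \<le> C" using le S by blast
      finally show False using K S by (simp add: field_simps)
    qed
    have inc: "A i \<subseteq> A j" if "i \<le> j" for i j
    proof
      fix x assume "x \<in> A i"
      moreover have "1 / real (Suc j) \<le> 1 / real (Suc i)" using that by (simp add: frac_le)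
      ultimately show "x \<in> A j" by (auto simp: A_def)
    qed
    have "ennreal (h x) = (SUP n. ennreal (h x) * indicator (A n) x)" for x
    proof (cases "h x = 0")
      case False
      then have "0 < h x * m x" using h[of x] m[of x] by simp
      then obtain n where n: "x \<in> A n" using nat_approx_posE unfolding A_def by blast
      show ?thesis
      proof (rule antisym)
        show "ennreal (h x) \<le> (SUP n. ennreal (h x) * indicator (A n) x)"
          by (rule SUP_upper2[of n]) (use n in auto)
      qed (auto intro!: SUP_least simp: indicator_def)
    qed simp
    then have "(\<integral>\<^sup>+x. ennreal (h x) \<partial>weighted_measure m)
        = (\<integral>\<^sup>+x. (SUP n. ennreal (h x) * indicator (A n) x) \<partial>weighted_measure m)"
      by simp
    also have "\<dots> = (SUP n. \<integral>\<^sup>+x. ennreal (h x) * indicator (A n) x \<partial>weighted_measure m)"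
    proof (rule nn_integral_monotone_convergence_SUP)
      show "incseq (\<lambda>n x. ennreal (h x) * indicator (A n) x)"
        using inc by (auto simp: incseq_def le_fun_def indicator_def)
    qed (simp add: weighted_measure_def)
    also have "\<dots> \<le> ennreal C"
      by (rule SUP_least) (use le finA in \<open>simp add: fin ennreal_leI\<close>)
    finally show "(\<integral>\<^sup>+x. ennreal (h x) \<partial>weighted_measure m) \<le> ennreal C" .
  qed
qed

lemma Lp_norm_le_iff_sum:
  assumes m: "\<And>x. 0 < m x" and p: "1 \<le> p" "p < \<infinity>" and C: "0 \<le> C"
  shows "Lp_norm (weighted_measure m) p f \<le> ennreal C \<longleftrightarrow>
    (\<forall>S. finite S \<longrightarrow> (\<Sum>x\<in>S. cmod (f x) powr enn2real p * m x) \<le> C powr enn2real p)"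
  unfolding Lp_norm_le_iff[OF p C]
  by (rule nn_integral_weighted_measure_le_iff[OF m]) auto

lemma enn2real_ge_1: "1 \<le> p \<Longrightarrow> p < \<infinity> \<Longrightarrow> 1 \<le> enn2real p"
  using enn2real_mono[of 1 p] by simp

section \<open>Contractivity and locality of words on a flow tree\<close>

context flow_tree
begin

lemma successors_ne: "successors E \<omega> x \<noteq> {}"
  using flow_pos[of x] flow[of x] by auto

lemma par_successor: "y \<in> successors E \<omega> x \<Longrightarrow> par y = x"
  by (simp add: successors_eq)

text \<open>The probability of descending from \<open>par y\<close> to \<open>y\<close>;
  \<open>shift_adj\<close> is the associated mean over successors.\<close>

definition transition :: "'a \<Rightarrow> real" where
  "transition y = m y / m (par y)"

lemma transition_pos: "0 < transition y"
  by (simp add: transition_def flow_pos)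

lemma sum_transition: "(\<Sum>y\<in>successors E \<omega> x. transition y) = 1"
proof -
  have "(\<Sum>y\<in>successors E \<omega> x. transition y) = (\<Sum>y\<in>successors E \<omega> x. m y / m x)"
    by (rule sum.cong) (auto simp: transition_def par_successor)
  also have "\<dots> = 1" using flow[of x] flow_pos[of x] by (simp flip: sum_divide_distrib)
  finally show ?thesis .
qed

lemma shift_adj_eq_avg: "shift_adj E \<omega> m = avg E \<omega> transition"
proof (intro ext)
  fix f x
  show "shift_adj E \<omega> m f x = avg E \<omega> transition f x"
    unfolding shift_adj_def avg_def sum_distrib_left
    by (rule sum.cong) (auto simp: transition_def par_successor)
qed

abbreviation "word \<equiv> nc_word (shift E \<omega>) (shift_adj E \<omega> m)"

lemma word_bounded:
  assumes "\<And>x. cmod (f x) \<le> C" shows "cmod (word \<alpha> f x) \<le> C"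
proof (induction \<alpha> arbitrary: x rule: indet_list_induct)
  case (Z2 \<alpha>)
  have "cmod (avg E \<omega> transition (word \<alpha> f) x) \<le> (\<Sum>y\<in>successors E \<omega> x. C * transition y)"
    unfolding avg_apply
    by (rule sum_norm_le) (use Z2 transition_pos in \<open>simp add: norm_mult mult_right_mono less_imp_le\<close>)
  also have "\<dots> = C" by (simp add: sum_distrib_left[symmetric] sum_transition)
  finally show ?case by (simp add: shift_adj_eq_avg)
qed (simp_all add: assms shift_def)

text \<open>Successor sets are finite, so a word reads only finitely many values. For
  \<open>p = \<infinity>\<close> this replaces the density of finitely supported functions.\<close>

lemma word_local:
  "\<exists>G. finite G \<and> (\<forall>f g. (\<forall>y\<in>G. f y = g y) \<longrightarrow> word \<alpha> f x = word \<alpha> g x)"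
proof (induction \<alpha> arbitrary: x rule: indet_list_induct)
  case Nil
  show ?case by (rule exI[of _ "{x}"]) simp
next
  case (Z1 \<alpha>)
  show ?case using Z1[of "par x"] by (simp add: shift_def)
next
  case (Z2 \<alpha>)
  from Z2 obtain G where G: "\<And>y. finite (G y)"
    "\<And>y f g. (\<forall>z\<in>G y. f z = g z) \<Longrightarrow> word \<alpha> f y = word \<alpha> g y" by metis
  show ?case
  proof (intro exI[of _ "\<Union>y\<in>successors E \<omega> x. G y"] conjI allI impI)
    show "finite (\<Union>y\<in>successors E \<omega> x. G y)" using G(1) finite_successors by blast
    fix f g :: "'a \<Rightarrow> complex" assume "\<forall>y\<in>\<Union>y\<in>successors E \<omega> x. G y. f y = g y"
    then have "word \<alpha> f y = word \<alpha> g y" if "y \<in> successors E \<omega> x" for y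
      using that by (intro G(2)) blast
    then show "word (Z2 # \<alpha>) f x = word (Z2 # \<alpha>) g x" by (simp add: shift_adj_def)
  qed
qed

lemma shift_Lp_contraction:
  assumes p: "1 \<le> p"
  shows "Lp_norm (weighted_measure m) p (shift E \<omega> f) \<le> Lp_norm (weighted_measure m) p f"
    and "Lp_norm (weighted_measure m) p (shift_adj E \<omega> m f) \<le> Lp_norm (weighted_measure m) p f"
proof -
  have "Lp_norm (weighted_measure m) p (shift E \<omega> f) \<le> Lp_norm (weighted_measure m) p f \<and>
      Lp_norm (weighted_measure m) p (shift_adj E \<omega> m f) \<le> Lp_norm (weighted_measure m) p f"
  proof (cases "p = \<infinity>")
    case True
    let ?C = "Lp_norm (weighted_measure m) \<infinity> f"
    have b: "ennreal (cmod (f x)) \<le> ?C" for x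
      using Lp_norm_top_le_iff[of m f ?C, OF flow_pos] by simp
    have "ennreal (cmod (shift_adj E \<omega> m f x)) \<le> ?C" for x
    proof (cases "?C")
      case (real C)
      then have "cmod (f x) \<le> C" for x using b by (simp add: ennreal_le_iff)
      then have "cmod (word [Z2] f x) \<le> C" by (rule word_bounded)
      then show ?thesis using real by (simp add: ennreal_leI)
    qed simp
    moreover have "ennreal (cmod (shift E \<omega> f x)) \<le> ?C" for x using b by (simp add: shift_def)
    ultimately show ?thesis
      unfolding True Lp_norm_top_le_iff[of m, OF flow_pos] by blast
  next
    case False
    then have p': "p < \<infinity>" by (simp add: less_top)
    define r where "r = enn2real p"
    have r: "1 \<le> r" using enn2real_ge_1[OF p p'] by (simp add: r_def)
    show ?thesis
    proof (cases "Lp_norm (weighted_measure m) p f")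
      case (real C)
      have C: "(\<Sum>x\<in>S. cmod (f x) powr r * m x) \<le> C powr r" if "finite S" for S
        using Lp_norm_le_iff_sum[where f = f and m = m, OF flow_pos p p' real(1)] real(2) that by (simp add: r_def)
      have "(\<Sum>x\<in>S. cmod (shift E \<omega> f x) powr r * m x) \<le> C powr r" if S: "finite S" for S
      proof -
        \<comment> \<open>Grouped by predecessor: by the flow condition all successors of
          \<open>z\<close> together have mass \<open>m z\<close>.\<close>
        have "(\<Sum>x\<in>S. cmod (shift E \<omega> f x) powr r * m x)
            = (\<Sum>z\<in>par ` S. \<Sum>x\<in>{x\<in>S. par x = z}. cmod (f (par x)) powr r * m x)"
          unfolding shift_def by (rule sum.image_gen[OF S])
        also have "\<dots> = (\<Sum>z\<in>par ` S. \<Sum>x\<in>{x\<in>S. par x = z}. cmod (f z) powr r * m x)"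
          by (intro sum.cong refl) auto
        also have "\<dots> \<le> (\<Sum>z\<in>par ` S. \<Sum>x\<in>successors E \<omega> z. cmod (f z) powr r * m x)"
          by (intro sum_mono sum_mono2 finite_successors)
             (auto simp: successors_eq less_imp_le[OF flow_pos])
        also have "\<dots> = (\<Sum>z\<in>par ` S. cmod (f z) powr r * m z)"
          by (simp add: sum_distrib_left[symmetric] flow[symmetric])
        also have "\<dots> \<le> C powr r" using S by (intro C) auto
        finally show ?thesis .
      qed
      moreover have "(\<Sum>x\<in>S. cmod (shift_adj E \<omega> m f x) powr r * m x) \<le> C powr r"
        if S: "finite S" for S
      proof -
        \<comment> \<open>Jensen's inequality for the probability weights \<open>transition\<close>;
          their total 1 makes the constant trivial, and multiplication by \<open>m x\<close> turns
          \<open>transition y\<close> into \<open>m y\<close>.\<close>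
        have jensen: "cmod (shift_adj E \<omega> m f x) powr r * m x
            \<le> (\<Sum>y\<in>successors E \<omega> x. cmod (f y) powr r * m y)" for x
        proof -
          have "cmod (shift_adj E \<omega> m f x) \<le> (\<Sum>y\<in>successors E \<omega> x. transition y * cmod (f y))"
            unfolding shift_adj_eq_avg avg_apply
            by (rule sum_norm_le) (simp add: norm_mult less_imp_le[OF transition_pos])
          then have "cmod (shift_adj E \<omega> m f x) powr r
              \<le> (\<Sum>y\<in>successors E \<omega> x. transition y * cmod (f y)) powr r"
            using r by (intro powr_mono2) auto
          also have "\<dots> \<le> 1 powr (r - 1) * (\<Sum>y\<in>successors E \<omega> x. transition y * cmod (f y) powr r)"
            by (rule weighted_powr_mean[OF finite_successors _ _ _ r])
               (auto simp: sum_transition less_imp_le[OF transition_pos])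
          finally have "cmod (shift_adj E \<omega> m f x) powr r * m x
              \<le> (\<Sum>y\<in>successors E \<omega> x. transition y * cmod (f y) powr r) * m x"
            using flow_pos[of x] by (intro mult_right_mono) (auto simp: less_imp_le)
          also have "\<dots> = (\<Sum>y\<in>successors E \<omega> x. cmod (f y) powr r * m y)"
            unfolding sum_distrib_right
            by (rule sum.cong) (use flow_pos[of x] in \<open>auto simp: transition_def par_successor\<close>)
          finally show ?thesis .
        qed
        have "(\<Sum>x\<in>S. cmod (shift_adj E \<omega> m f x) powr r * m x)
            \<le> (\<Sum>x\<in>S. \<Sum>y\<in>successors E \<omega> x. cmod (f y) powr r * m y)"
          by (rule sum_mono) (rule jensen)
        also have "\<dots> = (\<Sum>y\<in>(\<Union>x\<in>S. successors E \<omega> x). cmod (f y) powr r * m y)"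
          by (rule sum.UNION_disjoint[symmetric]) (use S finite_successors in \<open>auto simp: successors_eq\<close>)
        also have "\<dots> \<le> C powr r" using S finite_successors by (intro C) auto
        finally show ?thesis .
      qed
      ultimately show ?thesis
        unfolding real(2) Lp_norm_le_iff_sum[OF flow_pos p p' real(1)] by (simp add: r_def)
    qed simp
  qed
  then show "Lp_norm (weighted_measure m) p (shift E \<omega> f) \<le> Lp_norm (weighted_measure m) p f"
    and "Lp_norm (weighted_measure m) p (shift_adj E \<omega> m f) \<le> Lp_norm (weighted_measure m) p f"
    by auto
qed

lemma word_Lp_contraction:
  assumes "1 \<le> p"
  shows "Lp_norm (weighted_measure m) p (word \<alpha> f) \<le> Lp_norm (weighted_measure m) p f"
  by (induction \<alpha> rule: indet_list_induct)
     (auto intro: order_trans shift_Lp_contraction[OF assms])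

lemma Lp_norm_restrict:
  "Lp_norm (weighted_measure m) p (\<lambda>x. if x \<in> G then f x else 0) \<le> Lp_norm (weighted_measure m) p f"
  if p: "1 \<le> p"
proof (cases "p = \<infinity>")
  case True
  have "ennreal (cmod (f x)) \<le> Lp_norm (weighted_measure m) \<infinity> f" for x
    using Lp_norm_top_le_iff[of m f "Lp_norm (weighted_measure m) \<infinity> f", OF flow_pos] by simp
  then show ?thesis unfolding True Lp_norm_top_le_iff[of m, OF flow_pos] by simp
next
  case False
  then have p': "p < \<infinity>" by (simp add: less_top)
  show ?thesis
  proof (cases "Lp_norm (weighted_measure m) p f")
    case (real C)
    show ?thesis
      unfolding real(2) Lp_norm_le_iff_sum[OF flow_pos p p' real(1)]
    proof (intro allI impI)
      fix S :: "'a set" assume S: "finite S"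
      have "(\<Sum>x\<in>S. cmod (if x \<in> G then f x else 0) powr enn2real p * m x)
          \<le> (\<Sum>x\<in>S. cmod (f x) powr enn2real p * m x)"
        by (intro sum_mono) (auto simp: less_imp_le[OF flow_pos])
      also have "\<dots> \<le> C powr enn2real p"
        using Lp_norm_le_iff_sum[where f = f and m = m, OF flow_pos p p' real(1)] real(2) S by simp
      finally show "(\<Sum>x\<in>S. cmod (if x \<in> G then f x else 0) powr enn2real p * m x)
          \<le> C powr enn2real p" .
    qed
  qed simp
qed

text \<open>Since words are local operators and point evaluations are bounded on the unit ball,
  functions of finite support suffice to compute the operator norm, even for \<open>p = \<infinity>\<close>.\<close>

lemma nc_eval_finite_support_approx:
  assumes c: "c \<in> H21" and p: "1 \<le> p" and f: "Lp_norm (weighted_measure m) p f \<le> 1"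
    and S: "finite S" and e: "0 < e"
  obtains G where "finite G"
    and "\<And>x. x \<in> S \<Longrightarrow> cmod (nc_eval c (shift E \<omega>) (shift_adj E \<omega> m) f x
      - nc_eval c (shift E \<omega>) (shift_adj E \<omega> m) (\<lambda>x. if x \<in> G then f x else 0) x) < e"
proof -
  have "\<exists>D. \<forall>x. \<forall>f. Lp_norm (weighted_measure m) p f \<le> 1 \<longrightarrow> cmod (f x) \<le> D x"
    using cmod_bounded_of_Lp_norm[of m p, OF flow_pos p] by (intro choice) blast
  then obtain D where D: "\<And>x f. Lp_norm (weighted_measure m) p f \<le> 1 \<Longrightarrow> cmod (f x) \<le> D x" by blast
  \<comment> \<open>The entry 1 keeps \<open>M\<close> positive, also for empty
    \<open>S\<close>.\<close>
  define M where "M = Max (insert 1 (D ` S))"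
  have M: "D x \<le> M" if "x \<in> S" for x unfolding M_def using S that by auto
  have M1: "1 \<le> M" unfolding M_def using S by auto
  \<comment> \<open>With this choice \<open>f\<close> and its restriction each have a tail below
    \<open>e / 2\<close> at the points of \<open>S\<close>.\<close>
  obtain n where n: "(\<Sum>N. \<Sum>\<alpha> | length \<alpha> = N + n. cmod (c \<alpha>)) < e / (2 * M)"
    using H21_tail_small[OF c, of "e / (2 * M)"] e M1 by auto
  have "\<exists>G. \<forall>\<alpha> x. finite (G \<alpha> x) \<and> (\<forall>f g. (\<forall>y\<in>G \<alpha> x. f y = g y) \<longrightarrow> word \<alpha> f x = word \<alpha> g x)"
    using word_local by metis
  then obtain G where G: "\<And>\<alpha> x. finite (G \<alpha> x)"
    "\<And>\<alpha> x f g. (\<forall>y\<in>G \<alpha> x. f y = g y) \<Longrightarrow> word \<alpha> f x = word \<alpha> g x" by blast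
  \<comment> \<open>All vertices that words shorter than \<open>n\<close> read from
    \<open>S\<close>; restricting \<open>f\<close> to them leaves the truncated series on
    \<open>S\<close> unchanged.\<close>
  define H where "H = (\<Union>x\<in>S. \<Union>N\<in>{..<n}. \<Union>\<alpha>\<in>{\<alpha>. length \<alpha> = N}. G \<alpha> x)"
  let ?g = "\<lambda>x. if x \<in> H then f x else 0"
  let ?F = "nc_eval c (shift E \<omega>) (shift_adj E \<omega> m)"
  have "finite H" unfolding H_def using S G(1) finite_words by auto
  moreover have "cmod (?F f x - ?F ?g x) < e" if x: "x \<in> S" for x
  proof -
    have tail: "cmod (?F u x - (\<Sum>N<n. nc_homogeneous c (shift E \<omega>) (shift_adj E \<omega> m) N u x)) < e / 2"
      if "Lp_norm (weighted_measure m) p u \<le> 1" for u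
    proof -
      have "cmod (word \<alpha> u x) \<le> M" for \<alpha>
        using D[of "word \<alpha> u" x] word_Lp_contraction[OF p, of \<alpha> u] that M[OF x] by force
      from nc_eval_tail(2)[OF c this, of n]
      have "cmod (?F u x - (\<Sum>N<n. nc_homogeneous c (shift E \<omega>) (shift_adj E \<omega> m) N u x))
          \<le> M * (\<Sum>N. \<Sum>\<alpha> | length \<alpha> = N + n. cmod (c \<alpha>))" .
      also have "\<dots> < M * (e / (2 * M))" using n M1 by (intro mult_strict_left_mono) auto
      also have "\<dots> = e / 2" using M1 by simp
      finally show ?thesis .
    qed
    have "word \<alpha> f x = word \<alpha> ?g x" if "length \<alpha> < n" for \<alpha>
      by (rule G(2)) (use that x in \<open>auto simp: H_def\<close>)
    then have eq: "(\<Sum>N<n. nc_homogeneous c (shift E \<omega>) (shift_adj E \<omega> m) N f x)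
        = (\<Sum>N<n. nc_homogeneous c (shift E \<omega>) (shift_adj E \<omega> m) N ?g x)"
      unfolding nc_homogeneous_def by (intro sum.cong) auto
    from tail[OF f] tail[OF order_trans[OF Lp_norm_restrict[OF p] f], of H]
    show ?thesis
      unfolding eq by (rule norm_diff_less_half)
  qed
  ultimately show ?thesis using that by blast
qed

end

section \<open>Transposition\<close>

text \<open>Transposing a product reverses it, and the two shifts are transposes of each other for
  the pairing with weight \<open>m\<close>, hence the exchange of letters.\<close>

definition transpose_word :: "indet list \<Rightarrow> indet list" where
  "transpose_word \<alpha> = rev (map (\<lambda>i. case i of Z1 \<Rightarrow> Z2 | Z2 \<Rightarrow> Z1) \<alpha>)"

text \<open>The coefficients are not conjugated: the pairing is bilinear, so this is a transpose and
  not a Hilbert space adjoint.\<close>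

definition transpose_series :: "nc_series \<Rightarrow> nc_series" where
  "transpose_series c \<alpha> = c (transpose_word \<alpha>)"

lemma transpose_word_simps [simp]:
  "transpose_word [] = []"
  "transpose_word (Z1 # \<alpha>) = transpose_word \<alpha> @ [Z2]"
  "transpose_word (Z2 # \<alpha>) = transpose_word \<alpha> @ [Z1]"
  "length (transpose_word \<alpha>) = length \<alpha>"
  by (simp_all add: transpose_word_def)

lemma transpose_transpose_word [simp]: "transpose_word (transpose_word \<alpha>) = \<alpha>"
proof -
  have "transpose_word (\<beta> @ [i]) = (case i of Z1 \<Rightarrow> Z2 | Z2 \<Rightarrow> Z1) # transpose_word \<beta>" for \<beta> i
    by (simp add: transpose_word_def)
  then show ?thesis by (induction \<alpha> rule: indet_list_induct) simp_all
qed

lemma sum_transpose_word: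
  "(\<Sum>\<alpha> | length \<alpha> = N. g (transpose_word \<alpha>)) = (\<Sum>\<alpha> | length \<alpha> = N. g \<alpha>)"
  by (rule sum.reindex_bij_witness[of _ transpose_word transpose_word]) auto

lemma transpose_series_H21: "c \<in> H21 \<Longrightarrow> transpose_series c \<in> H21"
  using sum_transpose_word[of "\<lambda>\<alpha>. cmod (c \<alpha>)"] by (simp add: H21_def transpose_series_def)

context flow_tree
begin

text \<open>Both sides are the pairing of the word applied to the indicator of \<open>y\<close> with
  the indicator of \<open>x\<close>; the letters move across one at a time.\<close>

lemma word_transpose:
  "word \<alpha> (\<lambda>z. if z = y then 1 else 0) x * of_real (m x) =
    of_real (m y) * word (transpose_word \<alpha>) (\<lambda>z. if z = x then 1 else 0) y"
proof (induction \<alpha> arbitrary: x rule: indet_list_induct)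
  case Nil
  show ?case by simp
next
  case (Z1 \<alpha>)
  let ?\<beta> = "transpose_word \<alpha>" and ?r = "of_real (m x / m (par x)) :: complex"
  have nz: "m (par x) \<noteq> 0" using flow_pos[of "par x"] by simp
  \<comment> \<open>The indicator of \<open>x\<close> is seen only by the average at
    \<open>par x\<close>.\<close>
  have "shift_adj E \<omega> m (\<lambda>z. if z = x then 1 else 0) = (\<lambda>z. ?r * (if z = par x then 1 else 0))"
    unfolding shift_adj_def using finite_successors
    by (auto simp: successors_eq if_distrib[of "\<lambda>u. u * _"] sum.delta cong: if_cong)
  then have adj: "word (?\<beta> @ [Z2]) (\<lambda>z. if z = x then 1 else 0) y
      = ?r * word ?\<beta> (\<lambda>z. if z = par x then 1 else 0) y"
    using word_cmult[of E \<omega> transition ?\<beta> ?r "\<lambda>z. if z = par x then 1 else 0"]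
    by (simp only: nc_word_append nc_word_simps shift_adj_eq_avg)
  have "word (Z1 # \<alpha>) (\<lambda>z. if z = y then 1 else 0) x * of_real (m x)
      = ?r * (word \<alpha> (\<lambda>z. if z = y then 1 else 0) (par x) * of_real (m (par x)))"
    using nz by (simp add: shift_apply)
  also have "\<dots> = of_real (m y) * word (?\<beta> @ [Z2]) (\<lambda>z. if z = x then 1 else 0) y"
    unfolding Z1 adj by (simp only: mult_ac)
  finally show ?case by (simp only: transpose_word_simps)
next
  case (Z2 \<alpha>)
  let ?\<beta> = "transpose_word \<alpha>"
  have nz: "m x \<noteq> 0" using flow_pos[of x] by simp
  have "shift E \<omega> (\<lambda>z. if z = x then 1 else 0)
      = (\<lambda>z. \<Sum>u\<in>successors E \<omega> x. 1 * (if z = u then 1 else 0))"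
    unfolding shift_def using finite_successors by (auto simp: successors_eq)
  then have "word (?\<beta> @ [Z1]) (\<lambda>z. if z = x then 1 else 0) y
      = (\<Sum>u\<in>successors E \<omega> x. 1 * word ?\<beta> (\<lambda>z. if z = u then 1 else 0) y)"
    using word_sum[OF finite_successors, of E \<omega> transition ?\<beta> "\<lambda>_. 1" "\<lambda>u z. if z = u then 1 else 0" x]
    by (simp only: nc_word_append nc_word_simps shift_adj_eq_avg)
  then have "of_real (m y) * word (?\<beta> @ [Z1]) (\<lambda>z. if z = x then 1 else 0) y
      = (\<Sum>u\<in>successors E \<omega> x. word \<alpha> (\<lambda>z. if z = y then 1 else 0) u * of_real (m u))"
    by (simp only: sum_distrib_left Z2 mult_1)
  moreover have "word (Z2 # \<alpha>) (\<lambda>z. if z = y then 1 else 0) x * of_real (m x)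
      = (\<Sum>u\<in>successors E \<omega> x. word \<alpha> (\<lambda>z. if z = y then 1 else 0) u * of_real (m u))"
    using nz by (simp add: shift_adj_apply)
  ultimately show ?case by (simp only: transpose_word_simps)
qed

lemma nc_eval_transpose:
  assumes c: "c \<in> H21"
  shows "nc_eval c (shift E \<omega>) (shift_adj E \<omega> m) (\<lambda>z. if z = y then 1 else 0) x * of_real (m x) =
    of_real (m y) * nc_eval (transpose_series c) (shift E \<omega>) (shift_adj E \<omega> m) (\<lambda>z. if z = x then 1 else 0) y"
proof -
  have hom: "nc_homogeneous c (shift E \<omega>) (shift_adj E \<omega> m) N (\<lambda>z. if z = y then 1 else 0) x * of_real (m x) =
    of_real (m y) * nc_homogeneous (transpose_series c) (shift E \<omega>) (shift_adj E \<omega> m) N (\<lambda>z. if z = x then 1 else 0) y" for N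
  proof -
    let ?h = "\<lambda>\<alpha>. c (transpose_word \<alpha>) * (of_real (m y) * word \<alpha> (\<lambda>z. if z = x then 1 else 0) y)"
    have "nc_homogeneous c (shift E \<omega>) (shift_adj E \<omega> m) N (\<lambda>z. if z = y then 1 else 0) x * of_real (m x)
        = (\<Sum>\<alpha> | length \<alpha> = N. ?h (transpose_word \<alpha>))"
      unfolding nc_homogeneous_def sum_distrib_right mult.assoc word_transpose transpose_transpose_word ..
    also have "\<dots> = (\<Sum>\<alpha> | length \<alpha> = N. ?h \<alpha>)"
      by (rule sum_transpose_word)
    also have "\<dots> = of_real (m y) * nc_homogeneous (transpose_series c) (shift E \<omega>) (shift_adj E \<omega> m) N (\<lambda>z. if z = x then 1 else 0) y"
      by (simp add: nc_homogeneous_def transpose_series_def sum_distrib_left mult_ac)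
    finally show ?thesis .
  qed
  have s: "summable (\<lambda>N. nc_homogeneous c' (shift E \<omega>) (shift_adj E \<omega> m) N (\<lambda>z. if z = u then 1 else 0) v)"
    if "c' \<in> H21" for c' u v
    by (rule nc_eval_tail(1)[OF that word_bounded[where C = 1]]) simp
  show ?thesis
    unfolding nc_eval_def
    using suminf_mult2[OF s[OF c], of y x "of_real (m x)"]
      suminf_mult[OF s[OF transpose_series_H21[OF c]], of "of_real (m y)" x y]
    by (simp add: hom)
qed

lemma integral_kernel_nc_eval:
  assumes c: "c \<in> H21"
  defines "F \<equiv> nc_eval c (shift E \<omega>) (shift_adj E \<omega> m)"
  shows "integral_kernel m F x y * of_real (m y) = F (\<lambda>z. if z = y then 1 else 0) x"
proof -
  have K: "is_integral_kernel m F (integral_kernel m F)"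
    unfolding F_def
  proof (rule is_integral_kernel_nc_eval[OF flow_pos c])
    fix S :: "'a set" and k :: "'a \<Rightarrow> complex" and g assume S: "finite S"
    show "shift E \<omega> (\<lambda>x. \<Sum>y\<in>S. k y * g y x) = (\<lambda>x. \<Sum>y\<in>S. k y * shift E \<omega> (g y) x)"
      using word_sum[OF S, of E \<omega> transition "[Z1]"] by simp
    show "shift_adj E \<omega> m (\<lambda>x. \<Sum>y\<in>S. k y * g y x) = (\<lambda>x. \<Sum>y\<in>S. k y * shift_adj E \<omega> m (g y) x)"
      using word_sum[OF S, of E \<omega> transition "[Z2]"] by (simp add: shift_adj_eq_avg)
  qed (rule shift_Lp_contraction; simp)+
  have s: "{z. (if z = y then 1 else 0 :: complex) \<noteq> 0} = {y}" by auto
  have "F (\<lambda>z. if z = y then 1 else 0) x = (\<Sum>z | (if z = y then 1 else 0 :: complex) \<noteq> 0.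
      integral_kernel m F x z * (if z = y then 1 else 0) * of_real (m z))"
    by (rule K[unfolded is_integral_kernel_def, rule_format]) (simp add: s)
  then show ?thesis unfolding s by simp
qed

text \<open>Puts the summed variable \<open>x\<close> into the argument of an operator, where sums
  over \<open>x\<close> are handled by linearity, and leaves \<open>y\<close> as a point of
  evaluation.\<close>

lemma integral_kernel_mult_measure:
  assumes c: "c \<in> H21"
  shows "integral_kernel m (nc_eval c (shift E \<omega>) (shift_adj E \<omega> m)) x y * of_real (m x) =
    nc_eval (transpose_series c) (shift E \<omega>) (shift_adj E \<omega> m) (\<lambda>z. if z = x then 1 else 0) y"
proof -
  let ?F = "nc_eval c (shift E \<omega>) (shift_adj E \<omega> m)"
  let ?F' = "nc_eval (transpose_series c) (shift E \<omega>) (shift_adj E \<omega> m)"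
  have nz: "m y \<noteq> 0" using flow_pos[of y] by simp
  have "of_real (m y) * (integral_kernel m ?F x y * of_real (m x))
      = (integral_kernel m ?F x y * of_real (m y)) * of_real (m x)"
    by (simp only: mult_ac)
  also have "\<dots> = of_real (m y) * ?F' (\<lambda>z. if z = x then 1 else 0) y"
    unfolding integral_kernel_nc_eval[OF c] by (rule nc_eval_transpose[OF c])
  finally show ?thesis using nz by simp
qed

end

section \<open>Homogeneous trees\<close>

lemma homogeneous_flow_tree:
  assumes q: "1 \<le> q" and h: "homogeneous_tree q E \<omega> l"
  shows "flow_tree E \<omega> l (canonical_flow q l)"
proof -
  interpret rooted_tree E \<omega> l using h by (simp add: homogeneous_tree_def)
  show ?thesis
  proof
    fix x
    show "0 < canonical_flow q l x" using q by (simp add: canonical_flow_def)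
    have "canonical_flow q l y = real q powi (l x - 1)" if "y \<in> successors E \<omega> x" for y
    proof -
      have "l x = l y + 1" using that level[of y] by (simp add: successors_eq)
      then show ?thesis by (simp add: canonical_flow_def)
    qed
    then have "(\<Sum>y\<in>successors E \<omega> x. canonical_flow q l y) = real q * real q powi (l x - 1)"
      using h by (simp add: homogeneous_tree_def)
    also have "\<dots> = canonical_flow q l x"
      using q by (simp add: canonical_flow_def power_int_diff)
    finally show "canonical_flow q l x = (\<Sum>y\<in>successors E \<omega> x. canonical_flow q l y)" ..
  qed
qed

text \<open>The weight may depend on the levels themselves, so the top of the cone in the
  homogeneous tree has to sit at exactly the level of \<open>t\<close>.\<close>

lemma (in flow_tree) level_surj: "\<exists>x. l x = n"
proof -
  fix x0 :: 'a
  have down: "\<exists>x. l x = l x0 - int i" for i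
  proof (induction i)
    case (Suc i)
    then obtain x where x: "l x = l x0 - int i" by blast
    obtain y where "par y = x" using successors_ne[of x] by (auto simp: successors_eq)
    then have "l y = l x0 - int (Suc i)" using level[of y] x by simp
    then show ?case by blast
  qed auto
  show ?thesis
  proof (cases "n \<le> l x0")
    case True
    then show ?thesis using down[of "nat (l x0 - n)"] by simp
  next
    case False
    then have "l ((par ^^ nat (n - l x0)) x0) = n" by (simp add: level_funpow)
    then show ?thesis by blast
  qed
qed

section \<open>Lifting a cone to a homogeneous tree\<close>

lemma distribute_finite_set:
  assumes "finite I" "finite A" "card A = (\<Sum>i\<in>I. k i)"
  shows "\<exists>g. g ` A \<subseteq> I \<and> (\<forall>i\<in>I. card {a\<in>A. g a = i} = k i)"
  using assms
proof (induction I arbitrary: A)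
  case empty
  then show ?case by simp
next
  case (insert i I)
  then have "k i \<le> card A" by simp
  then obtain B where B: "B \<subseteq> A" "card B = k i" by (metis obtain_subset_with_card_n)
  have "card (A - B) = (\<Sum>i\<in>I. k i)"
    using insert B by (simp add: card_Diff_subset finite_subset)
  then obtain g where g: "g ` (A - B) \<subseteq> I" "\<forall>j\<in>I. card {a\<in>A - B. g a = j} = k j"
    using insert.IH[of "A - B"] insert.prems by blast
  define h where "h a = (if a \<in> B then i else g a)" for a
  have "{a\<in>A. h a = i} = B" using B g insert.hyps by (auto simp: h_def)
  moreover have "{a\<in>A. h a = j} = {a\<in>A - B. g a = j}" if "j \<in> I" for j
    using that insert.hyps by (auto simp: h_def)
  moreover have "h ` A \<subseteq> insert i I" using g by (auto simp: h_def)
  ultimately show ?case using B g by (intro exI[of _ h]) auto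
qed

text \<open>All shares are rounded down except that of one chosen successor, which takes the
  remainder. Its proportion converges because the others do and the limits sum to one.\<close>

lemma (in flow_tree) integer_approximation:
  "\<exists>k :: nat \<Rightarrow> 'a \<Rightarrow> nat. (\<forall>q x. (\<Sum>y\<in>successors E \<omega> x. k q y) = q) \<and>
    (\<forall>y. (\<lambda>q. real (k q y) / real q) \<longlonglongrightarrow> transition y)"
proof -
  define e where "e x = (SOME y. y \<in> successors E \<omega> x)" for x
  have e: "e x \<in> successors E \<omega> x" for x
    unfolding e_def by (rule someI_ex) (use successors_ne[of x] in blast)
  define f where "f q y = nat \<lfloor>real q * transition y\<rfloor>" for q y
  define S where "S x = successors E \<omega> x - {e x}" for x
  define k where "k q y = (if y = e (par y) then q - (\<Sum>z\<in>S (par y). f q z) else f q y)" for q y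
  have finS: "finite (S x)" for x using finite_successors by (simp add: S_def)
  have f_le: "real (f q y) \<le> real q * transition y" for q y
    using transition_pos[of y] by (simp add: f_def less_imp_le)
  have f_ge: "real q * transition y - 1 \<le> real (f q y)" for q y
    unfolding f_def by linarith
  have split: "(\<Sum>y\<in>successors E \<omega> x. g y) = g (e x) + (\<Sum>y\<in>S x. g y)" for g :: "'a \<Rightarrow> 'c::comm_monoid_add" and x
    unfolding S_def by (rule sum.remove[OF finite_successors e])
  \<comment> \<open>Makes the natural-number subtraction in \<open>k\<close> a true one.\<close>
  have le: "(\<Sum>z\<in>S x. f q z) \<le> q" for q x
  proof -
    have "real (\<Sum>z\<in>S x. f q z) \<le> (\<Sum>z\<in>S x. real q * transition z)"
      by (simp add: sum_mono f_le)
    also have "\<dots> = real q * (\<Sum>z\<in>S x. transition z)" by (simp add: sum_distrib_left)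
    also have "\<dots> \<le> real q * 1"
      using split[of transition x] sum_transition[of x] transition_pos[of "e x"]
      by (intro mult_left_mono) auto
    finally show ?thesis by (simp flip: of_nat_sum)
  qed
  have kS: "(\<Sum>y\<in>S x. k q y) = (\<Sum>y\<in>S x. f q y)" for q x
    by (rule sum.cong) (auto simp: S_def k_def par_successor)
  have ke: "k q (e x) = q - (\<Sum>z\<in>S x. f q z)" for q x
    using par_successor[OF e] by (simp add: k_def)
  have "(\<Sum>y\<in>successors E \<omega> x. k q y) = q" for q x
    unfolding split kS ke using le by simp
  moreover have flim: "(\<lambda>q. real (f q y) / real q) \<longlonglongrightarrow> transition y" for y
  proof (rule tendsto_sandwich)
    show "\<forall>\<^sub>F q in sequentially. transition y - 1 / real q \<le> real (f q y) / real q"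
      using eventually_gt_at_top[of 0]
    proof eventually_elim
      case (elim q)
      then show ?case
        using divide_right_mono[OF f_ge[of q y], of "real q"] by (simp add: diff_divide_distrib)
    qed
    show "\<forall>\<^sub>F q in sequentially. real (f q y) / real q \<le> transition y"
      using eventually_gt_at_top[of 0]
    proof eventually_elim
      case (elim q)
      then show ?case using f_le[of q y] by (simp add: field_simps)
    qed
    have "(\<lambda>q. transition y - 1 / real q) \<longlonglongrightarrow> transition y - 0"
      by (intro tendsto_diff tendsto_const lim_1_over_n)
    then show "(\<lambda>q. transition y - 1 / real q) \<longlonglongrightarrow> transition y" by simp
  qed simp
  moreover have "(\<lambda>q. real (k q y) / real q) \<longlonglongrightarrow> transition y" for y
  proof (cases "y = e (par y)")
    case False
    then show ?thesis using flim[of y] by (simp add: k_def)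
  next
    case True
    define x where "x = par y"
    have y: "y = e x" using True by (simp add: x_def)
    have "(\<lambda>q. 1 - (\<Sum>z\<in>S x. real (f q z) / real q)) \<longlonglongrightarrow> 1 - (\<Sum>z\<in>S x. transition z)"
      by (intro tendsto_diff tendsto_const tendsto_sum flim)
    also have "1 - (\<Sum>z\<in>S x. transition z) = transition y"
      using split[of transition x] sum_transition[of x] y by simp
    finally show ?thesis
    proof (rule Lim_transform_eventually)
      show "\<forall>\<^sub>F q in sequentially. 1 - (\<Sum>z\<in>S x. real (f q z) / real q) = real (k q y) / real q"
        using eventually_gt_at_top[of 0]
      proof eventually_elim
        case (elim q)
        have "real (k q y) = real q - (\<Sum>z\<in>S x. real (f q z))"
          unfolding y ke using le[of q x] by (simp add: of_nat_diff)
        then show ?case using elim by (simp add: diff_divide_distrib sum_divide_distrib)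
      qed
    qed
  qed
  ultimately show ?thesis by blast
qed

lemma cone_map_exists:
  fixes t :: 'a and t' :: 'b
  assumes "flow_tree E \<omega> l m" and "homogeneous_tree q E' \<omega>' l'"
    and k: "\<And>x. (\<Sum>y\<in>successors E \<omega> x. k y) = q" and t: "l' t' = l t"
  shows "\<exists>\<pi>. \<pi> t' = t \<and> (\<forall>x. l' x \<le> l t \<longrightarrow> (\<forall>y\<in>successors E' \<omega>' x. \<pi> y \<in> successors E \<omega> (\<pi> x)) \<and>
    (\<forall>y\<in>successors E \<omega> (\<pi> x). card {z\<in>successors E' \<omega>' x. \<pi> z = y} = k y))"
proof -
  interpret T: flow_tree E \<omega> l m by fact
  interpret H: rooted_tree E' \<omega>' l' using assms(2) by (simp add: homogeneous_tree_def)
  have "\<exists>g. g ` successors E' \<omega>' x' \<subseteq> successors E \<omega> x \<and>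
      (\<forall>y\<in>successors E \<omega> x. card {z\<in>successors E' \<omega>' x'. g z = y} = k y)" for x' x
    by (rule distribute_finite_set[OF T.finite_successors H.finite_successors])
       (use assms(2) k in \<open>simp add: homogeneous_tree_def\<close>)
  then obtain g where g: "\<And>x' x. g x' x ` successors E' \<omega>' x' \<subseteq> successors E \<omega> x"
      "\<And>x' x y. y \<in> successors E \<omega> x \<Longrightarrow> card {z\<in>successors E' \<omega>' x'. g x' x z = y} = k y"
    by metis
  \<comment> \<open>Recursion on the depth below level \<open>l t\<close>, each vertex reading the
    value at its predecessor. The base map is constantly \<open>t\<close>, also at the other
    vertices of that level and, through \<open>nat\<close>, above it; \<open>cone\<close> later
    discards whatever does not descend from \<open>t'\<close>.\<close>
  define \<rho> where "\<rho> = rec_nat (\<lambda>_. t) (\<lambda>n \<rho> y. g (H.par y) (\<rho> (H.par y)) y)"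
  define \<pi> where "\<pi> x = \<rho> (nat (l t - l' x)) x" for x
  have step: "\<pi> y = g x (\<pi> x) y" if "y \<in> successors E' \<omega>' x" "l' x \<le> l t" for x y
  proof -
    have py: "H.par y = x" using that by (simp add: H.successors_eq)
    then have "nat (l t - l' y) = Suc (nat (l t - l' x))" using H.level[of y] that by simp
    then show ?thesis by (simp add: \<pi>_def \<rho>_def py)
  qed
  have "{z\<in>successors E' \<omega>' x. \<pi> z = y} = {z\<in>successors E' \<omega>' x. g x (\<pi> x) z = y}" if "l' x \<le> l t" for x y
    using step that by auto
  then have "card {z\<in>successors E' \<omega>' x. \<pi> z = y} = k y"
    if "l' x \<le> l t" "y \<in> successors E \<omega> (\<pi> x)" for x y
    using g(2) that by simp
  moreover have "\<pi> y \<in> successors E \<omega> (\<pi> x)" if "l' x \<le> l t" "y \<in> successors E' \<omega>' x" for x y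
    unfolding step[OF that(2,1)] using g(1) that by blast
  moreover have "\<pi> t' = t" using t by (simp add: \<pi>_def \<rho>_def)
  ultimately show ?thesis by blast
qed

section \<open>The cone map, its fibres and the intertwining of words\<close>

locale cone_lift = T: flow_tree E \<omega> l m + H: flow_tree E' \<omega>' l' "canonical_flow q l'"
  for E :: "'a rel" and \<omega> l m and q and E' :: "'b rel" and \<omega>' l' +
  fixes k :: "'a \<Rightarrow> nat" and t :: 'a and t' :: 'b and \<pi> :: "'b \<Rightarrow> 'a"
  assumes q: "1 \<le> q"
    and top_level: "l' t' = l t" and \<pi>_top: "\<pi> t' = t"
    and \<pi>_successor: "l' x \<le> l t \<Longrightarrow> y \<in> successors E' \<omega>' x \<Longrightarrow> \<pi> y \<in> successors E \<omega> (\<pi> x)"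
    and \<pi>_card: "l' x \<le> l t \<Longrightarrow> z \<in> successors E \<omega> (\<pi> x) \<Longrightarrow>
      card {y\<in>successors E' \<omega>' x. \<pi> y = z} = k z"
begin

definition cone :: "'b set" where "cone = {x. \<exists>j. (H.par ^^ j) x = t'}"

text \<open>Extension by zero keeps the norm of a lift a sum over fibres; words that start deep
  enough below \<open>t'\<close> never meet the edge of the cone.\<close>

definition lift :: "('a \<Rightarrow> complex) \<Rightarrow> 'b \<Rightarrow> complex" where
  "lift f x = (if x \<in> cone then f (\<pi> x) else 0)"

definition fibre :: "'a \<Rightarrow> 'b set" where "fibre x = {x'\<in>cone. \<pi> x' = x}"

lemma level_below_top: "(H.par ^^ j) x = t' \<Longrightarrow> l' x = l t - int j"
  using H.level_funpow[of j x] top_level by simp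

text \<open>The exponent \<open>Suc j\<close> keeps \<open>x\<close> strictly below the top: at
  \<open>t'\<close> itself nothing relates the two predecessors.\<close>

lemma \<pi>_par:
  assumes "(H.par ^^ Suc j) x = t'" shows "T.par (\<pi> x) = \<pi> (H.par x)"
proof -
  have "(H.par ^^ j) (H.par x) = t'" using assms by (simp add: funpow_swap1)
  then have "l' (H.par x) \<le> l t" using level_below_top by simp
  then have "\<pi> x \<in> successors E \<omega> (\<pi> (H.par x))"
    by (rule \<pi>_successor) (simp add: H.successors_eq)
  then show ?thesis by (rule T.par_successor)
qed

lemma \<pi>_funpow:
  assumes "(H.par ^^ j) x = t'" "a \<le> j" shows "(T.par ^^ a) (\<pi> x) = \<pi> ((H.par ^^ a) x)"
  using assms(2)
proof (induction a)
  case (Suc a)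
  have "Suc (j - Suc a) + a = j" using Suc.prems by simp
  then have "(H.par ^^ Suc (j - Suc a)) ((H.par ^^ a) x) = t'"
    using assms(1) by (metis funpow_add o_apply)
  from \<pi>_par[OF this] Suc show ?case by simp
qed simp

lemma \<pi>_funpow_top: "(H.par ^^ j) x = t' \<Longrightarrow> (T.par ^^ j) (\<pi> x) = t"
  using \<pi>_funpow[of j x j] \<pi>_top by simp

lemma \<pi>_level: "x \<in> cone \<Longrightarrow> l (\<pi> x) = l' x"
proof -
  assume "x \<in> cone"
  then obtain j where j: "(H.par ^^ j) x = t'" by (auto simp: cone_def)
  show "l (\<pi> x) = l' x"
    using level_below_top[OF j] T.level_funpow[of j "\<pi> x"] \<pi>_funpow_top[OF j] by simp
qed

text \<open>The number of generations up to the top can be read off the level, which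
  \<open>\<pi>\<close> preserves on the cone.\<close>

lemma cone_depth:
  assumes "x \<in> cone" "(T.par ^^ j) (\<pi> x) = t" shows "(H.par ^^ j) x = t'"
proof -
  obtain i where i: "(H.par ^^ i) x = t'" using assms(1) by (auto simp: cone_def)
  have "l (\<pi> x) = l t - int j" using T.level_funpow[of j "\<pi> x"] assms(2) by simp
  then have "i = j" using \<pi>_level[OF assms(1)] level_below_top[OF i] by simp
  with i show ?thesis by simp
qed

lemma lift_eq_indicator: "lift (\<lambda>z. if z = x then 1 else 0) = (\<lambda>z. if z \<in> fibre x then 1 else 0)"
  by (auto simp: lift_def fibre_def)

text \<open>Induction on the depth: the fibre over \<open>x\<close> consists of successors of
  vertices in the fibre over \<open>T.par x\<close>, and each of these contributes
  \<open>k x\<close> of them.\<close>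

lemma finite_card_fibre:
  "(T.par ^^ j) x = t \<Longrightarrow> finite (fibre x) \<and> card (fibre x) = (\<Prod>i<j. k ((T.par ^^ i) x))"
proof (induction j arbitrary: x)
  case 0
  \<comment> \<open>The restriction to the cone matters here: other vertices of the same level may
    also be sent to \<open>t\<close>.\<close>
  have "fibre x = {t'}"
  proof
    show "fibre x \<subseteq> {t'}" using 0 cone_depth[of _ 0] by (auto simp: fibre_def)
    show "{t'} \<subseteq> fibre x" using 0 \<pi>_top by (auto simp: fibre_def cone_def intro: exI[of _ 0])
  qed
  then show ?case by simp
next
  case (Suc j)
  let ?C = "\<lambda>z. {y\<in>successors E' \<omega>' z. \<pi> y = x}"
  have px: "(T.par ^^ j) (T.par x) = t" using Suc.prems by (simp add: funpow_swap1)
  note IH = Suc.IH[OF px]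
  have zt: "(H.par ^^ j) z = t'" if "z \<in> fibre (T.par x)" for z
    using that px cone_depth[of z j] by (auto simp: fibre_def)
  have eq: "fibre x = (\<Union>z\<in>fibre (T.par x). ?C z)"
  proof (intro set_eqI iffI)
    fix y assume y: "y \<in> fibre x"
    then have yt: "(H.par ^^ Suc j) y = t'" using cone_depth[of y "Suc j"] Suc.prems by (auto simp: fibre_def)
    then have "(H.par ^^ j) (H.par y) = t'" by (simp add: funpow_swap1)
    then have "H.par y \<in> fibre (T.par x)"
      using \<pi>_par[OF yt] y by (auto simp: fibre_def cone_def)
    moreover have "y \<in> ?C (H.par y)" using y by (simp add: fibre_def H.successors_eq)
    ultimately show "y \<in> (\<Union>z\<in>fibre (T.par x). ?C z)" by blast
  next
    fix y assume "y \<in> (\<Union>z\<in>fibre (T.par x). ?C z)"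
    then obtain z where z: "z \<in> fibre (T.par x)" "H.par y = z" "\<pi> y = x" by (auto simp: H.successors_eq)
    have "(H.par ^^ Suc j) y = t'" using zt[OF z(1)] z(2) by (simp add: funpow_swap1)
    then show "y \<in> fibre x" using z(3) unfolding fibre_def cone_def by blast
  qed
  have cardC: "card (?C z) = k x" if z: "z \<in> fibre (T.par x)" for z
  proof (rule \<pi>_card)
    show "l' z \<le> l t" using level_below_top[OF zt[OF z]] by simp
    show "x \<in> successors E \<omega> (\<pi> z)" using z by (simp add: fibre_def T.successors_eq)
  qed
  have "card (fibre x) = (\<Sum>z\<in>fibre (T.par x). card (?C z))"
    unfolding eq
    by (rule card_UN_disjoint) (use IH H.finite_successors in \<open>auto simp: H.successors_eq\<close>)
  also have "\<dots> = card (fibre (T.par x)) * k x" using cardC by simp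
  also have "\<dots> = (\<Prod>i<Suc j. k ((T.par ^^ i) x))"
    using IH by (simp add: prod.lessThan_Suc_shift funpow_swap1 mult.commute del: prod.lessThan_Suc)
  finally have "card (fibre x) = (\<Prod>i<Suc j. k ((T.par ^^ i) x))" .
  moreover have "finite (fibre x)"
    unfolding eq using IH H.finite_successors by auto
  ultimately show ?case by blast
qed

lemma fibre_level: "y \<in> fibre x \<Longrightarrow> l' y = l x"
  using \<pi>_level by (auto simp: fibre_def)

text \<open>Every vertex at depth \<open>j\<close> has mass
  \<open>real q powi (l t - int j)\<close>, so one factor \<open>1 / q\<close> pairs with each
  multiplicity. What remains depends on \<open>q\<close> and \<open>t\<close> only.\<close>

lemma measure_fibre:
  assumes x: "(T.par ^^ j) x = t"
  shows "(\<Sum>y\<in>fibre x. canonical_flow q l' y)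
    = real q powi l t * (\<Prod>i<j. real (k ((T.par ^^ i) x)) / real q)"
proof -
  have lx: "l x = l t - int j" using T.level_funpow[of j x] x by simp
  have "(\<Sum>y\<in>fibre x. canonical_flow q l' y) = real (card (fibre x)) * real q powi (l t - int j)"
    by (simp add: canonical_flow_def fibre_level lx)
  also have "\<dots> = (\<Prod>i<j. real (k ((T.par ^^ i) x))) * (real q powi l t / real q ^ j)"
    using finite_card_fibre[OF x] q by (simp add: power_int_diff)
  also have "\<dots> = real q powi l t * (\<Prod>i<j. real (k ((T.par ^^ i) x)) / real q)"
    by (simp add: prod_dividef)
  finally show ?thesis .
qed

text \<open>Each letter moves by one level: climbing uses up one letter and one level of depth,
  descending adds depth. A word no longer than the depth of \<open>x\<close> therefore never leaves
  the cone.\<close>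

lemma word_lift:
  assumes "(H.par ^^ j) x = t'" "length \<alpha> \<le> j"
  shows "H.word \<alpha> (lift f) x = nc_word (shift E \<omega>) (avg E \<omega> (\<lambda>y. real (k y) / real q)) \<alpha> f (\<pi> x)"
  using assms
proof (induction \<alpha> arbitrary: x j rule: indet_list_induct)
  case Nil
  then show ?case by (auto simp: lift_def cone_def)
next
  case (Z1 \<alpha>)
  then obtain i where j: "j = Suc i" by (cases j) auto
  have i: "(H.par ^^ i) (H.par x) = t'" using Z1.prems by (simp add: j funpow_swap1)
  show ?case
    using Z1.IH[OF i] Z1.prems \<pi>_par[of i x] by (simp add: j shift_apply)
next
  case (Z2 \<alpha>)
  let ?W = "nc_word (shift E \<omega>) (avg E \<omega> (\<lambda>y. real (k y) / real q)) \<alpha> f"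
  have lx: "l' x \<le> l t" using level_below_top[OF Z2.prems(1)] by simp
  have word: "H.word \<alpha> (lift f) y = ?W (\<pi> y)" if y: "y \<in> successors E' \<omega>' x" for y
  proof (rule Z2.IH[of "Suc j"])
    show "(H.par ^^ Suc j) y = t'" using y Z2.prems by (simp add: H.successors_eq funpow_swap1)
  qed (use Z2.prems in simp)
  have tr: "H.transition y = 1 / real q" for y
    using q H.level[of y] by (simp add: H.transition_def canonical_flow_def power_int_add)
  have "H.word (Z2 # \<alpha>) (lift f) x = (\<Sum>y\<in>successors E' \<omega>' x. ?W (\<pi> y) * of_real (1 / real q))"
  proof -
    have "H.word (Z2 # \<alpha>) (lift f) x = avg E' \<omega>' H.transition (H.word \<alpha> (lift f)) x"
      by (simp add: H.shift_adj_eq_avg)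
    also have "\<dots> = (\<Sum>y\<in>successors E' \<omega>' x. ?W (\<pi> y) * of_real (1 / real q))"
      by (subst avg_apply) (rule sum.cong, simp_all add: tr word)
    finally show ?thesis .
  qed
  \<comment> \<open>The equal weights \<open>1 / real q\<close> are collected according to the image
    of the successor.\<close>
  also have "\<dots> = (\<Sum>z\<in>\<pi> ` successors E' \<omega>' x. \<Sum>y\<in>{y\<in>successors E' \<omega>' x. \<pi> y = z}. ?W (\<pi> y) * of_real (1 / real q))"
    by (rule sum.image_gen[OF H.finite_successors])
  also have "\<dots> = (\<Sum>z\<in>successors E \<omega> (\<pi> x). \<Sum>y\<in>{y\<in>successors E' \<omega>' x. \<pi> y = z}. ?W (\<pi> y) * of_real (1 / real q))"
  \<comment> \<open>Successors of \<open>\<pi> x\<close> that are not hit, which happens when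
    \<open>k z = 0\<close>, contribute an empty sum.\<close>
  proof (rule sum.mono_neutral_left[OF T.finite_successors])
    show "\<pi> ` successors E' \<omega>' x \<subseteq> successors E \<omega> (\<pi> x)" using \<pi>_successor[OF lx] by blast
    show "\<forall>z\<in>successors E \<omega> (\<pi> x) - \<pi> ` successors E' \<omega>' x.
        (\<Sum>y\<in>{y\<in>successors E' \<omega>' x. \<pi> y = z}. ?W (\<pi> y) * of_real (1 / real q)) = 0"
    proof
      fix z assume "z \<in> successors E \<omega> (\<pi> x) - \<pi> ` successors E' \<omega>' x"
      then have "{y\<in>successors E' \<omega>' x. \<pi> y = z} = {}" by blast
      then show "(\<Sum>y\<in>{y\<in>successors E' \<omega>' x. \<pi> y = z}. ?W (\<pi> y) * of_real (1 / real q)) = 0"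
        by (simp only: sum.empty)
    qed
  qed
  also have "\<dots> = (\<Sum>z\<in>successors E \<omega> (\<pi> x). ?W z * of_real (real (k z) / real q))"
  proof (rule sum.cong[OF refl])
    fix z assume z: "z \<in> successors E \<omega> (\<pi> x)"
    have "(\<Sum>y\<in>{y\<in>successors E' \<omega>' x. \<pi> y = z}. ?W (\<pi> y) * of_real (1 / real q))
        = (\<Sum>y\<in>{y\<in>successors E' \<omega>' x. \<pi> y = z}. ?W z * of_real (1 / real q))"
      by (rule sum.cong) auto
    then show "(\<Sum>y\<in>{y\<in>successors E' \<omega>' x. \<pi> y = z}. ?W (\<pi> y) * of_real (1 / real q))
        = ?W z * of_real (real (k z) / real q)"
      by (simp add: \<pi>_card[OF lx z])
  qed
  also have "\<dots> = nc_word (shift E \<omega>) (avg E \<omega> (\<lambda>y. real (k y) / real q)) (Z2 # \<alpha>) f (\<pi> x)"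
    by (simp only: nc_word_simps) (rule avg_apply[symmetric])
  finally show ?case .
qed

text \<open>If a shortest path turns inside the cone, its turning point is mapped along. If it turns
  above \<open>t'\<close>, where \<open>\<pi>\<close> is not controlled, the images still meet at
  \<open>t\<close>, which is no longer a detour.\<close>

lemma gdist_lift:
  assumes "x \<in> cone" "y \<in> cone" shows "gdist E (\<pi> x) (\<pi> y) \<le> gdist E' x y"
proof -
  obtain a b where ab: "a + b \<le> gdist E' x y" "(H.par ^^ a) x = (H.par ^^ b) y"
    by (rule H.common_ancestor_gdist)
  obtain i j where ij: "(H.par ^^ i) x = t'" "(H.par ^^ j) y = t'" using assms by (auto simp: cone_def)
  have lev: "l' x + int a = l' y + int b" using H.level_funpow[of a x] H.level_funpow[of b y] ab by simp
  have lev': "l' x + int i = l' y + int j" using H.level_funpow[of i x] H.level_funpow[of j y] ij by simp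
  show ?thesis
  proof (cases "a \<le> i")
    case True
    then have "b \<le> j" using lev lev' by simp
    then have "(T.par ^^ a) (\<pi> x) = (T.par ^^ b) (\<pi> y)"
      using \<pi>_funpow[OF ij(1) True] \<pi>_funpow[OF ij(2)] ab by simp
    from T.gdist_le_common_ancestor[OF this] ab show ?thesis by simp
  next
    case False
    then have "i + j \<le> a + b" using lev lev' by simp
    moreover have "(T.par ^^ i) (\<pi> x) = (T.par ^^ j) (\<pi> y)"
      using \<pi>_funpow_top ij by simp
    ultimately show ?thesis using T.gdist_le_common_ancestor ab by fastforce
  qed
qed

end

section \<open>Convergence along the lifts\<close>

text \<open>One cone of \<open>T\<close> lifted to all homogeneous trees at once: \<open>t\<close>
  stays fixed while \<open>q\<close> grows, so the products over generations keep a fixed number of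
  factors.\<close>

locale cone_lift_family = flow_tree E \<omega> l m
  for E :: "'a rel" and \<omega> l m +
  fixes Eq :: "nat \<Rightarrow> 'b rel" and \<omega>q :: "nat \<Rightarrow> (nat \<Rightarrow> 'b) set" and lq :: "nat \<Rightarrow> 'b \<Rightarrow> int"
    and t :: 'a and k :: "nat \<Rightarrow> 'a \<Rightarrow> nat" and tq :: "nat \<Rightarrow> 'b" and \<pi> :: "nat \<Rightarrow> 'b \<Rightarrow> 'a"
  assumes lifts: "1 \<le> q \<Longrightarrow> cone_lift E \<omega> l m q (Eq q) (\<omega>q q) (lq q) (k q) t (tq q) (\<pi> q)"
    and k_tendsto: "(\<lambda>q. real (k q y) / real q) \<longlonglongrightarrow> transition y"
begin

abbreviation "fibre q \<equiv> cone_lift.fibre (Eq q) (\<omega>q q) (tq q) (\<pi> q)"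
abbreviation "lift q \<equiv> cone_lift.lift (Eq q) (\<omega>q q) (tq q) (\<pi> q)"
abbreviation "mq q \<equiv> canonical_flow q (lq q)"
abbreviation "FT c \<equiv> nc_eval c (shift E \<omega>) (shift_adj E \<omega> m)"
abbreviation "FTq c q \<equiv> nc_eval c (shift (Eq q) (\<omega>q q)) (shift_adj (Eq q) (\<omega>q q) (mq q))"

text \<open>The limiting product of transition probabilities telescopes to \<open>m x / m t\<close>.
  The factor \<open>m t / real q powi l t\<close> is common to all \<open>x\<close> and cancels when
  norms are compared.\<close>

lemma measure_fibre_tendsto:
  assumes x: "(par ^^ j) x = t"
  shows "(\<lambda>q. (\<Sum>y\<in>fibre q x. mq q y) * m t / real q powi l t) \<longlonglongrightarrow> m x"
proof -
  have prod: "(\<Prod>i<j. transition ((par ^^ i) x)) * m ((par ^^ j) x) = m x" for j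
  proof (induction j)
    case (Suc j)
    then show ?case using flow_pos[of "par ((par ^^ j) x)"] by (simp add: transition_def)
  qed simp
  have "(\<lambda>q. (\<Prod>i<j. real (k q ((par ^^ i) x)) / real q) * m t)
      \<longlonglongrightarrow> (\<Prod>i<j. transition ((par ^^ i) x)) * m t"
    by (intro tendsto_mult tendsto_prod k_tendsto tendsto_const)
  also have "(\<Prod>i<j. transition ((par ^^ i) x)) * m t = m x" using prod[of j] x by simp
  finally show ?thesis
  proof (rule Lim_transform_eventually)
    show "\<forall>\<^sub>F q in sequentially. (\<Prod>i<j. real (k q ((par ^^ i) x)) / real q) * m t
        = (\<Sum>y\<in>fibre q x. mq q y) * m t / real q powi l t"
      using eventually_ge_at_top[of 1]
    proof eventually_elim
      case (elim q)
      interpret L: cone_lift E \<omega> l m q "Eq q" "\<omega>q q" "lq q" "k q" t "tq q" "\<pi> q" by (rule lifts[OF elim])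
      show ?case using elim by (simp add: L.measure_fibre[OF x])
    qed
  qed
qed

lemma finite_fibre: "(par ^^ j) x = t \<Longrightarrow> 1 \<le> q \<Longrightarrow> finite (fibre q x)"
  using cone_lift.finite_card_fibre[OF lifts] by blast

text \<open>A multiplicity \<open>k q y\<close> may vanish for small \<open>q\<close>, but the
  normalised mass of the fibre has a positive limit.\<close>

lemma fibre_nonempty:
  assumes x: "(par ^^ j) x = t" shows "\<forall>\<^sub>F q in sequentially. fibre q x \<noteq> {}"
  using order_tendstoD(1)[OF measure_fibre_tendsto[OF x] flow_pos]
  by eventually_elim auto

text \<open>Three errors: a tail on each tree and the difference of the truncated sums. Both tails
  obey one bound because \<open>B\<close> and \<open>n\<close> do not depend on \<open>q\<close>;
  the truncated sum on the homogeneous tree depends on \<open>y\<close> only through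
  \<open>\<pi> q y\<close>, which gives uniformity along the fibre.\<close>

lemma nc_eval_lift_approx:
  assumes c: "c \<in> H21" and f: "\<And>y. cmod (f y) \<le> B"
    and n: "B * (\<Sum>N. \<Sum>\<alpha> | length \<alpha> = N + n. cmod (c \<alpha>)) < \<eta> / 4"
    and x: "(par ^^ j) x = t" and j: "n \<le> j"
  shows "\<forall>\<^sub>F q in sequentially. \<forall>y\<in>fibre q x. cmod (FTq c q (lift q f) y - FT c f x) < \<eta>"
proof -
  define P where "P q = (\<Sum>N<n. nc_homogeneous c (shift E \<omega>) (avg E \<omega> (\<lambda>y. real (k q y) / real q)) N f x)" for q
  define P0 where "P0 = (\<Sum>N<n. nc_homogeneous c (shift E \<omega>) (shift_adj E \<omega> m) N f x)"
  have B: "0 \<le> B" using f[of x] norm_ge_zero[of "f x"] by linarith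
  have "(\<Sum>N. \<Sum>\<alpha> | length \<alpha> = N + n. cmod (c \<alpha>)) \<ge> 0"
  proof (rule suminf_nonneg)
    have "summable (\<lambda>N. \<Sum>\<alpha> | length \<alpha> = N. cmod (c \<alpha>))" using c by (simp add: H21_def)
    from summable_ignore_initial_segment[OF this, of n]
    show "summable (\<lambda>N. \<Sum>\<alpha> | length \<alpha> = N + n. cmod (c \<alpha>))" .
  qed (simp add: sum_nonneg)
  from mult_nonneg_nonneg[OF B this] have \<eta>: "0 < \<eta>" using n by simp
  have "P \<longlonglongrightarrow> P0"
    unfolding P_def P0_def shift_adj_eq_avg
    by (intro tendsto_sum nc_homogeneous_tendsto k_tendsto)
  then have "\<forall>\<^sub>F q in sequentially. dist (P q) P0 < \<eta> / 4"
    using \<eta> by (intro tendstoD) auto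
  then show ?thesis
    using eventually_ge_at_top[of 1]
  proof eventually_elim
    case (elim q)
    interpret L: cone_lift E \<omega> l m q "Eq q" "\<omega>q q" "lq q" "k q" t "tq q" "\<pi> q" by (rule lifts[OF elim(2)])
    show ?case
    proof
      fix y assume y: "y \<in> fibre q x"
      then have yt: "(L.H.par ^^ j) y = tq q" and \<pi>y: "\<pi> q y = x"
        using x L.cone_depth[of y j] by (auto simp: L.fibre_def)
      let ?g = "lift q f"
      have g: "cmod (?g z) \<le> B" for z using f B by (simp add: L.lift_def)
      have "L.H.word \<alpha> ?g y = nc_word (shift E \<omega>) (avg E \<omega> (\<lambda>y. real (k q y) / real q)) \<alpha> f x"
        if "length \<alpha> < n" for \<alpha>
        using L.word_lift[OF yt, of \<alpha> f] that j \<pi>y by simp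
      then have P: "(\<Sum>N<n. nc_homogeneous c (shift (Eq q) (\<omega>q q)) (shift_adj (Eq q) (\<omega>q q) (mq q)) N ?g y) = P q"
        unfolding P_def nc_homogeneous_def by (intro sum.cong) auto
      then have 1: "cmod (FTq c q ?g y - P q) < \<eta> / 4"
      proof -
        have "cmod (L.H.word \<alpha> ?g y) \<le> B" for \<alpha> by (rule L.H.word_bounded) (rule g)
        from nc_eval_tail(2)[OF c this, of n] P n show ?thesis by simp
      qed
      have 2: "cmod (FT c f x - P0) < \<eta> / 4"
      proof -
        have "cmod (word \<alpha> f x) \<le> B" for \<alpha> by (rule word_bounded) (rule f)
        from nc_eval_tail(2)[OF c this, of n] n show ?thesis by (simp add: P0_def)
      qed
      have "cmod (FTq c q ?g y - P0) < \<eta> / 2"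
        by (rule norm_diff_less_half[of _ "P q"]) (use 1 elim in \<open>simp_all add: dist_norm norm_minus_commute\<close>)
      moreover have "cmod (FT c f x - P0) < \<eta> / 2" using 2 \<eta> by simp
      ultimately show "cmod (FTq c q ?g y - FT c f x) < \<eta>" by (rule norm_diff_less_half)
    qed
  qed
qed

end

lemma cone_lift_family_exists:
  assumes T: "flow_tree E \<omega> l m"
    and H: "\<And>q. 1 \<le> q \<Longrightarrow> homogeneous_tree q (Eq q) (\<omega>q q) (lq q)"
  shows "\<exists>k tq \<pi>. cone_lift_family E \<omega> l m Eq \<omega>q lq t k tq \<pi>"
proof -
  interpret flow_tree E \<omega> l m by fact
  obtain k :: "nat \<Rightarrow> 'a \<Rightarrow> nat" where k: "\<And>q x. (\<Sum>y\<in>successors E \<omega> x. k q y) = q"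
      "\<And>y. (\<lambda>q. real (k q y) / real q) \<longlonglongrightarrow> transition y"
    using integer_approximation by blast
  have "\<exists>t' \<pi>. cone_lift E \<omega> l m q (Eq q) (\<omega>q q) (lq q) (k q) t t' \<pi>" if q: "1 \<le> q" for q
  proof -
    interpret H: flow_tree "Eq q" "\<omega>q q" "lq q" "canonical_flow q (lq q)"
      by (rule homogeneous_flow_tree[OF q H[OF q]])
    obtain t' where t': "lq q t' = l t" using H.level_surj by blast
    from cone_map_exists[OF T H[OF q] k(1) t'] obtain \<pi> where
      \<pi>: "\<pi> t' = t" "\<And>x. lq q x \<le> l t \<Longrightarrow> (\<forall>y\<in>successors (Eq q) (\<omega>q q) x. \<pi> y \<in> successors E \<omega> (\<pi> x)) \<and>
        (\<forall>y\<in>successors E \<omega> (\<pi> x). card {z\<in>successors (Eq q) (\<omega>q q) x. \<pi> z = y} = k q y)"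
      by blast
    have "cone_lift E \<omega> l m q (Eq q) (\<omega>q q) (lq q) (k q) t t' \<pi>"
      by unfold_locales (use q t' \<pi> in auto)
    then show ?thesis by blast
  qed
  then obtain tq \<pi> where "\<And>q. 1 \<le> q \<Longrightarrow> cone_lift E \<omega> l m q (Eq q) (\<omega>q q) (lq q) (k q) t (tq q) (\<pi> q)"
    by metis
  then have "cone_lift_family E \<omega> l m Eq \<omega>q lq t k tq \<pi>"
    by (intro cone_lift_family.intro T cone_lift_family_axioms.intro) (use k in auto)
  then show ?thesis by blast
qed

section \<open>Weighted kernel sums\<close>

text \<open>The common bound \<open>B\<close> makes each series converge, so that it commutes with
  the finite sum.\<close>

lemma (in flow_tree) nc_eval_sum:
  assumes c: "c \<in> H21" and S: "finite S" and g: "\<And>i y. i \<in> S \<Longrightarrow> cmod (g i y) \<le> B"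
  shows "nc_eval c (shift E \<omega>) (shift_adj E \<omega> m) (\<lambda>y. \<Sum>i\<in>S. a i * g i y) x =
    (\<Sum>i\<in>S. a i * nc_eval c (shift E \<omega>) (shift_adj E \<omega> m) (g i) x)"
proof -
  let ?h = "\<lambda>N f. nc_homogeneous c (shift E \<omega>) (shift_adj E \<omega> m) N f x"
  have "?h N (\<lambda>y. \<Sum>i\<in>S. a i * g i y) = (\<Sum>i\<in>S. a i * ?h N (g i))" for N
    unfolding nc_homogeneous_def shift_adj_eq_avg word_sum[OF S] sum_distrib_left
    by (subst sum.swap) (simp add: mult_ac)
  moreover have s: "summable (\<lambda>N. ?h N (g i))" if "i \<in> S" for i
    by (rule nc_eval_tail(1)[OF c, of _ _ _ _ B]) (intro word_bounded g that)
  ultimately have "nc_eval c (shift E \<omega>) (shift_adj E \<omega> m) (\<lambda>y. \<Sum>i\<in>S. a i * g i y) x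
      = (\<Sum>i\<in>S. \<Sum>N. a i * ?h N (g i))"
    unfolding nc_eval_def by (simp add: suminf_sum summable_mult)
  also have "\<dots> = (\<Sum>i\<in>S. a i * nc_eval c (shift E \<omega>) (shift_adj E \<omega> m) (g i) x)"
    unfolding nc_eval_def by (rule sum.cong) (auto intro!: suminf_mult s)
  finally show ?thesis .
qed

context cone_lift_family
begin

text \<open>The indicators of the vertices of a finite fibre add up to the lifted indicator of
  \<open>x\<close>, so transposition and linearity suffice.\<close>

lemma kernel_fibre_sum:
  assumes c: "c \<in> H21" and q: "1 \<le> q" and x: "(par ^^ j) x = t"
  shows "(\<Sum>x'\<in>fibre q x. integral_kernel (mq q) (FTq c q) x' y' * of_real (mq q x'))
    = FTq (transpose_series c) q (lift q (\<lambda>z. if z = x then 1 else 0)) y'"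
proof -
  interpret L: cone_lift E \<omega> l m q "Eq q" "\<omega>q q" "lq q" "k q" t "tq q" "\<pi> q" by (rule lifts[OF q])
  let ?\<delta> = "\<lambda>x' z. if z = x' then 1 else 0 :: complex"
  note fin = finite_fibre[OF x q]
  have "(\<Sum>x'\<in>fibre q x. integral_kernel (mq q) (FTq c q) x' y' * of_real (mq q x'))
      = (\<Sum>x'\<in>fibre q x. 1 * FTq (transpose_series c) q (?\<delta> x') y')"
    by (simp add: L.H.integral_kernel_mult_measure[OF c])
  also have "\<dots> = FTq (transpose_series c) q (\<lambda>z. \<Sum>x'\<in>fibre q x. 1 * ?\<delta> x' z) y'"
    by (rule L.H.nc_eval_sum[OF transpose_series_H21[OF c] fin, symmetric, of _ 1]) simp
  also have "(\<lambda>z. \<Sum>x'\<in>fibre q x. 1 * ?\<delta> x' z) = lift q (\<lambda>z. if z = x then 1 else 0)"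
    unfolding L.lift_eq_indicator using fin by (auto simp: sum.delta)
  finally show ?thesis .
qed

text \<open>The triangle inequality over the fibre bounds the kernel term, and the weight can only
  be larger on the homogeneous tree because \<open>\<pi>\<close> shrinks distances and preserves
  levels. If \<open>\<eta>\<close> exceeds the kernel term, the bound is trivial.\<close>

lemma weighted_kernel_sum_ge:
  fixes w :: "nat \<Rightarrow> int \<Rightarrow> int \<Rightarrow> real"
  assumes w: "\<And>n i j. 0 \<le> w n i j" "\<And>i j. mono (\<lambda>n. w n i j)"
    and c: "c \<in> H21" and q: "1 \<le> q" and x: "(par ^^ j) x = t" and y': "y' \<in> fibre q y"
    and close: "cmod (FTq (transpose_series c) q (lift q (\<lambda>z. if z = x then 1 else 0)) y'
      - FT (transpose_series c) (\<lambda>z. if z = x then 1 else 0) y) < \<eta>"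
  shows "w (gdist E x y) (l x) (l y) * (cmod (integral_kernel m (FT c) x y) * m x - \<eta>) \<le>
    (\<Sum>x'\<in>fibre q x. w (gdist (Eq q) x' y') (lq q x') (lq q y')
      * cmod (integral_kernel (mq q) (FTq c q) x' y') * mq q x')"
proof -
  interpret L: cone_lift E \<omega> l m q "Eq q" "\<omega>q q" "lq q" "k q" t "tq q" "\<pi> q" by (rule lifts[OF q])
  let ?K = "integral_kernel m (FT c) x y" and ?Kq = "\<lambda>x'. integral_kernel (mq q) (FTq c q) x' y'"
  have "cmod (?K * of_real (m x)) - \<eta> \<le> cmod (\<Sum>x'\<in>fibre q x. ?Kq x' * of_real (mq q x'))"
    unfolding kernel_fibre_sum[OF c q x] integral_kernel_mult_measure[OF c]
    using close norm_triangle_ineq2[of "FT (transpose_series c) (\<lambda>z. if z = x then 1 else 0) y"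
      "FTq (transpose_series c) q (lift q (\<lambda>z. if z = x then 1 else 0)) y'"]
    by (simp add: norm_minus_commute)
  also have "\<dots> \<le> (\<Sum>x'\<in>fibre q x. cmod (?Kq x') * mq q x')"
    by (rule sum_norm_le) (simp add: norm_mult less_imp_le[OF L.H.flow_pos])
  finally have "cmod ?K * m x - \<eta> \<le> (\<Sum>x'\<in>fibre q x. cmod (?Kq x') * mq q x')"
    by (simp add: norm_mult less_imp_le[OF flow_pos])
  then have "w (gdist E x y) (l x) (l y) * (cmod ?K * m x - \<eta>)
      \<le> (\<Sum>x'\<in>fibre q x. w (gdist E x y) (l x) (l y) * (cmod (?Kq x') * mq q x'))"
    unfolding sum_distrib_left[symmetric] by (rule mult_left_mono) (rule w)
  also have "\<dots> \<le> (\<Sum>x'\<in>fibre q x. w (gdist (Eq q) x' y') (lq q x') (lq q y') * (cmod (?Kq x') * mq q x'))"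
  proof (intro sum_mono mult_right_mono)
    fix x' assume x': "x' \<in> fibre q x"
    have "gdist E x y \<le> gdist (Eq q) x' y'"
      using L.gdist_lift[of x' y'] x' y' by (simp add: L.fibre_def)
    then show "w (gdist E x y) (l x) (l y) \<le> w (gdist (Eq q) x' y') (lq q x') (lq q y')"
      unfolding L.fibre_level[OF x'] L.fibre_level[OF y'] by (rule monoD[OF w(2)])
  qed (simp add: less_imp_le[OF L.H.flow_pos])
  finally show ?thesis by (simp only: mult.assoc)
qed

end

lemma weighted_kernel_le_liminf:
  fixes E :: "'a rel" and Eq :: "nat \<Rightarrow> 'b rel" and w :: "nat \<Rightarrow> int \<Rightarrow> int \<Rightarrow> real"
  assumes T: "flow_tree E \<omega> l m"
    and H: "\<And>q. 1 \<le> q \<Longrightarrow> homogeneous_tree q (Eq q) (\<omega>q q) (lq q)"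
    and c: "c \<in> H21"
    and w: "\<And>n i j. 0 \<le> w n i j" "\<And>i j. mono (\<lambda>n. w n i j)"
  defines "mq \<equiv> \<lambda>q. canonical_flow q (lq q)"
  defines "FT \<equiv> nc_eval c (shift E \<omega>) (shift_adj E \<omega> m)"
  defines "FTq \<equiv> \<lambda>q. nc_eval c (shift (Eq q) (\<omega>q q)) (shift_adj (Eq q) (\<omega>q q) (mq q))"
  shows "(SUP y. \<Sum>\<^sub>\<infinity>x. ennreal (w (gdist E x y) (l x) (l y) * cmod (integral_kernel m FT x y) * m x))
    \<le> liminf (\<lambda>q. SUP y. \<Sum>\<^sub>\<infinity>x. ennreal (w (gdist (Eq q) x y) (lq q x) (lq q y)
        * cmod (integral_kernel (mq q) (FTq q) x y) * mq q x))"
    (is "?lhs \<le> liminf ?rhs")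
  unfolding le_Liminf_iff
proof (intro allI impI)
  interpret flow_tree E \<omega> l m by (rule T)
  fix z assume "z < ?lhs"
  then obtain y where y: "z < (\<Sum>\<^sub>\<infinity>x. ennreal (w (gdist E x y) (l x) (l y) * cmod (integral_kernel m FT x y) * m x))"
    by (auto simp: less_SUP_iff)
  define v where "v x = w (gdist E x y) (l x) (l y)" for x
  define K where "K x = cmod (integral_kernel m FT x y) * m x" for x
  have v0: "0 \<le> v x" and K0: "0 \<le> K x" for x
    using w(1) flow_pos[of x] by (simp_all add: v_def K_def)
  have "z < (\<Sum>\<^sub>\<infinity>x. ennreal (v x * K x))" using y by (simp add: v_def K_def mult.assoc)
  also have "\<dots> = (SUP S\<in>{S. finite S \<and> S \<subseteq> UNIV}. \<Sum>x\<in>S. ennreal (v x * K x))"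
    by (rule nonneg_infsum_complete) simp
  finally obtain S where S: "finite S" and "z < (\<Sum>x\<in>S. ennreal (v x * K x))"
    by (auto simp: less_SUP_iff)
  then have zS: "z < ennreal (\<Sum>x\<in>S. v x * K x)"
    by (simp add: v0 K0)
  then obtain C where C: "z = ennreal C" "0 \<le> C" by (cases z) (auto simp: top_unique)
  then have CS: "C < (\<Sum>x\<in>S. v x * K x)" using zS by (simp add: ennreal_less_iff)
  define V where "V = (\<Sum>x\<in>S. v x)"
  have V0: "0 \<le> V" unfolding V_def by (intro sum_nonneg v0)
  \<comment> \<open>Makes the total loss \<open>\<eta> * V\<close> smaller than the gap above
    \<open>C\<close>; the summand 1 guards against \<open>V = 0\<close>.\<close>
  define \<eta> where "\<eta> = ((\<Sum>x\<in>S. v x * K x) - C) / (V + 1)"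
  have \<eta>: "0 < \<eta>" using CS V0 by (simp add: \<eta>_def)
  have "\<eta> * V < \<eta> * (V + 1)" using \<eta> by simp
  also have "\<dots> = (\<Sum>x\<in>S. v x * K x) - C" using V0 by (simp add: \<eta>_def)
  finally have CV: "C < (\<Sum>x\<in>S. v x * (K x - \<eta>))"
    by (simp add: V_def right_diff_distrib sum_subtractf sum_distrib_left mult.commute[of \<eta>] sum_distrib_right)
  note c' = transpose_series_H21[OF c]
  obtain n where n: "(\<Sum>N. \<Sum>\<alpha> | length \<alpha> = N + n. cmod (transpose_series c \<alpha>)) < \<eta> / 4"
    using H21_tail_small[OF c', of "\<eta> / 4"] \<eta> by auto
  \<comment> \<open>The depth \<open>n\<close> serves the evaluation point \<open>y\<close>; the
    vertices of \<open>S\<close> enter through their fibres, which are finite because these vertices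
    descend from \<open>t\<close>.\<close>
  obtain t where t: "\<forall>x\<in>insert y S. \<exists>j\<ge>n. (par ^^ j) x = t"
    using finite_common_ancestor[of "insert y S" n] S by auto
  obtain k tq \<pi> where "cone_lift_family E \<omega> l m Eq \<omega>q lq t k tq \<pi>"
    using cone_lift_family_exists[where t = t, OF T H] by blast
  then interpret F: cone_lift_family E \<omega> l m Eq \<omega>q lq t k tq \<pi> .
  obtain jy where jy: "(par ^^ jy) y = t" "n \<le> jy" using t by auto
  have "\<forall>\<^sub>F q in sequentially. \<forall>y'\<in>F.fibre q y.
      cmod (F.FTq (transpose_series c) q (F.lift q (\<lambda>z. if z = x then 1 else 0)) y'
        - F.FT (transpose_series c) (\<lambda>z. if z = x then 1 else 0) y) < \<eta>" for x
    by (rule F.nc_eval_lift_approx[OF c' _ _ jy, of _ 1]) (use n in auto)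
  then have "\<forall>\<^sub>F q in sequentially. \<forall>x\<in>S. \<forall>y'\<in>F.fibre q y.
      cmod (F.FTq (transpose_series c) q (F.lift q (\<lambda>z. if z = x then 1 else 0)) y'
        - F.FT (transpose_series c) (\<lambda>z. if z = x then 1 else 0) y) < \<eta>"
    by (intro eventually_ball_finite[OF S]) blast
  then show "\<forall>\<^sub>F q in sequentially. z < ?rhs q"
    using F.fibre_nonempty[OF jy(1)] eventually_ge_at_top[of 1]
  proof eventually_elim
    case (elim q)
    interpret L: cone_lift E \<omega> l m q "Eq q" "\<omega>q q" "lq q" "k q" t "tq q" "\<pi> q" by (rule F.lifts[OF elim(3)])
    \<comment> \<open>One point over \<open>y\<close> is enough, since a supremum is to be bounded
      below.\<close>
    obtain y' where y': "y' \<in> F.fibre q y" using elim(2) by blast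
    define h where "h x' = w (gdist (Eq q) x' y') (lq q x') (lq q y')
      * cmod (integral_kernel (mq q) (FTq q) x' y') * mq q x'" for x'
    have h0: "0 \<le> h x'" for x'
      using w(1) L.H.flow_pos[of x'] by (simp add: h_def mq_def)
    have fin: "finite (F.fibre q x)" if "x \<in> S" for x
      using t that F.finite_fibre[OF _ elim(3)] by blast
    have "v x * (K x - \<eta>) \<le> (\<Sum>x'\<in>F.fibre q x. h x')" if x: "x \<in> S" for x
    proof -
      obtain j where j: "(par ^^ j) x = t" using t x by blast
      from F.weighted_kernel_sum_ge[OF w c elim(3) j y', of \<eta>] elim(1) x y'
      show ?thesis by (simp add: v_def K_def h_def FT_def FTq_def mq_def)
    qed
    then have "(\<Sum>x\<in>S. v x * (K x - \<eta>)) \<le> (\<Sum>x\<in>S. \<Sum>x'\<in>F.fibre q x. h x')"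
      by (rule sum_mono)
    \<comment> \<open>Fibres over different vertices are disjoint, so nothing is counted
      twice.\<close>
    also have "\<dots> = (\<Sum>x'\<in>(\<Union>x\<in>S. F.fibre q x). h x')"
      by (rule sum.UNION_disjoint[symmetric]) (use S fin in \<open>auto simp: L.fibre_def\<close>)
    finally have "C < (\<Sum>x'\<in>(\<Union>x\<in>S. F.fibre q x). h x')" using CV by simp
    then have "z < (\<Sum>x'\<in>(\<Union>x\<in>S. F.fibre q x). ennreal (h x'))"
      using C h0 by (simp add: ennreal_less_iff sum_nonneg)
    also have "\<dots> \<le> (SUP S\<in>{S. finite S \<and> S \<subseteq> UNIV}. \<Sum>x'\<in>S. ennreal (h x'))"
      by (rule SUP_upper) (use S fin in auto)
    also have "\<dots> = (\<Sum>\<^sub>\<infinity>x'. ennreal (h x'))"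
      by (rule nonneg_infsum_complete[symmetric]) simp
    also have "\<dots> \<le> ?rhs q"
      unfolding h_def by (rule SUP_upper) simp
    finally show ?case .
  qed
qed

section \<open>Operator norms\<close>

lemma (in cone_lift) lift_powr_sum_le:
  assumes S: "finite S" and G: "finite G" "\<And>x. x \<in> G \<Longrightarrow> \<exists>j. (T.par ^^ j) x = t"
    and f: "\<And>x. x \<notin> G \<Longrightarrow> f x = 0"
  shows "(\<Sum>y\<in>S. cmod (lift f y) powr r * canonical_flow q l' y)
    \<le> (\<Sum>x\<in>G. cmod (f x) powr r * (\<Sum>y\<in>fibre x. canonical_flow q l' y))"
proof -
  have fin: "finite (fibre x)" if "x \<in> G" for x using finite_card_fibre G(2)[OF that] by blast
  have "(\<Sum>y\<in>S. cmod (lift f y) powr r * canonical_flow q l' y)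
      = (\<Sum>y\<in>S \<inter> (\<Union>x\<in>G. fibre x). cmod (lift f y) powr r * canonical_flow q l' y)"
  proof (rule sum.mono_neutral_right[OF S])
    show "\<forall>y\<in>S - S \<inter> (\<Union>x\<in>G. fibre x). cmod (lift f y) powr r * canonical_flow q l' y = 0"
      using f by (auto simp: lift_def fibre_def)
  qed simp
  also have "\<dots> \<le> (\<Sum>y\<in>(\<Union>x\<in>G. fibre x). cmod (lift f y) powr r * canonical_flow q l' y)"
    by (rule sum_mono2) (use G fin in \<open>auto simp: less_imp_le[OF H.flow_pos]\<close>)
  also have "\<dots> = (\<Sum>x\<in>G. \<Sum>y\<in>fibre x. cmod (lift f y) powr r * canonical_flow q l' y)"
    by (rule sum.UNION_disjoint) (use G fin in \<open>auto simp: fibre_def\<close>)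
  also have "\<dots> = (\<Sum>x\<in>G. \<Sum>y\<in>fibre x. cmod (f x) powr r * canonical_flow q l' y)"
    by (intro sum.cong) (auto simp: lift_def fibre_def)
  finally show ?thesis by (simp add: sum_distrib_left)
qed

lemma Lp_opnorm_le_D:
  assumes "Lp_opnorm (weighted_measure m) p A \<le> C" "Lp_norm (weighted_measure m) p f \<le> 1"
  shows "Lp_norm (weighted_measure m) p (A f) \<le> C"
proof -
  have "Lp_norm (weighted_measure m) p (A f) \<le> Lp_opnorm (weighted_measure m) p A"
    unfolding Lp_opnorm_def by (rule SUP_upper) (use assms(2) in \<open>simp add: weighted_measure_def\<close>)
  then show ?thesis using assms(1) by (rule order_trans)
qed

context cone_lift_family
begin

text \<open>In the supremum norm a lift is never larger than \<open>f\<close>, and a single vertex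
  serves as witness.\<close>

lemma Lp_opnorm_lift_infinity:
  assumes q: "1 \<le> q" and f: "\<And>x. cmod (f x) \<le> 1" and y: "C < cmod (FTq c q (lift q f) y)" and C: "0 \<le> C"
  shows "ennreal C < Lp_opnorm (weighted_measure (mq q)) \<infinity> (FTq c q)"
proof (rule ccontr)
  interpret L: cone_lift E \<omega> l m q "Eq q" "\<omega>q q" "lq q" "k q" t "tq q" "\<pi> q" by (rule lifts[OF q])
  assume "\<not> ?thesis"
  then have op: "Lp_opnorm (weighted_measure (mq q)) \<infinity> (FTq c q) \<le> ennreal C" by (simp only: not_less)
  have "Lp_norm (weighted_measure (mq q)) \<infinity> (lift q f) \<le> 1"
    using f by (simp add: Lp_norm_top_le_iff[of "mq q", OF L.H.flow_pos, unfolded infinity_ennreal_def] L.lift_def)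
  from Lp_opnorm_le_D[OF op this]
  have "Lp_norm (weighted_measure (mq q)) \<infinity> (FTq c q (lift q f)) \<le> ennreal C" .
  then have "ennreal (cmod (FTq c q (lift q f) y)) \<le> ennreal C"
    unfolding Lp_norm_top_le_iff[of "mq q", OF L.H.flow_pos] by blast
  then show False using y C by (simp add: ennreal_le_iff)
qed

text \<open>The test function is the lift of \<open>f\<close>, scaled by a power of
  \<open>J\<close>, which bounds the p-th power of its norm. The function \<open>u\<close> bounds
  the image from below; both estimates are expressed through fibre masses, so that their limits can
  be used.\<close>

lemma Lp_opnorm_lift:
  assumes c: "c \<in> H21" and q: "1 \<le> q" and p: "1 \<le> p" "p < \<infinity>" and C: "0 \<le> C" and J: "0 < J"
    and G: "finite G" "\<And>x. x \<in> G \<Longrightarrow> \<exists>j. (par ^^ j) x = t"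
    and S: "finite S" "\<And>x. x \<in> S \<Longrightarrow> \<exists>j. (par ^^ j) x = t"
    and f: "\<And>x. x \<notin> G \<Longrightarrow> f x = 0"
    and u: "\<And>x. x \<in> S \<Longrightarrow> 0 \<le> u x" "\<And>x y. x \<in> S \<Longrightarrow> y \<in> fibre q x \<Longrightarrow> u x \<le> cmod (FTq c q (lift q f) y)"
    and fG: "(\<Sum>x\<in>G. cmod (f x) powr enn2real p * (\<Sum>y\<in>fibre q x. mq q y)) \<le> J"
    and uS: "C powr enn2real p * J < (\<Sum>x\<in>S. u x powr enn2real p * (\<Sum>y\<in>fibre q x. mq q y))"
  shows "ennreal C < Lp_opnorm (weighted_measure (mq q)) p (FTq c q)"
proof (rule ccontr)
  interpret L: cone_lift E \<omega> l m q "Eq q" "\<omega>q q" "lq q" "k q" t "tq q" "\<pi> q" by (rule lifts[OF q])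
  define r where "r = enn2real p"
  have r: "1 \<le> r" unfolding r_def by (rule enn2real_ge_1[OF p])
  define a where "a = J powr (- 1 / r)"
  have "a powr r = J powr (- 1)" using r by (simp add: a_def powr_powr)
  then have a: "0 < a" "a powr r = 1 / J" using J by (simp_all add: a_def powr_minus_divide)
  define g where "g y = of_real a * lift q f y" for y
  have "(\<Sum>y\<in>S'. cmod (g y) powr r * mq q y) \<le> 1" if S': "finite S'" for S'
  proof -
    have "(\<Sum>y\<in>S'. cmod (g y) powr r * mq q y) = (\<Sum>y\<in>S'. cmod (lift q f y) powr r * mq q y) / J"
      using a by (simp add: g_def norm_mult powr_mult sum_divide_distrib)
    also have "\<dots> \<le> J / J"
      using L.lift_powr_sum_le[where r = r and f = f, OF S' G f] fG J by (intro divide_right_mono) (auto simp: r_def)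
    finally show ?thesis using J by simp
  qed
  then have "Lp_norm (weighted_measure (mq q)) p g \<le> ennreal 1"
    by (subst Lp_norm_le_iff_sum[OF L.H.flow_pos p]) (auto simp: r_def)
  then have g: "Lp_norm (weighted_measure (mq q)) p g \<le> 1" by simp
  assume "\<not> ?thesis"
  then have op: "Lp_opnorm (weighted_measure (mq q)) p (FTq c q) \<le> ennreal C" by (simp only: not_less)
  from Lp_opnorm_le_D[OF op g]
  have "Lp_norm (weighted_measure (mq q)) p (FTq c q g) \<le> ennreal C" .
  then have le: "(\<Sum>y\<in>S'. cmod (FTq c q g y) powr r * mq q y) \<le> C powr r" if "finite S'" for S'
    using that by (subst (asm) Lp_norm_le_iff_sum[OF L.H.flow_pos p C]) (auto simp: r_def)
  have fin: "finite (fibre q x)" if "x \<in> S" for x using finite_fibre[OF _ q] S(2)[OF that] by blast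
  \<comment> \<open>A uniform bound lets \<open>nc_eval_sum\<close> pull the scalar \<open>a\<close>
    out of the series; it exists because \<open>f\<close> has finite support.\<close>
  have "\<exists>B. \<forall>y. cmod (lift q f y) \<le> B"
  proof (intro exI allI)
    fix y
    have "cmod (f x) \<le> (\<Sum>x\<in>G. cmod (f x))" for x
      using member_le_sum[of x G "\<lambda>x. cmod (f x)"] G(1) f[of x] by (cases "x \<in> G") (auto simp: sum_nonneg)
    then show "cmod (lift q f y) \<le> (\<Sum>x\<in>G. cmod (f x))" by (simp add: L.lift_def sum_nonneg)
  qed
  then obtain B where B: "\<And>y. cmod (lift q f y) \<le> B" by blast
  have Fg: "FTq c q g y = of_real a * FTq c q (lift q f) y" for y
    using L.H.nc_eval_sum[OF c, of "{()}" "\<lambda>_. lift q f" B "\<lambda>_. of_real a" y] B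
    by (simp add: g_def[abs_def])
  have "(\<Sum>x\<in>S. u x powr r * (\<Sum>y\<in>fibre q x. mq q y))
      \<le> (\<Sum>x\<in>S. \<Sum>y\<in>fibre q x. cmod (FTq c q (lift q f) y) powr r * mq q y)"
    unfolding sum_distrib_left using r u
    by (intro sum_mono mult_right_mono powr_mono2) (auto simp: less_imp_le[OF L.H.flow_pos])
  also have "\<dots> = (\<Sum>y\<in>(\<Union>x\<in>S. fibre q x). cmod (FTq c q (lift q f) y) powr r * mq q y)"
    by (rule sum.UNION_disjoint[symmetric]) (use S fin in \<open>auto simp: L.fibre_def\<close>)
  also have "\<dots> = (\<Sum>y\<in>(\<Union>x\<in>S. fibre q x). cmod (FTq c q g y) powr r * mq q y) * J"
    using a J by (simp add: Fg norm_mult powr_mult sum_distrib_right)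
  also have "\<dots> \<le> C powr r * J"
    using J S fin by (intro mult_right_mono le) auto
  finally show False using uS by (simp add: r_def)
qed

end

lemma Lp_opnorm_le_liminf:
  fixes E :: "'a rel" and Eq :: "nat \<Rightarrow> 'b rel"
  assumes T: "flow_tree E \<omega> l m"
    and H: "\<And>q. 1 \<le> q \<Longrightarrow> homogeneous_tree q (Eq q) (\<omega>q q) (lq q)"
    and c: "c \<in> H21" and p: "1 \<le> p"
  defines "mq \<equiv> \<lambda>q. canonical_flow q (lq q)"
  defines "FT \<equiv> nc_eval c (shift E \<omega>) (shift_adj E \<omega> m)"
  defines "FTq \<equiv> \<lambda>q. nc_eval c (shift (Eq q) (\<omega>q q)) (shift_adj (Eq q) (\<omega>q q) (mq q))"
  shows "Lp_opnorm (weighted_measure m) p FT \<le> liminf (\<lambda>q. Lp_opnorm (weighted_measure (mq q)) p (FTq q))"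
  unfolding le_Liminf_iff
proof (intro allI impI)
  interpret flow_tree E \<omega> l m by (rule T)
  fix z assume "z < Lp_opnorm (weighted_measure m) p FT"
  then obtain f where f: "Lp_norm (weighted_measure m) p f \<le> 1" and zf: "z < Lp_norm (weighted_measure m) p (FT f)"
    unfolding Lp_opnorm_def by (auto simp: less_SUP_iff)
  obtain C where C: "z = ennreal C" "0 \<le> C" using zf by (cases z) (auto simp: top_unique)
  \<comment> \<open>The common core of both cases of \<open>p\<close>: up to \<open>\<eta>\<close>,
    the modulus of \<open>FT f\<close> at a point of \<open>S\<close> is a lower bound on the whole
    fibre for the image of the lift of a finitely supported function. The families are quantified
    inside because \<open>t\<close> depends on \<open>S\<close> and \<open>G\<close>.\<close>
  have reduce: "\<exists>G n t. finite G \<and> (\<forall>x\<in>S \<union> G. \<exists>j\<ge>n. (par ^^ j) x = t) \<and>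
      (\<forall>k tq \<pi>. cone_lift_family E \<omega> l m Eq \<omega>q lq t k tq \<pi> \<longrightarrow>
        (\<forall>\<^sub>F q in sequentially. \<forall>x\<in>S. \<forall>y\<in>cone_lift.fibre (Eq q) (\<omega>q q) (tq q) (\<pi> q) x.
          cmod (FT f x) - \<eta> < cmod (FTq q (cone_lift.lift (Eq q) (\<omega>q q) (tq q) (\<pi> q) (\<lambda>x. if x \<in> G then f x else 0)) y)))"
    if \<eta>: "0 < \<eta>" and S: "finite S" for \<eta> S
  proof -
    obtain G where G: "finite G"
      "\<And>x. x \<in> S \<Longrightarrow> cmod (FT f x - FT (\<lambda>x. if x \<in> G then f x else 0) x) < \<eta> / 2"
      using nc_eval_finite_support_approx[OF c p f S, of "\<eta> / 2"] \<eta> unfolding FT_def by auto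
    let ?f = "\<lambda>x. if x \<in> G then f x else 0"
    define B where "B = (\<Sum>x\<in>G. cmod (f x))"
    have B0: "0 \<le> B" by (simp add: B_def sum_nonneg)
    have fB: "cmod (?f x) \<le> B" for x
      using member_le_sum[of x G "\<lambda>x. cmod (f x)"] G(1) B0 by (auto simp: B_def)
    \<comment> \<open>Half of \<open>\<eta>\<close> goes to restricting \<open>f\<close>, half to
      lifting it, and a tail may use a quarter of the latter, hence the 8; the summand 1 covers
      \<open>B = 0\<close>.\<close>
    obtain n where n: "(\<Sum>N. \<Sum>\<alpha> | length \<alpha> = N + n. cmod (c \<alpha>)) < \<eta> / 8 / (B + 1)"
      using H21_tail_small[OF c, of "\<eta> / 8 / (B + 1)"] \<eta> B0 by auto
    have "B * (\<Sum>N. \<Sum>\<alpha> | length \<alpha> = N + n. cmod (c \<alpha>)) \<le> B * (\<eta> / 8 / (B + 1))"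
      using n B0 by (intro mult_left_mono) auto
    also have "\<dots> < \<eta> / 2 / 4" using B0 \<eta> by (simp add: field_simps)
    finally have Bn: "B * (\<Sum>N. \<Sum>\<alpha> | length \<alpha> = N + n. cmod (c \<alpha>)) < \<eta> / 2 / 4" .
    obtain t where t: "\<forall>x\<in>S \<union> G. \<exists>j\<ge>n. (par ^^ j) x = t"
      using finite_common_ancestor[of "S \<union> G" n] S G by auto
    have "\<forall>\<^sub>F q in sequentially. \<forall>x\<in>S. \<forall>y\<in>cone_lift.fibre (Eq q) (\<omega>q q) (tq q) (\<pi> q) x.
        cmod (FT f x) - \<eta> < cmod (FTq q (cone_lift.lift (Eq q) (\<omega>q q) (tq q) (\<pi> q) ?f) y)"
      if "cone_lift_family E \<omega> l m Eq \<omega>q lq t k tq \<pi>" for k tq \<pi>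
    proof -
      interpret F: cone_lift_family E \<omega> l m Eq \<omega>q lq t k tq \<pi> by fact
      have "\<forall>\<^sub>F q in sequentially. \<forall>y\<in>F.fibre q x. cmod (F.FTq c q (F.lift q ?f) y - F.FT c ?f x) < \<eta> / 2"
        if x: "x \<in> S" for x
      proof -
        obtain j where "(par ^^ j) x = t" "n \<le> j" using t x by blast
        then show ?thesis by (rule F.nc_eval_lift_approx[OF c fB Bn])
      qed
      then have "\<forall>\<^sub>F q in sequentially. \<forall>x\<in>S. \<forall>y\<in>F.fibre q x.
          cmod (F.FTq c q (F.lift q ?f) y - F.FT c ?f x) < \<eta> / 2"
        by (intro eventually_ball_finite[OF S]) blast
      then show ?thesis
      proof eventually_elim
        case (elim q)
        show ?case
        proof (intro ballI)
          fix x y assume x: "x \<in> S" and y: "y \<in> F.fibre q x"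
          have "cmod (F.FTq c q (F.lift q ?f) y - F.FT c f x) < \<eta>"
            by (rule norm_diff_less_half[of _ "F.FT c ?f x"])
               (use elim x y G(2)[OF x] in \<open>simp_all add: FT_def\<close>)
          then show "cmod (FT f x) - \<eta> < cmod (FTq q (F.lift q ?f) y)"
            using norm_triangle_ineq2[of "F.FT c f x" "F.FTq c q (F.lift q ?f) y"]
            by (simp add: FT_def FTq_def mq_def norm_minus_commute)
        qed
      qed
    qed
    with G t show ?thesis by blast
  qed
  show "\<forall>\<^sub>F q in sequentially. z < Lp_opnorm (weighted_measure (mq q)) p (FTq q)"
  proof (cases "p = \<infinity>")
    case True
    have "\<not> Lp_norm (weighted_measure m) \<infinity> (FT f) \<le> ennreal C" using zf C True by (simp add: not_le)
    then obtain x where "\<not> ennreal (cmod (FT f x)) \<le> ennreal C"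
      unfolding Lp_norm_top_le_iff[of m, OF flow_pos] by blast
    then have x: "C < cmod (FT f x)" using C by (simp add: ennreal_le_iff)
    \<comment> \<open>With this tolerance the lower bound on the fibre is exactly \<open>C\<close>,
      and it is strict.\<close>
    define \<eta> where "\<eta> = cmod (FT f x) - C"
    have \<eta>: "0 < \<eta>" using x by (simp add: \<eta>_def)
    from reduce[OF \<eta>, of "{x}"] obtain G n t where
      t: "\<forall>x\<in>{x} \<union> G. \<exists>j\<ge>n. (par ^^ j) x = t" and
      approx: "\<And>k tq \<pi>. cone_lift_family E \<omega> l m Eq \<omega>q lq t k tq \<pi> \<Longrightarrow>
        \<forall>\<^sub>F q in sequentially. \<forall>x\<in>{x}. \<forall>y\<in>cone_lift.fibre (Eq q) (\<omega>q q) (tq q) (\<pi> q) x.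
          cmod (FT f x) - \<eta> < cmod (FTq q (cone_lift.lift (Eq q) (\<omega>q q) (tq q) (\<pi> q) (\<lambda>x. if x \<in> G then f x else 0)) y)"
      by blast
    obtain k tq \<pi> where fam: "cone_lift_family E \<omega> l m Eq \<omega>q lq t k tq \<pi>"
      using cone_lift_family_exists[where t = t, OF T H] by blast
    then interpret F: cone_lift_family E \<omega> l m Eq \<omega>q lq t k tq \<pi> .
    obtain j where j: "(par ^^ j) x = t" using t by auto
    have f1: "cmod (f y) \<le> 1" for y
      using f True Lp_norm_top_le_iff[of m f 1, OF flow_pos] by simp
    show ?thesis
      using approx[OF fam] F.fibre_nonempty[OF j] eventually_ge_at_top[of 1]
    proof eventually_elim
      case (elim q)
      then obtain y where "C < cmod (FTq q (F.lift q (\<lambda>x. if x \<in> G then f x else 0)) y)"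
        by (auto simp: \<eta>_def)
      then have "ennreal C < Lp_opnorm (weighted_measure (F.mq q)) \<infinity> (F.FTq c q)"
        by (intro F.Lp_opnorm_lift_infinity[OF elim(3)]) (use f1 C in \<open>auto simp: FTq_def mq_def\<close>)
      then show ?case using C True by (simp add: FTq_def mq_def)
    qed
  next
    case False
    then have p': "p < \<infinity>" by (simp add: less_top)
    define r where "r = enn2real p"
    have r: "1 \<le> r" unfolding r_def by (rule enn2real_ge_1[OF p p'])
    have "\<not> Lp_norm (weighted_measure m) p (FT f) \<le> ennreal C" using zf C by (simp add: not_le)
    then obtain S where S: "finite S" and CS: "C powr r < (\<Sum>x\<in>S. cmod (FT f x) powr r * m x)"
      unfolding Lp_norm_le_iff_sum[where m = m and f = "FT f", OF flow_pos p p' C(2)] by (auto simp: r_def not_le)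
    \<comment> \<open>Cut off at zero, so that \<open>powr\<close> is applied to a nonnegative lower
      bound and stays continuous in \<open>\<eta>\<close>.\<close>
    define u where "u \<eta> x = max 0 (cmod (FT f x) - \<eta>)" for \<eta> x
    have "((\<lambda>\<eta>. \<Sum>x\<in>S. u \<eta> x powr r * m x) \<longlongrightarrow> (\<Sum>x\<in>S. u 0 x powr r * m x)) (at_right 0)"
      unfolding u_def using r
      by (intro tendsto_sum tendsto_mult tendsto_const tendsto_powr2 tendsto_max tendsto_diff tendsto_ident_at always_eventually) auto
    then have "\<forall>\<^sub>F \<eta> in at_right 0. C powr r < (\<Sum>x\<in>S. u \<eta> x powr r * m x)"
      by (rule order_tendstoD) (use CS in \<open>simp add: u_def\<close>)
    then have "\<forall>\<^sub>F \<eta> in at_right 0. C powr r < (\<Sum>x\<in>S. u \<eta> x powr r * m x) \<and> 0 < \<eta>"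
      using eventually_at_right_less by (rule eventually_conj)
    then obtain \<eta> where \<eta>: "0 < \<eta>" and uS: "C powr r < (\<Sum>x\<in>S. u \<eta> x powr r * m x)"
      using eventually_happens'[OF trivial_limit_at_right_real] by blast
    \<comment> \<open>The fibre masses only converge to \<open>m\<close>, so the rescaled lift may
      have norm slightly above one; \<open>J\<close> leaves room for this.\<close>
    have "((\<lambda>J. C powr r * J) \<longlongrightarrow> C powr r * 1) (at_right 1)"
      by (intro tendsto_intros)
    then have "\<forall>\<^sub>F J in at_right 1. C powr r * J < (\<Sum>x\<in>S. u \<eta> x powr r * m x)"
      by (rule order_tendstoD) (use uS in simp)
    then have "\<forall>\<^sub>F J in at_right 1. C powr r * J < (\<Sum>x\<in>S. u \<eta> x powr r * m x) \<and> 1 < J"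
      using eventually_at_right_less by (rule eventually_conj)
    then obtain J where J: "1 < J" "C powr r * J < (\<Sum>x\<in>S. u \<eta> x powr r * m x)"
      using eventually_happens'[OF trivial_limit_at_right_real] by blast
    from reduce[OF \<eta> S] obtain G n t where G: "finite G" and
      t: "\<forall>x\<in>S \<union> G. \<exists>j\<ge>n. (par ^^ j) x = t" and
      approx: "\<And>k tq \<pi>. cone_lift_family E \<omega> l m Eq \<omega>q lq t k tq \<pi> \<Longrightarrow>
        \<forall>\<^sub>F q in sequentially. \<forall>x\<in>S. \<forall>y\<in>cone_lift.fibre (Eq q) (\<omega>q q) (tq q) (\<pi> q) x.
          cmod (FT f x) - \<eta> < cmod (FTq q (cone_lift.lift (Eq q) (\<omega>q q) (tq q) (\<pi> q) (\<lambda>x. if x \<in> G then f x else 0)) y)"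
      by blast
    let ?f = "\<lambda>x. if x \<in> G then f x else 0"
    obtain k tq \<pi> where fam: "cone_lift_family E \<omega> l m Eq \<omega>q lq t k tq \<pi>"
      using cone_lift_family_exists[where t = t, OF T H] by blast
    then interpret F: cone_lift_family E \<omega> l m Eq \<omega>q lq t k tq \<pi> .
    define M where "M q x = (\<Sum>y\<in>F.fibre q x. F.mq q y)" for q x
    \<comment> \<open>The common factor under which fibre masses converge to
      \<open>m\<close>.\<close>
    define s where "s q = m t / real q powi l t" for q
    have M: "(\<lambda>q. \<Sum>x\<in>A. v x * (M q x * s q)) \<longlonglongrightarrow> (\<Sum>x\<in>A. v x * m x)"
      if "A \<subseteq> S \<union> G" for A and v :: "'a \<Rightarrow> real"
    proof (intro tendsto_sum tendsto_mult tendsto_const)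
      fix x assume "x \<in> A"
      then have "x \<in> S \<union> G" using that by blast
      then obtain j where "(par ^^ j) x = t" using t by blast
      from F.measure_fibre_tendsto[OF this] show "(\<lambda>q. M q x * s q) \<longlonglongrightarrow> m x"
        by (simp add: M_def s_def)
    qed
    have "Lp_norm (weighted_measure m) p f \<le> ennreal 1" using f by simp
    then have "(\<Sum>x\<in>G. cmod (f x) powr r * m x) \<le> 1 powr r"
      unfolding r_def using G by (subst (asm) Lp_norm_le_iff_sum[where m = m and f = f, OF flow_pos p p']) auto
    then have "(\<Sum>x\<in>G. cmod (f x) powr r * m x) < J" using J by simp
    then have ev1: "\<forall>\<^sub>F q in sequentially. (\<Sum>x\<in>G. cmod (f x) powr r * (M q x * s q)) < J"
      by (intro order_tendstoD(2)[OF M]) auto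
    have ev2: "\<forall>\<^sub>F q in sequentially. C powr r * J < (\<Sum>x\<in>S. u \<eta> x powr r * (M q x * s q))"
      by (intro order_tendstoD(1)[OF M]) (use J in auto)
    show ?thesis
      using approx[OF fam] ev1 ev2 eventually_ge_at_top[of 1]
    proof eventually_elim
      case (elim q)
      have s: "0 < s q" using elim(4) flow_pos[of t] by (simp add: s_def)
      \<comment> \<open>Undoing the normalisation replaces \<open>J\<close> by
        \<open>J / s q\<close>; the factor \<open>s q\<close> occurs in the estimates of the lift
        and of its image alike and cancels.\<close>
      have "ennreal C < Lp_opnorm (weighted_measure (F.mq q)) p (F.FTq c q)"
      proof (rule F.Lp_opnorm_lift[OF c elim(4) p p' C(2), where G = G and S = S and f = ?f and J = "J / s q" and u = "u \<eta>"])
        show "0 < J / s q" using J s by simp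
        show "(\<Sum>x\<in>G. cmod (?f x) powr enn2real p * (\<Sum>y\<in>F.fibre q x. F.mq q y)) \<le> J / s q"
        proof -
          have "(\<Sum>x\<in>G. cmod (?f x) powr r * M q x) * s q < J"
            using elim(2) by (simp add: sum_distrib_right mult.assoc)
          then show ?thesis using s by (simp add: r_def M_def pos_le_divide_eq)
        qed
        show "C powr enn2real p * (J / s q) < (\<Sum>x\<in>S. u \<eta> x powr enn2real p * (\<Sum>y\<in>F.fibre q x. F.mq q y))"
        proof -
          have "C powr r * J < (\<Sum>x\<in>S. u \<eta> x powr r * M q x) * s q"
            using elim(3) by (simp add: sum_distrib_right mult.assoc)
          then show ?thesis using s by (simp add: r_def M_def pos_divide_less_eq)
        qed
        show "u \<eta> x \<le> cmod (F.FTq c q (F.lift q ?f) y)" if "x \<in> S" "y \<in> F.fibre q x" for x y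
          using elim(1) that by (force simp: u_def FTq_def mq_def)
      qed (use G S t in \<open>auto simp: u_def\<close>)
      then show ?case using C by (simp add: FTq_def mq_def)
    qed
  qed
qed

theorem theorem4p8:
  fixes E :: "'a rel" and \<omega> :: "(nat \<Rightarrow> 'a) set" and l :: "'a \<Rightarrow> int" and m :: "'a \<Rightarrow> real"
    and Eq :: "nat \<Rightarrow> 'b rel" and \<omega>q :: "nat \<Rightarrow> (nat \<Rightarrow> 'b) set" and lq :: "nat \<Rightarrow> 'b \<Rightarrow> int"
    and F :: nc_series
  assumes "flow_tree E \<omega> l m"
    and "\<And>q. 1 \<le> q \<Longrightarrow> homogeneous_tree q (Eq q) (\<omega>q q) (lq q)"
    and "F \<in> H21"
  defines "mq \<equiv> \<lambda>q. canonical_flow q (lq q)"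
  defines "FT \<equiv> nc_eval F (shift E \<omega>) (shift_adj E \<omega> m)"
  defines "FTq \<equiv> \<lambda>q. nc_eval F (shift (Eq q) (\<omega>q q)) (shift_adj (Eq q) (\<omega>q q) (mq q))"
  shows "(\<forall>p::ennreal. 1 \<le> p \<longrightarrow>
            Lp_opnorm (weighted_measure m) p FT
              \<le> liminf (\<lambda>q. Lp_opnorm (weighted_measure (mq q)) p (FTq q))) \<and>
         (\<forall>w :: nat \<Rightarrow> int \<Rightarrow> int \<Rightarrow> real.
            (\<forall>n i j. 0 \<le> w n i j) \<and> (\<forall>i j. mono (\<lambda>n. w n i j)) \<longrightarrow>
            (SUP y. \<Sum>\<^sub>\<infinity>x. ennreal (w (gdist E x y) (l x) (l y) * cmod (integral_kernel m FT x y) * m x))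
              \<le> liminf (\<lambda>q. SUP y. \<Sum>\<^sub>\<infinity>x.
                  ennreal (w (gdist (Eq q) x y) (lq q x) (lq q y)
                           * cmod (integral_kernel (mq q) (FTq q) x y) * mq q x)))"
  unfolding FT_def FTq_def mq_def
proof (intro conjI allI impI; (elim conjE)?)
  fix p :: ennreal assume "1 \<le> p"
  then show "Lp_opnorm (weighted_measure m) p (nc_eval F (shift E \<omega>) (shift_adj E \<omega> m))
      \<le> liminf (\<lambda>q. Lp_opnorm (weighted_measure (canonical_flow q (lq q))) p
        (nc_eval F (shift (Eq q) (\<omega>q q)) (shift_adj (Eq q) (\<omega>q q) (canonical_flow q (lq q)))))"
    by (intro Lp_opnorm_le_liminf[OF assms(1) _ assms(3)] assms(2))
qed (intro weighted_kernel_le_liminf[OF assms(1) _ assms(3)] assms(2); blast)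

end
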